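(* Let $\Sigma=\mathbb{R}^{N-1}$ or $\Sigma=\mathbb{T}^{N-1}$. Suppose that $$\lim_{|\xi|\to\infty}\frac{\mu(\xi)}{|\xi|^3}=0\quad\text{and}\quad\liminf_{|\xi|\to\infty}\mu(\xi)>0 .$$ Then there exist constants $c_1,c_2>0$, independent of $\xi$, such that for every $\xi\in\hat\Sigma$ with $|\xi|$ sufficiently large there is a solution $(u,h)$ (with an associated pressure $p$), nontrivial at frequency $\xi$ in the sense that $\mathcal{E}_\xi(0)\neq0$, of the system $$\begin{cases}\partial_tu+\nabla p=\Delta u&\text{in }\Omega\\ \operatorname{div}u=0&\text{in }\Omega\\ \partial_th=u_N&\text{on }\{y=\ell\}\\ (pI-\mathbb{D}u)e_N=M(h)e_N&\text{on }\{y=\ell\}\\ u=0&\text{on }\{y=0\}\end{cases}$$ such that, for all $t\ge0$, $$\mathcal{E}_\xi(t)\ge c_1\exp\left(-c_2\frac{\mu(\xi)}{|\xi|}t\right)\mathcal{E}_\xi(0).$$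
   Context: Fix an integer $N\ge 2$ and $\ell>0$. The cross-section is $\Sigma=\mathbb{R}^{N-1}$ or $\Sigma=\mathbb{T}^{N-1}=\mathbb{R}^{N-1}/\mathbb{Z}^{N-1}$, with dual group $\hat\Sigma=\mathbb{R}^{N-1}$ or $\hat\Sigma=\mathbb{Z}^{N-1}$ respectively. Set $\Omega=\Sigma\times(0,\ell)$, with points $(x,y)$, $x\in\Sigma$, $y\in(0,\ell)$. The unknowns are $u(\cdot,t):\Omega\to\mathbb{R}^N$, $p(\cdot,t):\Omega\to\mathbb{R}$, $h(\cdot,t):\Sigma\to\mathbb{R}$ for $t\ge0$; when $\Sigma=\mathbb{T}^{N-1}$ solutions are also required to satisfy $\int_{\mathbb{T}^{N-1}}h(x,t)\,dx=0$ for all $t\ge0$. Here $e_N=(0,\dots,0,1)$, $I$ is the $N\times N$ identity and $(\mathbb{D}u)_{ij}=\partial_iu_j+\partial_ju_i$. The Fourier transform is always in the horizontal variable $x$ only: $\hat f(\xi)=\mathcal{F}f(\xi)=\int_\Sigma f(x)e^{-2\pi i\xi\cdot x}\,dx$, $\xi\in\hat\Sigma$. Boundary operator: $\mu:\hat\Sigma\to\mathbb{R}$ satisfies, for some $\theta>0$, $\theta\le\mu(\xi)\le\frac1\theta(1+|\xi|)^3$ for all $\xi\in\hat\Sigma$, and $M$ is defined by $\mathcal{F}M(h)(\xi)=\mu(\xi)\mathcal{F}h(\xi)$. Energy at frequency $\xi$: $$\mathcal{E}_\xi(t)=\frac12\int_0^\ell|\hat u(\xi,y,t)|^2\,dy+\frac{\mu(\xi)}2|\hat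 h(\xi,t)|^2 .$$
   Formalization: The symbol μ is additionally assumed even, μ(−ξ)=μ(ξ), so that M maps real functions to real functions (for real u, p, h the claim fails at large ξ where μ(ξ)≠μ(−ξ)), and measurable when Σ is the whole space. *)

theory Defs
  imports "HOL-Analysis.Analysis"
begin

section \<open>Cross-sections and the horizontal Fourier transform\<close>

text \<open>
  The horizontal dimension is \<open>CARD('n) = N - 1\<close>, which is at least 1, so \<open>N \<ge> 2\<close>.
  Functions on the torus are 1-periodic functions on \<open>real^'n\<close>, and its dual group is the set of
  vectors with integer entries.
\<close>

datatype cross_section = Euclidean | Torus

definition dual_group :: "cross_section \<Rightarrow> (real^'n) set" where
  "dual_group S = (case S of Euclidean \<Rightarrow> UNIV | Torus \<Rightarrow> {\<xi>. \<forall>i. \<xi> $ i \<in> \<int>})"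

definition freq_at_infinity :: "cross_section \<Rightarrow> (real^'n) filter" where
  "freq_at_infinity S = inf at_infinity (principal (dual_group S))"

definition fourier_on :: "(real^'n) set \<Rightarrow> (real^'n \<Rightarrow> real) \<Rightarrow> real^'n \<Rightarrow> complex" where
  "fourier_on A f \<xi> = (LINT x:A|lebesgue. complex_of_real (f x) * cis (- 2 * pi * (\<xi> \<bullet> x)))"

text \<open>
  On the torus this is the usual integral over a fundamental cell. On the whole space it is the
  (Plancherel) Fourier transform of an \<open>L\<^sup>2\<close> function, i.e. the \<open>L\<^sup>2\<close> limit of the truncated
  integrals; \<open>F\<close> is one representative of its class. Absolutely convergent integrals would force
  \<open>F\<close> to be continuous, which is incompatible with a multiplier \<open>\<mu>\<close> that is merely measurable.
\<close>

definition is_fourier_transform ::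
  "cross_section \<Rightarrow> (real^'n \<Rightarrow> real) \<Rightarrow> (real^'n \<Rightarrow> complex) \<Rightarrow> bool" where
  "is_fourier_transform S f F \<longleftrightarrow>
    (case S of
       Torus \<Rightarrow>
         set_integrable lebesgue (cbox 0 One) f \<and>
         (\<forall>\<xi>\<in>dual_group Torus. F \<xi> = fourier_on (cbox 0 One) f \<xi>)
     | Euclidean \<Rightarrow>
         f \<in> borel_measurable lebesgue \<and> integrable lebesgue (\<lambda>x. (f x)\<^sup>2) \<and>
         F \<in> borel_measurable lebesgue \<and> integrable lebesgue (\<lambda>\<xi>. (cmod (F \<xi>))\<^sup>2) \<and>
         ((\<lambda>R. \<integral>\<^sup>+ \<xi>. ennreal ((cmod (F \<xi> - fourier_on (cball 0 R) f \<xi>))\<^sup>2) \<partial>lebesgue)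
            \<longlongrightarrow> 0) at_top)"

section \<open>The boundary operator\<close>

text \<open>
  Besides the two-sided bound, the symbol is even, which says that the operator maps real-valued
  functions to real-valued functions (as \<open>h\<close> and \<open>p\<close> are real-valued), and measurable, which is
  needed for multiplication by it to make sense (it is automatic on the torus, whose dual group is
  countable).
\<close>

definition boundary_symbol :: "cross_section \<Rightarrow> (real^'n \<Rightarrow> real) \<Rightarrow> bool" where
  "boundary_symbol S \<mu> \<longleftrightarrow>
    (\<exists>\<theta>>0. \<forall>\<xi>\<in>dual_group S. \<theta> \<le> \<mu> \<xi> \<and> \<mu> \<xi> \<le> 1 / \<theta> * (1 + norm \<xi>) ^ 3) \<and>
    (\<forall>\<xi>\<in>dual_group S. \<mu> (- \<xi>) = \<mu> \<xi>) \<and>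
    \<mu> \<in> borel_measurable (restrict_space lebesgue (dual_group S))"

text \<open>\<open>g = M(f)\<close>, where \<open>M\<close> is the Fourier multiplier with symbol \<open>\<mu>\<close>.\<close>

definition is_multiplier_image ::
  "cross_section \<Rightarrow> (real^'n \<Rightarrow> real) \<Rightarrow> (real^'n \<Rightarrow> real) \<Rightarrow> (real^'n \<Rightarrow> real) \<Rightarrow> bool" where
  "is_multiplier_image S \<mu> f g \<longleftrightarrow>
    (\<exists>F. is_fourier_transform S f F \<and>
         is_fourier_transform S g (\<lambda>\<xi>. complex_of_real (\<mu> \<xi>) * F \<xi>))"

section \<open>Differential operators on the closed layer\<close>

text \<open>A point of \<open>\<real>\<^sup>N\<close> is a pair of a horizontal vector and the height \<open>y\<close>.\<close>

type_synonym 'n point = "(real, 'n) vec \<times> real"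

definition e_N :: "'n::finite point" where
  "e_N = (0, 1)"

definition layer :: "real \<Rightarrow> ('n::finite point) set" where
  "layer L = UNIV \<times> {0<..<L}"

definition closed_layer :: "real \<Rightarrow> ('n::finite point) set" where
  "closed_layer L = UNIV \<times> {0..L}"

text \<open>
  Derivatives are taken within the closed layer: they are the ordinary ones in the interior and
  one-sided in \<open>y\<close> on the two boundary planes.
\<close>

definition pdv ::
  "real \<Rightarrow> 'n::finite point \<Rightarrow> ('n point \<Rightarrow> 'b::real_normed_vector) \<Rightarrow> 'n point \<Rightarrow> 'b" where
  "pdv L b f z = frechet_derivative f (at z within closed_layer L) b"

definition grad :: "real \<Rightarrow> ('n::finite point \<Rightarrow> real) \<Rightarrow> 'n point \<Rightarrow> 'n point" where
  "grad L p z = (\<Sum>b\<in>Basis. pdv L b p z *\<^sub>R b)"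

definition divergence :: "real \<Rightarrow> ('n::finite point \<Rightarrow> 'n point) \<Rightarrow> 'n point \<Rightarrow> real" where
  "divergence L u z = (\<Sum>b\<in>Basis. pdv L b u z \<bullet> b)"

definition laplacian :: "real \<Rightarrow> ('n::finite point \<Rightarrow> 'n point) \<Rightarrow> 'n point \<Rightarrow> 'n point" where
  "laplacian L u z = (\<Sum>b\<in>Basis. pdv L b (pdv L b u) z)"

definition sym_grad ::
  "real \<Rightarrow> ('n::finite point \<Rightarrow> 'n point) \<Rightarrow> 'n point \<Rightarrow> 'n point \<Rightarrow> 'n point \<Rightarrow> real" where
  "sym_grad L u z b c = pdv L b u z \<bullet> c + pdv L c u z \<bullet> b"

text \<open>The vector \<open>(p I - \<D>u) v\<close>, where \<open>\<D>u\<close> has the entries \<open>sym_grad L u z b c\<close>.\<close>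

definition stress ::
  "real \<Rightarrow> ('n::finite point \<Rightarrow> 'n point) \<Rightarrow> ('n point \<Rightarrow> real) \<Rightarrow> 'n point \<Rightarrow> 'n point \<Rightarrow> 'n point"
where
  "stress L u p z v =
    p z *\<^sub>R v - (\<Sum>b\<in>Basis. (\<Sum>c\<in>Basis. sym_grad L u z b c * (v \<bullet> c)) *\<^sub>R b)"

definition dt :: "(real \<Rightarrow> 'a \<Rightarrow> 'b::real_normed_vector) \<Rightarrow> real \<Rightarrow> 'a \<Rightarrow> 'b" where
  "dt f t z = vector_derivative (\<lambda>s. f s z) (at t within {0..})"

section \<open>Classical solutions\<close>

definition C0_field :: "'a::topological_space set \<Rightarrow> (real \<Rightarrow> 'a \<Rightarrow> 'b::topological_space) \<Rightarrow> bool" where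
  "C0_field A f \<longleftrightarrow> continuous_on ({0..} \<times> A) (\<lambda>(t, z). f t z)"

definition C1_space :: "real \<Rightarrow> (real \<Rightarrow> 'n::finite point \<Rightarrow> 'b::real_normed_vector) \<Rightarrow> bool" where
  "C1_space L f \<longleftrightarrow>
    C0_field (closed_layer L) f \<and>
    (\<forall>t\<ge>0. f t differentiable_on closed_layer L) \<and>
    (\<forall>b\<in>Basis. C0_field (closed_layer L) (\<lambda>t. pdv L b (f t)))"

definition C2_space :: "real \<Rightarrow> (real \<Rightarrow> 'n::finite point \<Rightarrow> 'b::real_normed_vector) \<Rightarrow> bool" where
  "C2_space L f \<longleftrightarrow> C1_space L f \<and> (\<forall>b\<in>Basis. C1_space L (\<lambda>t. pdv L b (f t)))"

definition C1_time :: "'a::topological_space set \<Rightarrow> (real \<Rightarrow> 'a \<Rightarrow> 'b::real_normed_vector) \<Rightarrow> bool" where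
  "C1_time A f \<longleftrightarrow>
    C0_field A f \<and>
    (\<forall>t\<ge>0. \<forall>z\<in>A. (\<lambda>s. f s z) differentiable (at t within {0..})) \<and>
    C0_field A (dt f)"

definition regular_fields ::
  "real \<Rightarrow> (real \<Rightarrow> 'n::finite point \<Rightarrow> 'n point) \<Rightarrow> (real \<Rightarrow> 'n point \<Rightarrow> real) \<Rightarrow>
   (real \<Rightarrow> real^'n \<Rightarrow> real) \<Rightarrow> bool" where
  "regular_fields L u p h \<longleftrightarrow>
    C2_space L u \<and> C1_time (closed_layer L) u \<and> C1_space L p \<and> C1_time UNIV h"

text \<open>On the torus the fields are periodic and \<open>h\<close> has mean zero.\<close>

definition torus_conditions ::
  "real \<Rightarrow> (real \<Rightarrow> 'n::finite point \<Rightarrow> 'n point) \<Rightarrow> (real \<Rightarrow> 'n point \<Rightarrow> real) \<Rightarrow>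
   (real \<Rightarrow> real^'n \<Rightarrow> real) \<Rightarrow> bool" where
  "torus_conditions L u p h \<longleftrightarrow>
    (\<forall>t\<ge>0. \<forall>k\<in>dual_group Torus. \<forall>x.
       (\<forall>y\<in>{0..L}. u t (x + k, y) = u t (x, y) \<and> p t (x + k, y) = p t (x, y)) \<and>
       h t (x + k) = h t x) \<and>
    (\<forall>t\<ge>0. (LINT x:cbox 0 One|lebesgue. h t x) = 0)"

definition is_solution ::
  "cross_section \<Rightarrow> real \<Rightarrow> (real^'n \<Rightarrow> real) \<Rightarrow> (real \<Rightarrow> 'n::finite point \<Rightarrow> 'n point) \<Rightarrow>
   (real \<Rightarrow> 'n point \<Rightarrow> real) \<Rightarrow> (real \<Rightarrow> real^'n \<Rightarrow> real) \<Rightarrow> bool" where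
  "is_solution S L \<mu> u p h \<longleftrightarrow>
    regular_fields L u p h \<and>
    (S = Torus \<longrightarrow> torus_conditions L u p h) \<and>
    (\<forall>t\<ge>0. \<forall>y\<in>{0..L}. \<exists>P. is_fourier_transform S (\<lambda>x. p t (x, y)) P) \<and>
    (\<forall>t\<ge>0. \<forall>z\<in>layer L. dt u t z + grad L (p t) z = laplacian L (u t) z) \<and>
    (\<forall>t\<ge>0. \<forall>z\<in>layer L. divergence L (u t) z = 0) \<and>
    (\<forall>t\<ge>0. \<forall>x. dt h t x = u t (x, L) \<bullet> e_N) \<and>
    (\<forall>t\<ge>0. \<exists>Mh. is_multiplier_image S \<mu> (h t) Mh \<and>
        (\<forall>x. stress L (u t) (p t) (x, L) e_N = Mh x *\<^sub>R e_N)) \<and>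
    (\<forall>t\<ge>0. \<forall>x. u t (x, 0) = 0)"

section \<open>Energy at a frequency\<close>

text \<open>
  \<open>U t \<xi> y b\<close> is the component along the basis vector \<open>b\<close> of the transform of \<open>u\<close>, and \<open>H t \<xi>\<close> is
  the transform of \<open>h\<close>. On the whole space, continuity in \<open>(t, y)\<close> at every fixed frequency makes
  \<open>U\<close> and \<open>H\<close> unique up to a single null set of frequencies, independent of \<open>t\<close> and \<open>y\<close>.
\<close>

definition horizontal_transforms ::
  "cross_section \<Rightarrow> real \<Rightarrow> (real \<Rightarrow> 'n::finite point \<Rightarrow> 'n point) \<Rightarrow> (real \<Rightarrow> real^'n \<Rightarrow> real) \<Rightarrow>
   (real \<Rightarrow> real^'n \<Rightarrow> real \<Rightarrow> 'n point \<Rightarrow> complex) \<Rightarrow> (real \<Rightarrow> real^'n \<Rightarrow> complex) \<Rightarrow> bool" where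
  "horizontal_transforms S L u h U H \<longleftrightarrow>
    (\<forall>t\<ge>0. is_fourier_transform S (h t) (H t)) \<and>
    (\<forall>t\<ge>0. \<forall>y\<in>{0..L}. \<forall>b\<in>Basis.
       is_fourier_transform S (\<lambda>x. u t (x, y) \<bullet> b) (\<lambda>\<xi>. U t \<xi> y b)) \<and>
    (\<forall>\<xi>\<in>dual_group S.
       continuous_on {0..} (\<lambda>t. H t \<xi>) \<and>
       (\<forall>b\<in>Basis. continuous_on ({0..} \<times> {0..L}) (\<lambda>(t, y). U t \<xi> y b)))"

definition freq_energy ::
  "real \<Rightarrow> (real^'n \<Rightarrow> real) \<Rightarrow> (real \<Rightarrow> real^'n \<Rightarrow> real \<Rightarrow> 'n::finite point \<Rightarrow> complex) \<Rightarrow>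
   (real \<Rightarrow> real^'n \<Rightarrow> complex) \<Rightarrow> real^'n \<Rightarrow> real \<Rightarrow> real" where
  "freq_energy L \<mu> U H \<xi> t =
    1 / 2 * integral {0..L} (\<lambda>y. \<Sum>b\<in>Basis. (cmod (U t \<xi> y b))\<^sup>2) +
    \<mu> \<xi> / 2 * (cmod (H t \<xi>))\<^sup>2"

text \<open>
  The lower bound at the frequency \<open>\<xi>\<close>. Since transforms on the whole space are only determined up
  to null sets, a condition at the single point \<open>\<xi>\<close> could be met by changing the representative
  there; it is therefore imposed at all frequencies in some neighbourhood of \<open>\<xi>\<close>, including \<open>\<xi>\<close>
  itself. The dual group of the torus is discrete, so there the neighbourhood is no extra demand.
\<close>

definition slow_decay_at ::
  "cross_section \<Rightarrow> real \<Rightarrow> (real^'n \<Rightarrow> real) \<Rightarrow> real \<Rightarrow> real \<Rightarrow>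
   (real \<Rightarrow> real^'n \<Rightarrow> real \<Rightarrow> 'n::finite point \<Rightarrow> complex) \<Rightarrow> (real \<Rightarrow> real^'n \<Rightarrow> complex) \<Rightarrow>
   real^'n \<Rightarrow> bool" where
  "slow_decay_at S L \<mu> c1 c2 U H \<xi> \<longleftrightarrow>
    (\<exists>V. open V \<and> \<xi> \<in> V \<and>
      (\<forall>\<eta>\<in>V \<inter> dual_group S.
         freq_energy L \<mu> U H \<eta> 0 \<noteq> 0 \<and>
         (\<forall>t\<ge>0. freq_energy L \<mu> U H \<eta> t \<ge>
            c1 * exp (- c2 * (\<mu> \<eta> / norm \<eta>) * t) * freq_energy L \<mu> U H \<eta> 0)))"

end

theory Submission
  imports Defs "HOL-Probability.Characteristic_Functions"
begin

text \<open>
  At a frequency \<open>\<eta>\<close> with \<open>k = 2\<pi>|\<eta>|\<close> look for a real mode decaying like \<open>exp (- lam t)\<close>, whose velocity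
  has the horizontal part \<open>- a(y) sin (2\<pi> \<eta>\<cdot>x) \<eta>/|\<eta>|\<close> and the vertical part \<open>b(y) cos (2\<pi> \<eta>\<cdot>x)\<close>. For
  every \<open>lam \<le> k\<^sup>2/16\<close> the resulting ordinary differential equations, with no slip at the bottom and no
  tangential stress at the top, have an explicit solution; the normal stress condition then says
  \<open>lam * R = \<mu>(\<eta>)\<close>, where \<open>R\<close> is the ratio of normal stress to normal velocity. Testing the equations
  with a mode and using a Korn inequality gives \<open>R \<ge> k\<close>, bounds \<open>R\<close> as \<open>lam\<close> tends to 0 and makes
  \<open>lam * R\<close> increasing. Hence there is a unique decay rate, it is at most \<open>\<mu>(\<eta>)/k\<close>, and it depends
  measurably on \<open>\<eta>\<close>.

  Modes are superposed against a finite measure on the frequencies: a point mass on the torus,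
  Lebesgue measure on a small ball on the whole space. In the second case the symbol \<open>\<mu>\<close> is only
  measurable, so the transforms have to be identified by \<open>L\<^sup>2\<close> inversion. The energy at each
  frequency is exactly proportional to \<open>exp (- 2 lam t)\<close>.
\<close>

section \<open>Modes of the layer at a fixed wave number\<close>

text \<open>The relation between \<open>lam\<close> and \<open>\<mu>\<close> is a quotient of
  products of hyperbolic functions, too involved to be inverted or differentiated directly. It is
  never expanded: all facts about \<open>R\<close> come from testing two modes of equal wave number
  and different rates against each other. The Korn constant 2 and the range
  \<open>lam \<le> k\<^sup>2 / 16\<close> make the inertial term at most 1/8 of the dissipation,
  which keeps the form coercive. The growth hypothesis on the symbol gives
  \<open>\<mu> \<eta> \<le> norm \<eta> ^ 3\<close>, below \<open>k ^ 3 / 16\<close>, so the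
  candidate rate \<open>\<mu> \<eta> / k\<close> stays in that range. The energy decays at the rate
  \<open>2 * lam\<close>, at most \<open>\<mu> \<eta> / (pi * norm \<eta>)\<close>, so both
  constants of the theorem can be 1. As the fields are real, every frequency brings its negative
  along; the frequency set is disjoint from its reflection, so that each value of a transform
  contains a single exponential. On the whole space one wave is not square integrable and the decay
  is demanded on a neighbourhood, hence the open set of frequencies there.\<close>

locale stokes_mode =
  fixes L k lam :: real and a a' b q :: "real \<Rightarrow> real"
  assumes L_pos: "L > 0" and k_pos: "k > 0"
    and b_deriv: "\<And>y. (b has_real_derivative k * a y) (at y)"
    and a_deriv: "\<And>y. (a has_real_derivative a' y) (at y)"
    and a'_deriv: "\<And>y. (a' has_real_derivative (k\<^sup>2 - lam) * a y + k * q y) (at y)"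
    and q_deriv: "\<And>y. (q has_real_derivative k * a' y - (k\<^sup>2 - lam) * b y) (at y)"
    and a_0: "a 0 = 0" and b_0: "b 0 = 0" and tangential: "a' L + k * b L = 0"
begin

lemma cont: "continuous_on S a" "continuous_on S a'" "continuous_on S b" "continuous_on S q"
  using a_deriv a'_deriv b_deriv q_deriv
  by (meson DERIV_continuous continuous_at_imp_continuous_on)+

text \<open>This and \<open>mass\<close> are twice the horizontal means of \<open>|Du|^2 / 2\<close>
  and of \<open>|u|^2\<close>, integrated over the height; the factor 2 removes the means of the
  squared sine and cosine.\<close>

definition "dissip = integral {0..L} (\<lambda>y. 4 * k\<^sup>2 * (a y)\<^sup>2 + (a' y + k * b y)\<^sup>2)"
definition "mass = integral {0..L} (\<lambda>y. (a y)\<^sup>2 + (b y)\<^sup>2)"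
text \<open>Minus the normal component of the stress \<open>(p I - Du) e_N\<close>; with this sign
  its ratio to \<open>b L\<close> is positive.\<close>

definition "normal_stress = 2 * k * a L - q L"

lemma dissip: "((\<lambda>y. 4 * k\<^sup>2 * (a y)\<^sup>2 + (a' y + k * b y)\<^sup>2) has_integral dissip) {0..L}"
  unfolding dissip_def
  by (intro integrable_integral integrable_continuous_interval continuous_intros cont)

lemma mass: "((\<lambda>y. (a y)\<^sup>2 + (b y)\<^sup>2) has_integral mass) {0..L}"
  unfolding mass_def
  by (intro integrable_integral integrable_continuous_interval continuous_intros cont)

lemma mass_nonneg: "mass \<ge> 0" and dissip_nonneg: "dissip \<ge> 0"
  by (rule has_integral_nonneg[OF mass], simp) (rule has_integral_nonneg[OF dissip], simp)

text \<open>Because \<open>b' = k a\<close>, the derivative of \<open>a^2 + b^2\<close> is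
  \<open>2 a s\<close> with \<open>s = a' + k b\<close>. It is integrated up from the bottom, where
  both components vanish, and \<open>4 k a s\<close> is at most
  \<open>4 k^2 a^2 + s^2\<close>.\<close>

lemma trace_bound: "2 * k * ((a L)\<^sup>2 + (b L)\<^sup>2) \<le> dissip"
proof -
  have "((\<lambda>y. 2 * a y * (a' y + k * b y)) has_integral ((a L)\<^sup>2 + (b L)\<^sup>2) - ((a 0)\<^sup>2 + (b 0)\<^sup>2)) {0..L}"
    by (rule fundamental_theorem_of_calculus[of 0 L "\<lambda>y. (a y)\<^sup>2 + (b y)\<^sup>2"])
       (use L_pos in \<open>auto intro!: derivative_eq_intros a_deriv[THEN has_field_derivative_at_within] b_deriv[THEN has_field_derivative_at_within]
          simp: has_real_derivative_iff_has_vector_derivative[symmetric] algebra_simps\<close>)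
  then have "((\<lambda>y. 2 * a y * (a' y + k * b y)) has_integral ((a L)\<^sup>2 + (b L)\<^sup>2)) {0..L}"
    by (simp add: a_0 b_0)
  then have "2 * k * ((a L)\<^sup>2 + (b L)\<^sup>2) \<le> dissip"
  proof (rule has_integral_le[OF has_integral_mult_right dissip])
    fix y
    have "0 \<le> (2 * k * a y - (a' y + k * b y))\<^sup>2" by simp
    then show "2 * k * (2 * a y * (a' y + k * b y)) \<le> 4 * k\<^sup>2 * (a y)\<^sup>2 + (a' y + k * b y)\<^sup>2"
      by (simp add: power2_eq_square algebra_simps)
  qed
  then show ?thesis .
qed

text \<open>Integrating the derivative of \<open>k a b\<close> trades the mixed term
  \<open>k b (a' + k b)\<close> for a boundary value at the top, which \<open>trace_bound\<close>
  absorbs. The constant depends neither on \<open>k\<close> nor on \<open>L\<close>.\<close>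

lemma korn: "k\<^sup>2 * mass \<le> 2 * dissip"
proof -
  have "((\<lambda>y. k * b y * (a' y + k * b y) - k\<^sup>2 * (b y)\<^sup>2 + k\<^sup>2 * (a y)\<^sup>2)
      has_integral k * a L * b L - k * a 0 * b 0) {0..L}"
    by (rule fundamental_theorem_of_calculus[of 0 L "\<lambda>y. k * a y * b y"])
       (use L_pos in \<open>auto intro!: derivative_eq_intros a_deriv[THEN has_field_derivative_at_within] b_deriv[THEN has_field_derivative_at_within]
          simp: has_real_derivative_iff_has_vector_derivative[symmetric] algebra_simps power2_eq_square\<close>)
  then have X: "((\<lambda>y. k * b y * (a' y + k * b y) - k\<^sup>2 * (b y)\<^sup>2 + k\<^sup>2 * (a y)\<^sup>2)
      has_integral k * a L * b L) {0..L}"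
    by (simp add: a_0 b_0)
  have "k\<^sup>2 * mass \<le> dissip - 2 * (k * a L * b L)"
  proof (rule has_integral_le[OF has_integral_mult_right[OF mass]
          has_integral_diff[OF dissip has_integral_mult_right[OF X]]])
    \<comment> \<open>With \<open>s = a' + k b\<close>, the right-hand integrand exceeds the
      left-hand one by exactly \<open>(k b - s)^2 + k^2 a^2\<close>.\<close>
    fix y
    have "0 \<le> (k * b y - (a' y + k * b y))\<^sup>2 + k\<^sup>2 * (a y)\<^sup>2" by simp
    then show "k\<^sup>2 * ((a y)\<^sup>2 + (b y)\<^sup>2) \<le> 4 * k\<^sup>2 * (a y)\<^sup>2 + (a' y + k * b y)\<^sup>2
       - 2 * (k * b y * (a' y + k * b y) - k\<^sup>2 * (b y)\<^sup>2 + k\<^sup>2 * (a y)\<^sup>2)"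
      by (simp add: power2_eq_square algebra_simps)
  qed
  also have "- 2 * (k * a L * b L) \<le> k * ((a L)\<^sup>2 + (b L)\<^sup>2)"
  proof -
    have "0 \<le> k * (a L + b L)\<^sup>2" using k_pos by simp
    then show ?thesis by (simp add: power2_eq_square algebra_simps)
  qed
  then have "dissip - 2 * (k * a L * b L) \<le> dissip + dissip"
    using trace_bound dissip_nonneg by linarith
  finally show ?thesis by simp
qed

end

text \<open>The momentum equations of the first mode are multiplied by the velocity of the second
  and integrated by parts. The pressure drops out since \<open>d' = k c\<close>, and of the boundary
  terms only the normal stress at the top survives. Apart from the term with \<open>lam\<close>, the
  integrand is symmetric in the two modes.\<close>

lemma weak_form:
  assumes "stokes_mode L k lam a a' b q" "stokes_mode L k lam2 c c' d r"
  shows "((\<lambda>y. 4 * k\<^sup>2 * (a y * c y) + (a' y + k * b y) * (c' y + k * d y) - lam * (a y * c y + b y * d y))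
     has_integral (2 * k * a L - q L) * d L) {0..L}"
proof -
  interpret m1: stokes_mode L k lam a a' b q by fact
  interpret m2: stokes_mode L k lam2 c c' d r by fact
  have "((\<lambda>y. 4 * k\<^sup>2 * (a y * c y) + (a' y + k * b y) * (c' y + k * d y) - lam * (a y * c y + b y * d y))
     has_integral ((a' L + k * b L) * c L + (2 * k * a L - q L) * d L)
       - ((a' 0 + k * b 0) * c 0 + (2 * k * a 0 - q 0) * d 0)) {0..L}"
    by (rule fundamental_theorem_of_calculus[of 0 L "\<lambda>y. (a' y + k * b y) * c y + (2 * k * a y - q y) * d y"])
       (use m1.L_pos in \<open>auto intro!: derivative_eq_intros m1.a_deriv[THEN has_field_derivative_at_within]
          m1.b_deriv[THEN has_field_derivative_at_within] m1.a'_deriv[THEN has_field_derivative_at_within]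
          m1.q_deriv[THEN has_field_derivative_at_within] m2.a_deriv[THEN has_field_derivative_at_within]
          m2.b_deriv[THEN has_field_derivative_at_within]
          simp: has_real_derivative_iff_has_vector_derivative[symmetric] algebra_simps power2_eq_square\<close>)
  then show ?thesis
    by (simp add: m1.tangential m2.a_0 m2.b_0)
qed

context stokes_mode begin

lemma energy_identity: "normal_stress * b L = dissip - lam * mass"
proof -
  have "((\<lambda>y. 4 * k\<^sup>2 * (a y * a y) + (a' y + k * b y) * (a' y + k * b y) - lam * (a y * a y + b y * b y))
     has_integral normal_stress * b L) {0..L}"
    unfolding normal_stress_def using weak_form[OF stokes_mode_axioms stokes_mode_axioms] .
  moreover have "((\<lambda>y. 4 * k\<^sup>2 * (a y * a y) + (a' y + k * b y) * (a' y + k * b y) - lam * (a y * a y + b y * b y))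
     has_integral dissip - lam * mass) {0..L}"
    using has_integral_diff[OF dissip has_integral_mult_right[OF mass, of lam]]
    by (simp add: power2_eq_square)
  ultimately show ?thesis by (rule has_integral_unique)
qed

text \<open>By \<open>korn\<close>, \<open>lam * mass\<close> is at most
  \<open>k^2/16 * 2 dissip / k^2\<close>, one eighth of the dissipation.\<close>

lemma energy_lower:
  assumes "0 \<le> lam" "lam \<le> k\<^sup>2 / 16"
  shows "normal_stress * b L \<ge> 7/8 * dissip"
proof -
  have "lam * mass \<le> k\<^sup>2 / 16 * mass" using assms mass_nonneg by (intro mult_right_mono) auto
  also have "\<dots> \<le> dissip / 8" using korn by linarith
  finally show ?thesis using energy_identity by simp
qed

end

text \<open>Derivatives within a nondegenerate interval are unique at its end points too; the bottom
  \<open>y = 0\<close> is the point where this is used for \<open>a'\<close>.\<close>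

lemma zero_deriv_zero:
  fixes f f' :: "real \<Rightarrow> real"
  assumes "\<And>y. (f has_real_derivative f' y) (at y)" "\<And>y. y \<in> {0..L} \<Longrightarrow> f y = 0" "L > 0" "y \<in> {0..L}"
  shows "f' y = 0"
proof -
  have "(f has_vector_derivative f' y) (at y within {0..L})"
    using assms(1) has_real_derivative_iff_has_vector_derivative has_vector_derivative_at_within by blast
  moreover have z: "((\<lambda>_. 0) has_vector_derivative 0) (at y within {0..L})" by simp
  have "(f has_vector_derivative 0) (at y within {0..L})"
    by (rule has_vector_derivative_transform[OF assms(4) _ z]) (simp add: assms(2))
  ultimately show ?thesis
    using vector_derivative_unique_within_closed_interval[of 0 L y f "f' y" 0] assms(3,4) by simp
qed

context stokes_mode begin

text \<open>Without normal velocity at the top no work is done, so the dissipation vanishes,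
  \<open>a\<close> is zero throughout, and the equation for the derivative of \<open>a'\<close>
  leaves \<open>k * q 0 = 0\<close>. The pressure is evaluated at the bottom because for the
  explicit modes that value is a nonzero multiple of \<open>mode_Q\<close>.\<close>

lemma no_pressure_without_normal_velocity:
  assumes "0 \<le> lam" "lam \<le> k\<^sup>2 / 16" "b L = 0"
  shows "q 0 = 0"
proof -
  have "dissip = 0" using energy_lower[OF assms(1,2)] assms(3) dissip_nonneg by simp
  then have "\<And>y. y \<in> {0..L} \<Longrightarrow> 4 * k\<^sup>2 * (a y)\<^sup>2 + (a' y + k * b y)\<^sup>2 = 0"
    using dissip L_pos
    by (intro has_integral_0_cbox_imp_0[of 0 L "\<lambda>y. 4 * k\<^sup>2 * (a y)\<^sup>2 + (a' y + k * b y)\<^sup>2"])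
       (auto intro!: continuous_intros cont)
  note zero = this
  have "\<And>y. y \<in> {0..L} \<Longrightarrow> a y = 0"
  proof -
    fix y assume y: "y \<in> {0..L}"
    have "4 * k\<^sup>2 * (a y)\<^sup>2 \<ge> 0" by simp
    then have "4 * k\<^sup>2 * (a y)\<^sup>2 = 0"
      using zero[OF y] zero_le_power2[of "a' y + k * b y"] by linarith
    then show "a y = 0" using k_pos by simp
  qed
  note a0 = this
  have "\<And>y. y \<in> {0..L} \<Longrightarrow> a' y = 0" using zero_deriv_zero[OF a_deriv a0 L_pos] by simp
  then have "(k\<^sup>2 - lam) * a 0 + k * q 0 = 0"
    using zero_deriv_zero[OF a'_deriv _ L_pos, of 0] L_pos by simp
  then show ?thesis using a_0 k_pos by simp
qed

end

text \<open>
  The number \<open>z\<close> is the \<open>L\<^sup>2\<close> product of the two modes, normalised to unit normal velocity at the top.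
\<close>

lemma stress_ratio_compare:
  assumes "stokes_mode L k lam a a' b q" "stokes_mode L k lam2 c c' d r"
    and "b L \<noteq> 0" "d L \<noteq> 0" "0 \<le> lam" "lam \<le> k\<^sup>2 / 16" "0 \<le> lam2" "lam2 \<le> k\<^sup>2 / 16"
  defines "R \<equiv> (2 * k * a L - q L) / b L" and "R2 \<equiv> (2 * k * c L - r L) / d L"
  shows "\<exists>z. R - R2 = (lam2 - lam) * z \<and> \<bar>z\<bar> \<le> 3/2 * (R + R2) / k\<^sup>2" and "R \<ge> k"
proof -
  interpret m1: stokes_mode L k lam a a' b q by fact
  interpret m2: stokes_mode L k lam2 c c' d r by fact
  have k: "k > 0" by (rule m1.k_pos)
  define z where "z = integral {0..L} (\<lambda>y. a y * c y + b y * d y)"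
  have z: "((\<lambda>y. a y * c y + b y * d y) has_integral z) {0..L}"
    unfolding z_def
    by (intro integrable_integral integrable_continuous_interval continuous_intros m1.cont m2.cont)
  have 1: "((\<lambda>y. 4 * k\<^sup>2 * (a y * c y) + (a' y + k * b y) * (c' y + k * d y) - lam * (a y * c y + b y * d y))
     has_integral (2 * k * a L - q L) * d L) {0..L}" by (rule weak_form) fact+
  have 2: "((\<lambda>y. 4 * k\<^sup>2 * (c y * a y) + (c' y + k * d y) * (a' y + k * b y) - lam2 * (c y * a y + d y * b y))
     has_integral (2 * k * c L - r L) * b L) {0..L}" by (rule weak_form) fact+
  \<comment> \<open>The dissipative parts of the two weak forms coincide by symmetry; only the
    inertial terms remain in the difference.\<close>
  have "((\<lambda>y. (lam2 - lam) * (a y * c y + b y * d y)) has_integral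
      (2 * k * a L - q L) * d L - (2 * k * c L - r L) * b L) {0..L}"
    using has_integral_diff[OF 1 2] by (simp add: algebra_simps)
  with has_integral_mult_right[OF z] has_integral_unique
  have eq: "(lam2 - lam) * z = (2 * k * a L - q L) * d L - (2 * k * c L - r L) * b L" by blast
  have diff: "R - R2 = (lam2 - lam) * (z / (b L * d L))"
  proof -
    have "R - R2 = ((2 * k * a L - q L) * d L - (2 * k * c L - r L) * b L) / (b L * d L)"
      using assms(3,4) by (simp add: R_def R2_def diff_divide_distrib)
    then show ?thesis by (simp flip: eq)
  qed
  have Rb: "R * (b L)\<^sup>2 = m1.normal_stress * b L" "R2 * (d L)\<^sup>2 = m2.normal_stress * d L"
    using assms(3,4) by (simp_all add: R_def R2_def m1.normal_stress_def m2.normal_stress_def power2_eq_square)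
  have D: "m1.dissip \<le> 8/7 * (R * (b L)\<^sup>2)" "m2.dissip \<le> 8/7 * (R2 * (d L)\<^sup>2)"
    using m1.energy_lower m2.energy_lower assms(5-8) Rb by simp_all
  \<comment> \<open>The factor 2 of \<open>korn\<close> times 8/7 is 16/7, rounded up to 3.\<close>
  have "m1.mass * k\<^sup>2 \<le> 3 * R * (b L)\<^sup>2" "m2.mass * k\<^sup>2 \<le> 3 * R2 * (d L)\<^sup>2"
    using D m1.korn m2.korn m1.dissip_nonneg m2.dissip_nonneg by (simp_all add: mult.commute)
  then have M: "m1.mass \<le> 3 * R * (b L)\<^sup>2 / k\<^sup>2" "m2.mass \<le> 3 * R2 * (d L)\<^sup>2 / k\<^sup>2"
    using k by (simp_all add: pos_le_divide_eq)
  have "((\<lambda>y. ((a y)\<^sup>2 + (b y)\<^sup>2) / (b L)\<^sup>2 / 2 + ((c y)\<^sup>2 + (d y)\<^sup>2) / (d L)\<^sup>2 / 2) has_integral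
      m1.mass / (b L)\<^sup>2 / 2 + m2.mass / (d L)\<^sup>2 / 2) {0..L}"
    by (intro has_integral_add has_integral_divide m1.mass m2.mass)
  note ub = this
  have zn: "((\<lambda>y. (a y * c y + b y * d y) / (b L * d L)) has_integral z / (b L * d L)) {0..L}"
    by (intro has_integral_divide z)
  have pt: "\<bar>(x1 * x2 + x3 * x4) / (s * t)\<bar> \<le> (x1\<^sup>2 + x3\<^sup>2) / s\<^sup>2 / 2 + (x2\<^sup>2 + x4\<^sup>2) / t\<^sup>2 / 2"
    if "s \<noteq> 0" "t \<noteq> 0" for x1 x2 x3 x4 s t :: real
  proof -
    have am: "\<bar>u * v\<bar> \<le> u\<^sup>2 / 2 + v\<^sup>2 / 2" for u v :: real
    proof -
      have "0 \<le> (\<bar>u\<bar> - \<bar>v\<bar>)\<^sup>2" by simp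
      then show ?thesis by (simp add: power2_diff abs_mult)
    qed
    have "(x1 * x2 + x3 * x4) / (s * t) = (x1 / s) * (x2 / t) + (x3 / s) * (x4 / t)"
      by (simp add: add_divide_distrib)
    also have "\<bar>\<dots>\<bar> \<le> ((x1 / s)\<^sup>2 / 2 + (x2 / t)\<^sup>2 / 2) + ((x3 / s)\<^sup>2 / 2 + (x4 / t)\<^sup>2 / 2)"
      by (rule order_trans[OF abs_triangle_ineq add_mono[OF am am]])
    finally show ?thesis by (simp add: power_divide add_divide_distrib algebra_simps)
  qed
  have "z / (b L * d L) \<le> m1.mass / (b L)\<^sup>2 / 2 + m2.mass / (d L)\<^sup>2 / 2"
    by (rule has_integral_le[OF zn ub]) (rule order_trans[OF abs_ge_self pt[OF assms(3,4)]])
  moreover have "- (z / (b L * d L)) \<le> m1.mass / (b L)\<^sup>2 / 2 + m2.mass / (d L)\<^sup>2 / 2"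
    by (rule has_integral_le[OF has_integral_neg[OF zn] ub]) (rule order_trans[OF abs_ge_minus_self pt[OF assms(3,4)]])
  ultimately have "\<bar>z / (b L * d L)\<bar> \<le> m1.mass / (b L)\<^sup>2 / 2 + m2.mass / (d L)\<^sup>2 / 2" by linarith
  also have "\<dots> \<le> (3 * R / k\<^sup>2) / 2 + (3 * R2 / k\<^sup>2) / 2"
  proof -
    have "m1.mass / (b L)\<^sup>2 \<le> 3 * R / k\<^sup>2" "m2.mass / (d L)\<^sup>2 \<le> 3 * R2 / k\<^sup>2"
      using M assms(3,4) by (simp_all add: pos_divide_le_eq)
    then show ?thesis by (intro add_mono divide_right_mono) auto
  qed
  also have "\<dots> = 3/2 * (R + R2) / k\<^sup>2" by (simp add: add_divide_distrib algebra_simps)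
  finally show "\<exists>z. R - R2 = (lam2 - lam) * z \<and> \<bar>z\<bar> \<le> 3/2 * (R + R2) / k\<^sup>2"
    using diff by blast
  \<comment> \<open>The trace bound against the energy bound yields even
    \<open>R \<ge> 7/4 * k\<close>; the weaker bound is enough for the decay rate.\<close>
  have "2 * k * (b L)\<^sup>2 \<le> m1.dissip"
    by (rule order_trans[OF _ m1.trace_bound]) (use k in simp)
  then have "2 * k * (b L)\<^sup>2 \<le> 8/7 * R * (b L)\<^sup>2" using D(1) by linarith
  then have "2 * k \<le> 8/7 * R" using assms(3) by (simp add: mult_le_cancel_right)
  then show "R \<ge> k" using k by linarith
qed

text \<open>
  With \<open>m\<^sup>2 = k\<^sup>2 - lam\<close> the vertical profile solves \<open>(D\<^sup>2 - k\<^sup>2) (D\<^sup>2 - m\<^sup>2) b = 0\<close>. The solutions with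
  \<open>b(0) = b'(0) = 0\<close> are spanned by \<open>cosh (k y) - cosh (m y)\<close> and \<open>m sinh (k y) - k sinh (m y)\<close>; their
  coefficients are fixed up to scaling by the tangential stress condition.
\<close>

definition mode_P :: "real \<Rightarrow> real \<Rightarrow> real \<Rightarrow> real" where
  "mode_P L k m = 2 * k\<^sup>2 * m * sinh (k * L) - k * (k\<^sup>2 + m\<^sup>2) * sinh (m * L)"
definition mode_Q :: "real \<Rightarrow> real \<Rightarrow> real \<Rightarrow> real" where
  "mode_Q L k m = 2 * k\<^sup>2 * cosh (k * L) - (k\<^sup>2 + m\<^sup>2) * cosh (m * L)"
definition mode_b where
  "mode_b L k m y = k * (mode_P L k m * (cosh (k * y) - cosh (m * y)) - mode_Q L k m * (m * sinh (k * y) - k * sinh (m * y)))"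
definition mode_a where
  "mode_a L k m y = mode_P L k m * (k * sinh (k * y) - m * sinh (m * y)) - mode_Q L k m * k * m * (cosh (k * y) - cosh (m * y))"
definition mode_a' where
  "mode_a' L k m y = mode_P L k m * (k\<^sup>2 * cosh (k * y) - m\<^sup>2 * cosh (m * y)) - mode_Q L k m * k * m * (k * sinh (k * y) - m * sinh (m * y))"
text \<open>Obtained by solving the equation for the second derivative of \<open>a\<close> for the
  pressure. The parts with wave number \<open>m\<close> cancel and only \<open>sinh (k * y)\<close>
  and \<open>cosh (k * y)\<close> remain, as they must for a harmonic pressure.\<close>

definition mode_q where
  "mode_q L k m y = (k\<^sup>2 - m\<^sup>2) * (mode_P L k m * sinh (k * y) - mode_Q L k m * m * cosh (k * y))"

lemma cosh_sinh_scaled_deriv: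
  fixes c y :: real
  shows "((\<lambda>y. cosh (c * y)) has_real_derivative c * sinh (c * y)) (at y)"
    and "((\<lambda>y. sinh (c * y)) has_real_derivative c * cosh (c * y)) (at y)"
  using has_field_derivative_cosh[OF DERIV_cmult_Id, of c y UNIV]
    has_field_derivative_sinh[OF DERIV_cmult_Id, of c y UNIV]
  by (simp_all only: mult.commute[of _ c])

lemma mode_derivs:
  shows mode_b_deriv: "(mode_b L k m has_real_derivative k * mode_a L k m y) (at y)"
    and mode_a_deriv: "(mode_a L k m has_real_derivative mode_a' L k m y) (at y)"
    and mode_a'_deriv: "(mode_a' L k m has_real_derivative m\<^sup>2 * mode_a L k m y + k * mode_q L k m y) (at y)"
    and mode_q_deriv: "(mode_q L k m has_real_derivative k * mode_a' L k m y - m\<^sup>2 * mode_b L k m y) (at y)"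
  subgoal unfolding mode_b_def[abs_def] mode_a_def mode_a'_def mode_b_def mode_q_def
    apply (rule DERIV_cong)
     apply ((rule DERIV_cmult DERIV_diff cosh_sinh_scaled_deriv)+)[1]
    apply (simp add: algebra_simps power2_eq_square)
    done
  subgoal unfolding mode_a_def[abs_def] mode_a_def mode_a'_def mode_b_def mode_q_def
    apply (rule DERIV_cong)
     apply ((rule DERIV_cmult DERIV_diff cosh_sinh_scaled_deriv)+)[1]
    apply (simp add: algebra_simps power2_eq_square)
    done
  subgoal unfolding mode_a'_def[abs_def] mode_a_def mode_a'_def mode_b_def mode_q_def
    apply (rule DERIV_cong)
     apply ((rule DERIV_cmult DERIV_diff cosh_sinh_scaled_deriv)+)[1]
    apply (simp add: algebra_simps power2_eq_square)
    done
  subgoal unfolding mode_q_def[abs_def] mode_a_def mode_a'_def mode_b_def mode_q_def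
    apply (rule DERIV_cong)
     apply ((rule DERIV_cmult DERIV_diff cosh_sinh_scaled_deriv)+)[1]
    apply (simp add: algebra_simps power2_eq_square)
    done
  done

text \<open>The two basis profiles have tangential stresses \<open>mode_Q\<close> and
  \<open>mode_P\<close> at the top, so that the chosen combination gives
  \<open>mode_P * mode_Q - mode_Q * mode_P\<close>.\<close>

lemma mode_tangential: "mode_a' L k m L + k * mode_b L k m L = 0"
proof -
  have "mode_a' L k m L + k * mode_b L k m L
      = mode_P L k m * (2 * k\<^sup>2 * cosh (k * L) - (k\<^sup>2 + m\<^sup>2) * cosh (m * L))
      - mode_Q L k m * (2 * k\<^sup>2 * m * sinh (k * L) - k * (k\<^sup>2 + m\<^sup>2) * sinh (m * L))"
    unfolding mode_a'_def mode_b_def by (simp add: algebra_simps power2_eq_square)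
  then show ?thesis by (simp add: mode_P_def[symmetric] mode_Q_def[symmetric])
qed

lemma stokes_mode_explicit:
  assumes "L > 0" "k > 0" "m\<^sup>2 = k\<^sup>2 - lam"
  shows "stokes_mode L k lam (mode_a L k m) (mode_a' L k m) (mode_b L k m) (mode_q L k m)"
  unfolding stokes_mode_def
  using mode_derivs[of L k m] mode_tangential[of L k m] assms
  by (simp add: mode_a_def mode_b_def)

text \<open>If the normal velocity vanished at the top, so would the pressure at the bottom, which
  is \<open>-(k^2 - m^2) * m * mode_Q\<close>. But \<open>mode_Q\<close> is positive: for
  \<open>m < k\<close> both factors of its first product are the larger ones.\<close>

lemma mode_b_nonzero:
  assumes "L > 0" "k > 0" "0 < m" "m < k" "k\<^sup>2 - m\<^sup>2 \<le> k\<^sup>2 / 16"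
  shows "mode_b L k m L \<noteq> 0"
proof
  interpret stokes_mode L k "k\<^sup>2 - m\<^sup>2" "mode_a L k m" "mode_a' L k m" "mode_b L k m" "mode_q L k m"
    by (rule stokes_mode_explicit) (use assms in auto)
  have mk: "m\<^sup>2 < k\<^sup>2" using assms by (intro power_strict_mono) auto
  assume "mode_b L k m L = 0"
  then have "mode_q L k m 0 = 0" using no_pressure_without_normal_velocity mk assms by auto
  then have "mode_Q L k m = 0" using mk assms by (simp add: mode_q_def)
  moreover have "(k\<^sup>2 + m\<^sup>2) * cosh (m * L) < (2 * k\<^sup>2) * cosh (k * L)"
    using mk assms by (intro mult_strict_mono) (auto intro!: add_nonneg_nonneg simp: cosh_real_nonneg_less_iff)
  ultimately show False by (simp add: mode_Q_def)
qed

text \<open>\<open>lam * stress_ratio L k lam\<close> is the value of the symbol for which the mode decays at the rate \<open>lam\<close>.\<close>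

definition stress_ratio :: "real \<Rightarrow> real \<Rightarrow> real \<Rightarrow> real" where
  "stress_ratio L k lam = (let m = sqrt (k\<^sup>2 - lam) in (2 * k * mode_a L k m L - mode_q L k m L) / mode_b L k m L)"

section \<open>The decay rate as a function of the value of the symbol\<close>

context
  fixes L k :: real
  assumes L: "L > 0" and k: "k > 0"
begin

lemma mode_sqrt:
  assumes "0 < lam" "lam \<le> k\<^sup>2 / 16"
  defines "m \<equiv> sqrt (k\<^sup>2 - lam)"
  shows "0 < m" "m < k" "m\<^sup>2 = k\<^sup>2 - lam" "mode_b L k m L \<noteq> 0"
    "stokes_mode L k lam (mode_a L k m) (mode_a' L k m) (mode_b L k m) (mode_q L k m)"
proof -
  have "lam < k\<^sup>2" using assms zero_less_power[OF k, of 2] by linarith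
  then show m: "0 < m" "m\<^sup>2 = k\<^sup>2 - lam" unfolding m_def by simp_all
  show mk: "m < k" using m assms k by (intro power_less_imp_less_base[of m 2 k]) auto
  show "mode_b L k m L \<noteq> 0" using mode_b_nonzero[OF L k m(1) mk] m assms by simp
  show "stokes_mode L k lam (mode_a L k m) (mode_a' L k m) (mode_b L k m) (mode_q L k m)"
    by (rule stokes_mode_explicit[OF L k m(2)])
qed

text \<open>For rates up to \<open>k^2/16\<close> the comparison gives
  \<open>|R - R2| \<le> 3/32 * (R + R2)\<close>, hence \<open>R \<le> 35/29 * R2\<close>; the factor
  2 is a round number. Monotonicity follows from
  \<open>lam * R - lam2 * R2 = (lam - lam2) * (R - lam2 * z)\<close>, where the perturbation
  \<open>lam2 * z\<close> is too small to change the sign of the last factor.\<close>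

lemma stress_ratio_bounds:
  assumes "0 < lam" "lam \<le> k\<^sup>2 / 16" "0 < lam2" "lam2 \<le> k\<^sup>2 / 16"
  defines "R \<equiv> stress_ratio L k lam" and "R2 \<equiv> stress_ratio L k lam2"
  shows "R \<ge> k" and "R \<le> 2 * R2" and "lam2 < lam \<Longrightarrow> lam2 * R2 < lam * R"
proof -
  note cmp = stress_ratio_compare[OF mode_sqrt(5)[OF assms(1,2)] mode_sqrt(5)[OF assms(3,4)]
     mode_sqrt(4)[OF assms(1,2)] mode_sqrt(4)[OF assms(3,4)]]
  have cmp2: "R2 \<ge> k"
    using stress_ratio_compare(2)[OF mode_sqrt(5)[OF assms(3,4)] mode_sqrt(5)[OF assms(1,2)]
     mode_sqrt(4)[OF assms(3,4)] mode_sqrt(4)[OF assms(1,2)]] assms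
    by (simp add: stress_ratio_def Let_def)
  show R: "R \<ge> k" using cmp(2) assms by (simp add: stress_ratio_def Let_def)
  obtain z where z: "R - R2 = (lam2 - lam) * z" "\<bar>z\<bar> \<le> 3/2 * (R + R2) / k\<^sup>2"
    using cmp(1) assms by (auto simp: stress_ratio_def Let_def)
  have zb: "\<bar>t * z\<bar> \<le> 3/32 * (R + R2)" if "\<bar>t\<bar> \<le> k\<^sup>2 / 16" for t
  proof -
    have "\<bar>t * z\<bar> \<le> k\<^sup>2 / 16 * (3/2 * (R + R2) / k\<^sup>2)"
      unfolding abs_mult using that z by (intro mult_mono) auto
    also have "\<dots> = 3/32 * (R + R2)" using k by simp
    finally show ?thesis .
  qed
  have d: "\<bar>R - R2\<bar> \<le> 3/32 * (R + R2)" unfolding z(1) by (rule zb) (use assms(1-4) in linarith)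
  then show RR: "R \<le> 2 * R2" using R cmp2 k by argo
  show "lam2 * R2 < lam * R" if "lam2 < lam"
  proof -
    have "lam * R - lam2 * R2 = (lam - lam2) * R + lam2 * (R - R2)" by (simp add: algebra_simps)
    also have "\<dots> = (lam - lam2) * (R - lam2 * z)" unfolding z(1) by (simp add: algebra_simps)
    also have "\<dots> > 0"
    proof (rule mult_pos_pos)
      have "\<bar>lam2 * z\<bar> \<le> 3/32 * (R + R2)" by (rule zb) (use assms(1-4) in linarith)
      then show "R - lam2 * z > 0" using d R cmp2 k by argo
    qed (use that in simp)
    finally show ?thesis by simp
  qed
qed

lemma continuous_stress_ratio: "continuous_on {0<..k\<^sup>2 / 16} (stress_ratio L k)"
  unfolding stress_ratio_def Let_def
proof (rule continuous_on_divide)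
  show "continuous_on {0<..k\<^sup>2 / 16} (\<lambda>lam. 2 * k * mode_a L k (sqrt (k\<^sup>2 - lam)) L - mode_q L k (sqrt (k\<^sup>2 - lam)) L)"
    unfolding mode_a_def mode_q_def mode_P_def mode_Q_def by (intro continuous_intros)
  show "continuous_on {0<..k\<^sup>2 / 16} (\<lambda>lam. mode_b L k (sqrt (k\<^sup>2 - lam)) L)"
    unfolding mode_b_def mode_P_def mode_Q_def by (intro continuous_intros)
qed (use mode_sqrt(4) in auto)

lemma decay_rate_exists:
  assumes "0 < v" "v \<le> k ^ 3 / 16"
  shows "\<exists>!lam. 0 < lam \<and> lam \<le> k\<^sup>2 / 16 \<and> lam * stress_ratio L k lam = v"
    and "\<exists>lam. 0 < lam \<and> lam \<le> k\<^sup>2 / 16 \<and> lam \<le> v / k \<and> lam * stress_ratio L k lam = v"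
proof -
  \<comment> \<open>At this rate the bound \<open>R \<ge> k\<close> makes the product at least
    \<open>v\<close>; the hypothesis \<open>v \<le> k ^ 3 / 16\<close> keeps it within the
    admissible range.\<close>
  define l0 where "l0 = v / k"
  have l0: "0 < l0" "l0 \<le> k\<^sup>2 / 16"
    using assms k by (auto simp: l0_def field_simps power3_eq_cube power2_eq_square)
  define R0 where "R0 = stress_ratio L k l0"
  have R0: "R0 \<ge> k" using stress_ratio_bounds(1)[OF l0 l0] by (simp add: R0_def)
  \<comment> \<open>Every admissible ratio is at most \<open>2 * R0\<close>, so the product at this
    rate is at most \<open>v\<close>. No limit as the rate tends to 0 has to be computed.\<close>
  define l1 where "l1 = min l0 (v / (2 * R0))"
  have l1: "0 < l1" "l1 \<le> l0" using l0 R0 k assms by (auto simp: l1_def)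
  then have l1': "l1 \<le> k\<^sup>2/16" using l0 by simp
  have "l1 * stress_ratio L k l1 \<le> v / (2 * R0) * (2 * R0)"
    using stress_ratio_bounds(1,2)[OF l1(1) l1' l0] k l1 R0
    by (intro mult_mono) (auto simp: l1_def R0_def)
  then have lo: "l1 * stress_ratio L k l1 \<le> v" using R0 k by simp
  have "v = l0 * k" using k by (simp add: l0_def)
  also have "\<dots> \<le> l0 * R0" using R0 l0 by simp
  finally have hi: "v \<le> l0 * stress_ratio L k l0" by (simp add: R0_def)
  have "continuous_on {l1..l0} (\<lambda>l. l * stress_ratio L k l)"
    by (intro continuous_intros continuous_on_subset[OF continuous_stress_ratio]) (use l1 l0 in auto)
  then obtain lam where lam: "l1 \<le> lam" "lam \<le> l0" "lam * stress_ratio L k lam = v"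
    using IVT'[of "\<lambda>l. l * stress_ratio L k l", OF lo hi l1(2)] by auto
  then show ex: "\<exists>lam. 0 < lam \<and> lam \<le> k\<^sup>2 / 16 \<and> lam \<le> v / k \<and> lam * stress_ratio L k lam = v"
    using l1(1) l0(2) unfolding l0_def by (intro exI[of _ lam] conjI) linarith+
  then show "\<exists>!lam. 0 < lam \<and> lam \<le> k\<^sup>2 / 16 \<and> lam * stress_ratio L k lam = v"
    using stress_ratio_bounds(3) by (metis less_irrefl linorder_neqE_linordered_idom)
qed

definition decay_rate :: "real \<Rightarrow> real" where
  "decay_rate v = (THE lam. 0 < lam \<and> lam \<le> k\<^sup>2 / 16 \<and> lam * stress_ratio L k lam = v)"

lemma decay_rate:
  assumes "0 < v" "v \<le> k ^ 3 / 16"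
  shows "0 < decay_rate v" "decay_rate v \<le> k\<^sup>2 / 16" "decay_rate v * stress_ratio L k (decay_rate v) = v"
    "decay_rate v \<le> v / k"
proof -
  show *: "0 < decay_rate v" "decay_rate v \<le> k\<^sup>2 / 16" "decay_rate v * stress_ratio L k (decay_rate v) = v"
    using theI'[OF decay_rate_exists(1)[OF assms]] by (simp_all add: decay_rate_def)
  \<comment> \<open>Uniqueness identifies the rate with the one found by the intermediate value
    theorem, which was sought below \<open>v / k\<close>.\<close>
  show "decay_rate v \<le> v / k"
    using decay_rate_exists[OF assms] * by blast
qed

text \<open>Strict monotonicity of \<open>lam * R\<close> turns a sublevel set of the implicitly
  defined rate into an inequality between explicit functions. This is how its measurability is
  obtained.\<close>

lemma decay_rate_le_iff:
  assumes "0 < v" "v \<le> k ^ 3 / 16" "0 < c" "c \<le> k\<^sup>2 / 16"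
  shows "decay_rate v \<le> c \<longleftrightarrow> v \<le> c * stress_ratio L k c"
proof -
  note d = decay_rate[OF assms(1,2)]
  have "v < c * stress_ratio L k c" if "decay_rate v < c"
    using stress_ratio_bounds(3)[OF assms(3,4) d(1,2) that] d(3) by simp
  moreover have "c * stress_ratio L k c < v" if "c < decay_rate v"
    using stress_ratio_bounds(3)[OF d(1,2) assms(3,4) that] d(3) by simp
  ultimately show ?thesis using d(3) by (metis leD le_less not_le)
qed

end

section \<open>Gaussian and character integrals\<close>

text \<open>Lebesgue measure is the image of a product measure under the coordinate expansion, so
  integrals of products of one-variable functions factor.\<close>

lemma lborel_integral_prod:
  fixes f :: "'a::euclidean_space \<Rightarrow> real \<Rightarrow> 'c::{real_normed_field,banach,second_countable_topology}"
  assumes f: "\<And>b. b \<in> Basis \<Longrightarrow> integrable lborel (f b)"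
  shows "integrable lborel (\<lambda>x::'a. \<Prod>b\<in>Basis. f b (x \<bullet> b))"
    and "(\<integral>x. (\<Prod>b\<in>Basis. f b (x \<bullet> b)) \<partial>lborel) = (\<Prod>b\<in>Basis. integral\<^sup>L lborel (f b))"
proof -
  interpret product_sigma_finite "\<lambda>_::'a. lborel :: real measure" ..
  have [measurable]: "f b \<in> borel_measurable borel" if "b \<in> Basis" for b
    using f[OF that] by auto
  have coord: "(\<Sum>b\<in>Basis. g b *\<^sub>R b) \<bullet> c = g c" if "c \<in> Basis" for g :: "'a \<Rightarrow> real" and c
    using that by (simp add: inner_sum_left inner_Basis if_distrib cong: if_cong)
  have cong: "(\<Prod>b\<in>Basis. f b ((\<Sum>c\<in>Basis. g c *\<^sub>R c) \<bullet> b)) = (\<Prod>b\<in>Basis. f b (g b))" for g :: "'a \<Rightarrow> real"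
    by (intro prod.cong refl) (simp add: coord)
  have m: "(\<lambda>x::'a. \<Prod>b\<in>Basis. f b (x \<bullet> b)) \<in> borel_measurable borel" by measurable
  have d: "(\<lambda>f. \<Sum>b\<in>Basis. f b *\<^sub>R b) \<in> (\<Pi>\<^sub>M b\<in>Basis. lborel) \<rightarrow>\<^sub>M (borel :: 'a measure)"
    by measurable
  show "integrable lborel (\<lambda>x::'a. \<Prod>b\<in>Basis. f b (x \<bullet> b))"
    by (subst lborel_eq, subst integrable_distr_eq[OF d m])
      (unfold cong, rule product_integrable_prod[OF finite_Basis f])
  show "(\<integral>x. (\<Prod>b\<in>Basis. f b (x \<bullet> b)) \<partial>lborel) = (\<Prod>b\<in>Basis. integral\<^sup>L lborel (f b))"
    by (subst lborel_eq, subst integral_distr[OF d m])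
      (unfold cong, rule product_integral_prod[OF finite_Basis f])
qed

lemma cis_inner_prod: "cis ((w::'a::euclidean_space) \<bullet> x) = (\<Prod>b\<in>Basis. cis ((w \<bullet> b) * (x \<bullet> b)))"
proof -
  have "cis (\<Sum>b\<in>A. g b) = (\<Prod>b\<in>A. cis (g b))" if "finite A" for A and g :: "'a \<Rightarrow> real"
    using that by induction (auto simp flip: cis_mult)
  then show ?thesis by (subst euclidean_inner) simp
qed

text \<open>This is the characteristic function of the standard normal law after the substitution of
  \<open>s * x\<close> for the variable.\<close>

lemma gaussian_fourier_real:
  fixes s t :: real
  assumes "s > 0"
  shows "integrable lborel (\<lambda>x. cis (t * x) * complex_of_real (exp (- (s * x)\<^sup>2 / 2)))"
    and "(\<integral>x. cis (t * x) * complex_of_real (exp (- (s * x)\<^sup>2 / 2)) \<partial>lborel)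
      = complex_of_real (sqrt (2 * pi) / s * exp (- (t / s)\<^sup>2 / 2))"
proof -
  have std: "integrable lborel (\<lambda>x. cis (t * x) * complex_of_real (exp (- x\<^sup>2 / 2)))"
     "(\<integral>x. cis (t * x) * complex_of_real (exp (- x\<^sup>2 / 2)) \<partial>lborel) = complex_of_real (sqrt (2 * pi) * exp (- t\<^sup>2 / 2))" for t
  proof -
    have e: "cis (t * x) * complex_of_real (exp (- x\<^sup>2 / 2))
        = complex_of_real (sqrt (2 * pi)) * (std_normal_density x *\<^sub>R iexp (t * x))" for x
      by (simp add: std_normal_density_def cis_conv_exp scaleR_conv_of_real mult.commute)
    have "integrable lborel (\<lambda>x. std_normal_density x *\<^sub>R iexp (t * x))"
      by (rule Bochner_Integration.integrable_bound[of _ "std_normal_density"]) auto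
    then show "integrable lborel (\<lambda>x. cis (t * x) * complex_of_real (exp (- x\<^sup>2 / 2)))"
      unfolding e by (rule integrable_mult_right)
    have "(\<integral>x. std_normal_density x *\<^sub>R iexp (t * x) \<partial>lborel) = char std_normal_distribution t"
      unfolding char_def by (subst integral_density) auto
    then show "(\<integral>x. cis (t * x) * complex_of_real (exp (- x\<^sup>2 / 2)) \<partial>lborel) = complex_of_real (sqrt (2 * pi) * exp (- t\<^sup>2 / 2))"
      unfolding e by (simp only: integral_mult_right_zero char_std_normal_distribution of_real_mult)
  qed
  show "integrable lborel (\<lambda>x. cis (t * x) * complex_of_real (exp (- (s * x)\<^sup>2 / 2)))"
    using lborel_integrable_real_affine[OF std(1)[of "t / s"], of s 0] assms by simp
  show "(\<integral>x. cis (t * x) * complex_of_real (exp (- (s * x)\<^sup>2 / 2)) \<partial>lborel)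
      = complex_of_real (sqrt (2 * pi) / s * exp (- (t / s)\<^sup>2 / 2))"
    using lborel_integral_real_affine[of s "\<lambda>x. cis (t / s * x) * complex_of_real (exp (- x\<^sup>2 / 2))" 0]
      std(2)[of "t / s"] assms
    by (simp add: scaleR_conv_of_real field_simps)
qed

lemma gaussian_fourier:
  fixes w :: "'a::euclidean_space"
  assumes "s > 0"
  shows "integrable lborel (\<lambda>x::'a. cis (w \<bullet> x) * complex_of_real (exp (- (s * norm x)\<^sup>2 / 2)))"
    and "(\<integral>x. cis (w \<bullet> x) * complex_of_real (exp (- (s * norm x)\<^sup>2 / 2)) \<partial>lborel)
      = complex_of_real ((sqrt (2 * pi) / s) ^ DIM('a) * exp (- (norm w / s)\<^sup>2 / 2))"
proof -
  have sq: "(norm x)\<^sup>2 = (\<Sum>b\<in>Basis. (x \<bullet> b)\<^sup>2)" for x :: 'a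
    unfolding power2_norm_eq_inner by (subst euclidean_inner) (simp add: power2_eq_square)
  have ex: "exp (- (c * norm x)\<^sup>2 / 2) = (\<Prod>b\<in>Basis. exp (- (c * (x \<bullet> b))\<^sup>2 / 2))" for x :: 'a and c :: real
    by (simp add: sq power_mult_distrib exp_sum[symmetric] sum_distrib_left sum_negf sum_divide_distrib)
  have e: "cis (w \<bullet> x) * complex_of_real (exp (- (s * norm x)\<^sup>2 / 2))
      = (\<Prod>b\<in>Basis. cis ((w \<bullet> b) * (x \<bullet> b)) * complex_of_real (exp (- (s * (x \<bullet> b))\<^sup>2 / 2)))" for x
    unfolding ex cis_inner_prod by (simp add: prod.distrib)
  show "integrable lborel (\<lambda>x::'a. cis (w \<bullet> x) * complex_of_real (exp (- (s * norm x)\<^sup>2 / 2)))"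
    unfolding e by (rule lborel_integral_prod(1)[OF gaussian_fourier_real(1)[OF assms]])
  have "(\<integral>x. cis (w \<bullet> x) * complex_of_real (exp (- (s * norm x)\<^sup>2 / 2)) \<partial>lborel)
      = (\<Prod>b\<in>(Basis::'a set). complex_of_real (sqrt (2 * pi) / s * exp (- ((w \<bullet> b) / s)\<^sup>2 / 2)))"
    unfolding e
    by (subst lborel_integral_prod(2)[OF gaussian_fourier_real(1)[OF assms]])
       (simp only: gaussian_fourier_real(2)[OF assms])
  also have "\<dots> = complex_of_real ((sqrt (2 * pi) / s) ^ DIM('a) * exp (- (norm w / s)\<^sup>2 / 2))"
  proof -
    define c where "c = sqrt (2 * pi) / s"
    have "(\<Prod>b\<in>(Basis::'a set). c * exp (- ((w \<bullet> b) / s)\<^sup>2 / 2)) = c ^ DIM('a) * exp (- (norm w / s)\<^sup>2 / 2)"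
      using ex[of "1 / s" w] by (simp add: prod.distrib)
    then show ?thesis by (simp only: c_def[symmetric] of_real_prod[symmetric])
  qed
  finally show "(\<integral>x. cis (w \<bullet> x) * complex_of_real (exp (- (s * norm x)\<^sup>2 / 2)) \<partial>lborel)
      = complex_of_real ((sqrt (2 * pi) / s) ^ DIM('a) * exp (- (norm w / s)\<^sup>2 / 2))" .
qed

lemma lborel_integral_affine:
  fixes f :: "'a::euclidean_space \<Rightarrow> 'b::{banach,second_countable_topology}"
  assumes [measurable]: "f \<in> borel_measurable borel" and "c \<noteq> 0"
  shows "integral\<^sup>L lborel f = \<bar>c\<bar> ^ DIM('a) *\<^sub>R (\<integral>x. f (t + c *\<^sub>R x) \<partial>lborel)"
  by (subst lborel_affine[OF assms(2), of t]) (simp add: integral_density integral_distr)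

lemma lborel_integrable_shift_iff:
  fixes f :: "'a::euclidean_space \<Rightarrow> 'b::{banach,second_countable_topology}"
  assumes [measurable]: "f \<in> borel_measurable borel"
  shows "integrable lborel (\<lambda>x. f (t + x)) \<longleftrightarrow> integrable lborel f"
  by (subst (2) lborel_distr_plus[of t, symmetric]) (simp add: integrable_distr_eq)

text \<open>The integral factors over the coordinates. For a nonzero integer component the
  one-dimensional factor has a 1-periodic antiderivative and vanishes.\<close>

lemma torus_character_integral:
  fixes k :: "'a::euclidean_space"
  assumes "\<And>b. b \<in> Basis \<Longrightarrow> k \<bullet> b \<in> \<int>"
  shows "(LINT x:cbox 0 One|lborel. cis (2 * pi * (k \<bullet> x))) = (if k = 0 then 1 else 0)"
proof -
  define g where "g = (\<lambda>t x. indicator {0..1::real} x *\<^sub>R cis (2 * pi * t * x))"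
  have g: "integrable lborel (g t)" for t
    unfolding g_def
    by (rule borel_integrable_compact) (auto intro!: continuous_intros)
  have gi: "integral\<^sup>L lborel (g t) = (if t = 0 then 1 else 0)" if "t \<in> \<int>" for t
  proof (cases "t = 0")
    case False
    have d: "((\<lambda>x. cis (2 * pi * t * x) / (\<i> * (2 * pi * t))) has_vector_derivative cis (2 * pi * t * x)) (at x within {0..1})" for x
    proof -
      define a where "a = \<i> * (2 * pi * t)"
      have "a \<noteq> 0" using False by (simp add: a_def)
      then have "((\<lambda>z. exp (a * z) / a) has_field_derivative exp (a * complex_of_real x)) (at (complex_of_real x) within of_real ` {0..1})"
        by (auto intro!: derivative_eq_intros)
      then have "((\<lambda>x. exp (a * complex_of_real x) / a) has_vector_derivative exp (a * complex_of_real x)) (at x within {0..1})"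
        by (rule field_vector_diff_chain_within[OF has_vector_derivative_of_real, unfolded o_def, OF DERIV_ident, simplified])
      moreover have "exp (a * complex_of_real x) = cis (2 * pi * t * x)" for x
        by (simp add: a_def cis_conv_exp mult_ac)
      ultimately show ?thesis by (simp add: a_def)
    qed
    have "integral\<^sup>L lborel (g t) = cis (2 * pi * t * 1) / (\<i> * (2 * pi * t)) - cis (2 * pi * t * 0) / (\<i> * (2 * pi * t))"
      unfolding g_def by (rule integral_FTC_Icc[OF _ d]) (auto intro!: continuous_intros)
    also have "cis (2 * pi * t * 1) = 1"
      using that by (auto elim!: Ints_cases simp: cis_multiple_2pi)
    finally show ?thesis using False by simp
  qed (simp add: g_def)
  have e: "indicator (cbox 0 One) x *\<^sub>R cis (2 * pi * (k \<bullet> x)) = (\<Prod>b\<in>Basis. g (k \<bullet> b) (x \<bullet> b))" for x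
  proof -
    have "indicator (cbox 0 One) x = (\<Prod>b\<in>Basis. indicator {0..1::real} (x \<bullet> b) :: real)"
    proof (cases "x \<in> cbox 0 One")
      case True
      then show ?thesis by (simp add: mem_box)
    next
      case False
      then obtain b where "b \<in> Basis" "x \<bullet> b \<notin> {0..1}" by (auto simp: mem_box)
      then have "(\<Prod>b\<in>Basis. indicator {0..1::real} (x \<bullet> b) :: real) = 0"
        by (intro prod_zero bexI[of _ b]) auto
      then show ?thesis using False by simp
    qed
    moreover have "cis (2 * pi * (k \<bullet> x)) = (\<Prod>b\<in>Basis. cis (2 * pi * (k \<bullet> b) * (x \<bullet> b)))"
      using cis_inner_prod[of "(2 * pi) *\<^sub>R k" x] by (simp add: mult.assoc)
    ultimately show ?thesis unfolding g_def by (simp add: scaleR_conv_of_real prod.distrib)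
  qed
  have "(LINT x:cbox 0 One|lborel. cis (2 * pi * (k \<bullet> x))) = (\<Prod>b\<in>Basis. integral\<^sup>L lborel (g (k \<bullet> b)))"
    unfolding set_lebesgue_integral_def e using lborel_integral_prod(2)[OF g] .
  also have "\<dots> = (\<Prod>b\<in>(Basis::'a set). if k \<bullet> b = 0 then 1 else 0)"
    by (intro prod.cong refl gi assms)
  also have "\<dots> = (if k = 0 then 1 else 0)"
    by (auto simp: prod_zero_iff euclidean_eq_iff[of k 0])
  finally show ?thesis .
qed

section \<open>The Plancherel theorem and inversion\<close>

lemma lborel_integral_shift:
  fixes f :: "'a::euclidean_space \<Rightarrow> 'b::{banach,second_countable_topology}"
  assumes "f \<in> borel_measurable borel"
  shows "(\<integral>x. f (x + v) \<partial>lborel) = integral\<^sup>L lborel f"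
  using lborel_integral_affine[OF assms, of 1 v] by (simp add: add.commute)

lemma lborel_integrable_shift:
  fixes f :: "'a::euclidean_space \<Rightarrow> 'b::{banach,second_countable_topology}"
  assumes "integrable lborel f"
  shows "integrable lborel (\<lambda>x. f (x + v))"
  using lborel_integrable_shift_iff[of f v] assms by (simp add: add.commute)

lemma L1_translation_approx:
  fixes f g :: "'a::euclidean_space \<Rightarrow> 'b::{banach,second_countable_topology}"
  assumes f: "integrable lborel f" and g: "integrable lborel g"
  shows "(\<integral>x. norm (f (x + v) - f x) \<partial>lborel)
    \<le> (\<integral>x. norm (g (x + v) - g x) \<partial>lborel) + 2 * (\<integral>x. norm (f x - g x) \<partial>lborel)"
proof -
  note sh = lborel_integrable_shift[OF f, of v] lborel_integrable_shift[OF g, of v]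
  have [measurable]: "f \<in> borel_measurable borel" "g \<in> borel_measurable borel" using f g by auto
  have "(\<integral>x. norm (f (x + v) - f x) \<partial>lborel)
    \<le> (\<integral>x. norm (g (x + v) - g x) + (norm (f (x + v) - g (x + v)) + norm (f x - g x)) \<partial>lborel)"
  proof (rule integral_mono)
    fix x
    have "f (x + v) - f x = (g (x + v) - g x) + ((f (x + v) - g (x + v)) - (f x - g x))" by simp
    then show "norm (f (x + v) - f x) \<le> norm (g (x + v) - g x) + (norm (f (x + v) - g (x + v)) + norm (f x - g x))"
      by (metis norm_triangle_mono norm_triangle_ineq4 order_refl)
  qed (use f g sh in auto)
  also have "\<dots> = (\<integral>x. norm (g (x + v) - g x) \<partial>lborel) + ((\<integral>x. norm (f (x + v) - g (x + v)) \<partial>lborel) + (\<integral>x. norm (f x - g x) \<partial>lborel))"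
    using f g sh by simp
  also have "(\<integral>x. norm (f (x + v) - g (x + v)) \<partial>lborel) = (\<integral>x. norm (f x - g x) \<partial>lborel)"
    by (rule lborel_integral_shift[of "\<lambda>x. norm (f x - g x)" v]) measurable
  finally show ?thesis by simp
qed

text \<open>Translations are isometries of L1, so the functions whose translates converge form a
  closed set; this reduces the claim to a dense class.\<close>

lemma L1_translation_closure:
  fixes f :: "'a::euclidean_space \<Rightarrow> 'b::{banach,second_countable_topology}"
  assumes f: "integrable lborel f"
    and approx: "\<And>e. e > 0 \<Longrightarrow> \<exists>g. integrable lborel g \<and> (\<integral>x. norm (f x - g x) \<partial>lborel) < e \<and>
      (\<lambda>n. \<integral>x. norm (g (x + v n) - g x) \<partial>lborel) \<longlonglongrightarrow> 0"
  shows "(\<lambda>n::nat. \<integral>x. norm (f (x + v n) - f x) \<partial>lborel) \<longlonglongrightarrow> 0"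
proof (rule LIMSEQ_I)
  fix e :: real assume "e > 0"
  then obtain g where g: "integrable lborel g" "(\<integral>x. norm (f x - g x) \<partial>lborel) < e / 4"
      "(\<lambda>n. \<integral>x. norm (g (x + v n) - g x) \<partial>lborel) \<longlonglongrightarrow> 0"
    using approx[of "e / 4"] by auto
  from LIMSEQ_D[OF g(3), of "e / 2"] \<open>e > 0\<close> obtain N where
    N: "\<And>n. n \<ge> N \<Longrightarrow> norm ((\<integral>x. norm (g (x + v n) - g x) \<partial>lborel) - 0) < e / 2" by auto
  show "\<exists>N. \<forall>n\<ge>N. norm ((\<integral>x. norm (f (x + v n) - f x) \<partial>lborel) - 0) < e"
  proof (intro exI[of _ N] allI impI)
    fix n assume "n \<ge> N"
    have "0 \<le> (\<integral>x. norm (f (x + v n) - f x) \<partial>lborel)" by simp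
    moreover have "(\<integral>x. norm (g (x + v n) - g x) \<partial>lborel) < e / 2" using N[OF \<open>n \<ge> N\<close>] by simp
    ultimately show "norm ((\<integral>x. norm (f (x + v n) - f x) \<partial>lborel) - 0) < e"
      using L1_translation_approx[OF f g(1), of "v n"] g(2) by simp
  qed
qed

text \<open>Openness makes \<open>x + v n\<close> lie eventually in \<open>U\<close> for each
  \<open>x\<close> in \<open>U\<close>, so dominated convergence applies on \<open>U\<close> without
  any control of its boundary.\<close>

lemma L1_translation_open:
  fixes U :: "'a::euclidean_space set" and c :: "'b::{banach,second_countable_topology}"
  assumes U: "open U" "emeasure lborel U < \<infinity>" and v: "v \<longlonglongrightarrow> 0"
  shows "(\<lambda>n::nat. \<integral>x. norm (indicat_real U (x + v n) *\<^sub>R c - indicat_real U x *\<^sub>R c) \<partial>lborel) \<longlonglongrightarrow> 0"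
proof -
  have [measurable]: "U \<in> sets borel" using U by simp
  have i: "integrable lborel (indicat_real U)" using U by simp
  have eq: "(\<integral>x. norm (indicat_real U (x + w) *\<^sub>R c - indicat_real U x *\<^sub>R c) \<partial>lborel)
    = norm c * (2 * (\<integral>x. indicat_real U x * (1 - indicat_real U (x + w)) \<partial>lborel))" for w
  proof -
    \<comment> \<open>The last difference integrates to zero by translation invariance, so the mass
      that leaves \<open>U\<close> already determines the whole distance.\<close>
    have p: "norm (indicat_real U (x + w) *\<^sub>R c - indicat_real U x *\<^sub>R c)
       = norm c * (2 * (indicat_real U x * (1 - indicat_real U (x + w))) + (indicat_real U (x + w) - indicat_real U x))" for x
      by (simp add: indicator_def)
    have j: "integrable lborel (\<lambda>x. indicat_real U x * (1 - indicat_real U (x + w)))"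
      by (rule Bochner_Integration.integrable_bound[OF i]) (auto simp: indicator_def)
    show ?thesis
      unfolding p using i j lborel_integrable_shift[OF i, of w] lborel_integral_shift[of "indicat_real U" w]
      by simp
  qed
  have "(\<lambda>n. \<integral>x. indicat_real U x * (1 - indicat_real U (x + v n)) \<partial>lborel) \<longlonglongrightarrow> (\<integral>x. 0 \<partial>(lborel :: 'a measure))"
  proof (rule integral_dominated_convergence[where w = "indicat_real U"])
    show "AE x in lborel. (\<lambda>n. indicat_real U x * (1 - indicat_real U (x + v n))) \<longlonglongrightarrow> 0"
    proof (rule AE_I2)
      fix x
      show "(\<lambda>n. indicat_real U x * (1 - indicat_real U (x + v n))) \<longlonglongrightarrow> 0"
      proof (cases "x \<in> U")
        case True
        have "(\<lambda>n. x + v n) \<longlonglongrightarrow> x + 0" by (intro tendsto_intros v)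
        then have "\<forall>\<^sub>F n in sequentially. x + v n \<in> U"
          using U(1) True by (auto intro: topological_tendstoD)
        then have "\<forall>\<^sub>F n in sequentially. indicat_real U x * (1 - indicat_real U (x + v n)) = 0"
          by eventually_elim simp
        then show ?thesis by (rule tendsto_eventually)
      qed simp
    qed
  qed (use i in \<open>auto simp: indicator_def\<close>)
  then have "(\<lambda>n. norm c * (2 * (\<integral>x. indicat_real U x * (1 - indicat_real U (x + v n)) \<partial>lborel))) \<longlonglongrightarrow> norm c * (2 * 0)"
    by (intro tendsto_intros) simp
  then show ?thesis unfolding eq by simp
qed

text \<open>Indicators of measurable sets are approximated by those of open sets through outer
  regularity; sums and limits of simple functions follow from the closure property.\<close>

lemma L1_translation_tendsto:
  fixes f :: "'a::euclidean_space \<Rightarrow> 'b::{banach,second_countable_topology}"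
  assumes "integrable lborel f" and v: "v \<longlonglongrightarrow> 0"
  shows "(\<lambda>n::nat. \<integral>x. norm (f (x + v n) - f x) \<partial>lborel) \<longlonglongrightarrow> 0"
  using assms(1)
proof (induction rule: integrable_induct)
  case (base A c)
  have A[measurable]: "A \<in> sets borel" using base by simp
  have iA: "integrable lborel (\<lambda>x. indicat_real A x *\<^sub>R c)" using base by simp
  show ?case
  proof (rule L1_translation_closure[OF iA])
    fix e :: real assume e: "e > 0"
    \<comment> \<open>Adding 1 in the denominator covers the case \<open>c = 0\<close>.\<close>
    define d where "d = e / (norm c + 1)"
    have d: "d > 0" using e by (simp add: d_def add_nonneg_pos)
    obtain U where U: "open U" "A \<subseteq> U" "emeasure lborel (U - A) < ennreal d"
      using outer_regular_lborel[OF A d] by blast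
    have [measurable]: "U \<in> sets borel" using U by simp
    have "emeasure lborel U \<le> emeasure lborel A + emeasure lborel (U - A)"
      using emeasure_subadditive[of A lborel "U - A"] U(2) by (simp add: Un_absorb1)
    also have "\<dots> < \<infinity>" using base U(3) by (simp add: less_top[symmetric]) (metis ennreal_less_top order_less_trans less_irrefl)
    finally have fU: "emeasure lborel U < \<infinity>" .
    have fD: "emeasure lborel (U - A) < \<infinity>" using U(3) by (metis ennreal_less_top order_less_trans infinity_ennreal_def)
    have "(\<integral>x. norm (indicat_real A x *\<^sub>R c - indicat_real U x *\<^sub>R c) \<partial>lborel) = (\<integral>x. norm c * indicat_real (U - A) x \<partial>lborel)"
      by (rule Bochner_Integration.integral_cong) (use U(2) in \<open>auto simp: indicator_def\<close>)
    also have "\<dots> = norm c * measure lborel (U - A)" using fD by simp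
    also have "\<dots> \<le> norm c * d"
      unfolding measure_def using U(3) d by (intro mult_left_mono enn2real_leI) simp_all
    also have "norm c * d < e"
    proof -
      have "norm c + 1 > 0" by (simp add: add_nonneg_pos)
      then have "d * (norm c + 1) = e" by (simp add: d_def)
      then show ?thesis using d by (simp add: algebra_simps)
    qed
    finally have "(\<integral>x. norm (indicat_real A x *\<^sub>R c - indicat_real U x *\<^sub>R c) \<partial>lborel) < e" .
    then show "\<exists>g. integrable lborel g \<and> (\<integral>x. norm (indicat_real A x *\<^sub>R c - g x) \<partial>lborel) < e \<and>
      (\<lambda>n. \<integral>x. norm (g (x + v n) - g x) \<partial>lborel) \<longlonglongrightarrow> 0"
      using L1_translation_open[OF U(1) fU v, of c] fU
      by (intro exI[of _ "\<lambda>x. indicat_real U x *\<^sub>R c"]) auto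
  qed
next
  case (add f g)
  note sh = lborel_integrable_shift[OF add.hyps(1)] lborel_integrable_shift[OF add.hyps(2)]
  have [measurable]: "f \<in> borel_measurable borel" "g \<in> borel_measurable borel" using add.hyps by auto
  have lim: "(\<lambda>n. (\<integral>x. norm (f (x + v n) - f x) \<partial>lborel) + (\<integral>x. norm (g (x + v n) - g x) \<partial>lborel)) \<longlonglongrightarrow> 0"
    using tendsto_add[OF add.IH] by simp
  show ?case
  proof (rule tendsto_sandwich[OF always_eventually always_eventually tendsto_const lim], safe)
    fix n
    show "(\<integral>x. norm (f (x + v n) + g (x + v n) - (f x + g x)) \<partial>lborel)
      \<le> (\<integral>x. norm (f (x + v n) - f x) \<partial>lborel) + (\<integral>x. norm (g (x + v n) - g x) \<partial>lborel)"
    proof -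
      have "(\<integral>x. norm (f (x + v n) + g (x + v n) - (f x + g x)) \<partial>lborel)
        \<le> (\<integral>x. norm (f (x + v n) - f x) + norm (g (x + v n) - g x) \<partial>lborel)"
        by (rule integral_mono[OF _ _ norm_diff_triangle_ineq]) (use add.hyps sh in auto)
      then show ?thesis using add.hyps sh by simp
    qed
  qed simp
next
  case (lim f s)
  have [measurable]: "f \<in> borel_measurable borel" "s i \<in> borel_measurable borel" for i using lim.hyps(1,4) by auto
  \<comment> \<open>The approximants satisfy \<open>norm (s i x) \<le> 2 * norm (f x)\<close>,
    whence the dominating function with factor 3.\<close>
  have conv: "(\<lambda>i. \<integral>x. norm (f x - s i x) \<partial>lborel) \<longlonglongrightarrow> (\<integral>x. 0 \<partial>(lborel :: 'a measure))"
  proof (rule integral_dominated_convergence[where w = "\<lambda>x. 3 * norm (f x)"])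
    show "AE x in lborel. (\<lambda>i. norm (f x - s i x)) \<longlonglongrightarrow> 0"
      using lim.hyps(2) by (intro AE_I2 tendsto_norm_zero) (auto intro!: tendsto_eq_intros)
    show "AE x in lborel. norm (norm (f x - s i x)) \<le> 3 * norm (f x)" for i
    proof (rule AE_I2)
      fix x :: 'a
      have "norm (f x - s i x) \<le> norm (f x) + norm (s i x)" by (rule norm_triangle_ineq4)
      also have "\<dots> \<le> 3 * norm (f x)" using lim.hyps(3)[of x i] by simp
      finally show "norm (norm (f x - s i x)) \<le> 3 * norm (f x)" by simp
    qed
  qed (use lim.hyps(4) in auto)
  show ?case
  proof (rule L1_translation_closure[OF lim.hyps(4)])
    fix e :: real assume "e > 0"
    from LIMSEQ_D[OF conv this] obtain i where i: "norm ((\<integral>x. norm (f x - s i x) \<partial>lborel) - (\<integral>x. 0 \<partial>(lborel :: 'a measure))) < e" by blast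
    then have "(\<integral>x. norm (f x - s i x) \<partial>lborel) < e" by simp
    then show "\<exists>g. integrable lborel g \<and> (\<integral>x. norm (f x - g x) \<partial>lborel) < e \<and>
      (\<lambda>n. \<integral>x. norm (g (x + v n) - g x) \<partial>lborel) \<longlonglongrightarrow> 0"
      using lim.hyps(1) lim.IH by blast
  qed
qed

section \<open>Fubini for bounded kernels, Gaussian summation and the Plancherel identity\<close>

lemma integrable_pair_bounded_kernel:
  fixes F :: "'b::euclidean_space \<Rightarrow> complex" and g :: "'a::euclidean_space \<Rightarrow> complex"
  assumes F: "integrable lborel F" and g: "integrable lborel g"
    and c[measurable]: "(\<lambda>(x, y). c x y) \<in> borel_measurable (lborel \<Otimes>\<^sub>M lborel)"
    and B: "\<And>x y. cmod (c x y) \<le> B"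
  shows "integrable (lborel \<Otimes>\<^sub>M lborel) (\<lambda>(x, y). g x * F y * c x y)"
proof -
  have [measurable]: "F \<in> borel_measurable borel" "g \<in> borel_measurable borel" using F g by auto
  have "integrable (lborel \<Otimes>\<^sub>M lborel) (\<lambda>(x, y). g x * F y)"
  proof (rule lborel_pair.Fubini_integrable)
    show "(\<lambda>(x, y). g x * F y) \<in> borel_measurable (lborel \<Otimes>\<^sub>M lborel)" by measurable
  qed (use F g in \<open>auto simp: norm_mult\<close>)
  then have "integrable (lborel \<Otimes>\<^sub>M lborel) (\<lambda>z. B *\<^sub>R (case z of (x, y) \<Rightarrow> g x * F y))"
    by simp
  then show ?thesis
  proof (rule Bochner_Integration.integrable_bound)
    show "(\<lambda>(x, y). g x * F y * c x y) \<in> borel_measurable (lborel \<Otimes>\<^sub>M lborel)" by measurable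
    show "AE z in lborel \<Otimes>\<^sub>M lborel. norm (case z of (x, y) \<Rightarrow> g x * F y * c x y)
        \<le> norm (B *\<^sub>R (case z of (x, y) \<Rightarrow> g x * F y))"
    proof (rule AE_I2, clarify)
      fix x y
      have "cmod (c x y) \<le> \<bar>B\<bar>" using B[of x y] by simp
      then have "norm (g x * F y) * cmod (c x y) \<le> norm (g x * F y) * \<bar>B\<bar>"
        by (intro mult_left_mono) auto
      then show "norm (g x * F y * c x y) \<le> norm (B *\<^sub>R (g x * F y))"
        by (simp add: norm_mult mult.commute)
    qed
  qed
qed

text \<open>The form of Fubini behind every exchange below: the kernel is a character, a conjugate
  character or a translate of a bounded function.\<close>

lemma integral_swap_bounded_kernel:
  fixes F :: "'b::euclidean_space \<Rightarrow> complex" and g :: "'a::euclidean_space \<Rightarrow> complex"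
  assumes "integrable lborel F" "integrable lborel g"
    and "(\<lambda>(x, y). c x y) \<in> borel_measurable (lborel \<Otimes>\<^sub>M lborel)"
    and "\<And>x y. cmod (c x y) \<le> B"
  shows "(\<integral>x. g x * (\<integral>y. F y * c x y \<partial>lborel) \<partial>lborel) = (\<integral>y. F y * (\<integral>x. g x * c x y \<partial>lborel) \<partial>lborel)"
proof -
  have "(\<integral>y. \<integral>x. g x * F y * c x y \<partial>lborel \<partial>lborel) = (\<integral>x. \<integral>y. g x * F y * c x y \<partial>lborel \<partial>lborel)"
    by (rule lborel_pair.Fubini_integral[OF integrable_pair_bounded_kernel[OF assms]])
  moreover have "(\<integral>x. g x * F y * c x y \<partial>lborel) = F y * (\<integral>x. g x * c x y \<partial>lborel)" for y
    by (subst integral_mult_right_zero[symmetric]) (simp add: mult_ac)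
  moreover have "(\<integral>y. g x * F y * c x y \<partial>lborel) = g x * (\<integral>y. F y * c x y \<partial>lborel)" for x
    by (subst integral_mult_right_zero[symmetric]) (simp add: mult_ac)
  ultimately show ?thesis by simp
qed

lemma borel_measurable_cis [measurable]: "cis \<in> borel_measurable borel"
  by (intro borel_measurable_continuous_onI continuous_intros)

lemma borel_measurable_cnj [measurable]: "cnj \<in> borel_measurable borel"
  by (intro borel_measurable_continuous_onI continuous_intros)

context
  fixes F :: "'a::euclidean_space \<Rightarrow> complex" and C :: real
  assumes F: "integrable lborel F" and C: "\<And>x. cmod (F x) \<le> C"
begin

lemma F_meas[measurable]: "F \<in> borel_measurable borel" using F by auto

definition "ift x = (\<integral>\<eta>. F \<eta> * cis (2 * pi * (\<eta> \<bullet> x)) \<partial>lborel)"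
definition "autocorr v = (\<integral>\<eta>. F \<eta> * cnj (F (\<eta> + v)) \<partial>lborel)"
text \<open>The density of the centred normal law with standard deviation
  \<open>1 / (2 * pi)\<close> in each coordinate. It arises from the transform of the Gaussian
  weight, and its normalisation does not depend on the scale \<open>s\<close>.\<close>

definition "kern w = sqrt (2 * pi) ^ DIM('a) * exp (- (2 * pi * norm (w::'a))\<^sup>2 / 2)"

lemma ift_meas[measurable]: "ift \<in> borel_measurable borel"
  unfolding ift_def[abs_def] by measurable

lemma cmod_ift_le: "cmod (ift x) \<le> (\<integral>\<eta>. cmod (F \<eta>) \<partial>lborel)"
proof -
  have "cmod (ift x) \<le> (\<integral>\<eta>. cmod (F \<eta> * cis (2 * pi * (\<eta> \<bullet> x))) \<partial>lborel)"
    unfolding ift_def by (rule integral_norm_bound)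
  then show ?thesis by (simp add: norm_mult)
qed

lemma F_sq_integrable: "integrable lborel (\<lambda>x. (cmod (F x))\<^sup>2)"
proof (rule Bochner_Integration.integrable_bound)
  show "integrable lborel (\<lambda>x. C *\<^sub>R F x)" using F by simp
  show "AE x in lborel. norm ((cmod (F x))\<^sup>2) \<le> norm (C *\<^sub>R F x)"
  proof (rule AE_I2)
    fix x
    have "cmod (F x) * cmod (F x) \<le> \<bar>C\<bar> * cmod (F x)"
      using C[of x] by (intro mult_right_mono) auto
    then show "norm ((cmod (F x))\<^sup>2) \<le> norm (C *\<^sub>R F x)" by (simp add: power2_eq_square)
  qed
qed simp

lemma kern_integral: "integrable lborel kern" "(\<integral>w. kern w \<partial>lborel) = 1"
proof -
  have e: "cis (0 \<bullet> x) * complex_of_real (exp (- (2 * pi * norm x)\<^sup>2 / 2)) = complex_of_real (exp (- (2 * pi * norm x)\<^sup>2 / 2))" for x :: 'a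
    by simp
  have "0 < 2 * pi" by simp
  note g = gaussian_fourier[OF this, of "0::'a", unfolded e]
  have i: "integrable lborel (\<lambda>x::'a. exp (- (2 * pi * norm x)\<^sup>2 / 2))"
    using g(1) by (simp only: complex_of_real_integrable_eq)
  then show "integrable lborel kern" unfolding kern_def[abs_def] by (rule integrable_mult_right)
  have "complex_of_real (\<integral>x. exp (- (2 * pi * norm (x::'a))\<^sup>2 / 2) \<partial>lborel) = complex_of_real ((sqrt (2 * pi) / (2 * pi)) ^ DIM('a))"
    using g(2) by (simp add: integral_complex_of_real del: of_real_power of_real_divide)
  then have "(\<integral>x. exp (- (2 * pi * norm (x::'a))\<^sup>2 / 2) \<partial>lborel) = (sqrt (2 * pi) / (2 * pi)) ^ DIM('a)"
    by (simp only: of_real_eq_iff)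
  then have "(\<integral>w. kern w \<partial>lborel) = sqrt (2 * pi) ^ DIM('a) * (sqrt (2 * pi) / (2 * pi)) ^ DIM('a)"
    unfolding kern_def by simp
  also have "\<dots> = (sqrt (2 * pi) * sqrt (2 * pi) / (2 * pi)) ^ DIM('a)"
    by (simp only: power_mult_distrib[symmetric] times_divide_eq_right)
  finally show "(\<integral>w. kern w \<partial>lborel) = 1" by simp
qed

text \<open>
  Gaussian summation: the integral of \<open>|ift|\<^sup>2\<close> against \<open>exp (- (s |x|)\<^sup>2 / 2)\<close> is an average of the
  autocorrelation of \<open>F\<close> at scale \<open>s\<close>, which tends to its value at 0.
\<close>

lemma gaussian_summation:
  assumes s: "s > 0"
  shows "integrable lborel (\<lambda>x. (cmod (ift x))\<^sup>2 * exp (- (s * norm x)\<^sup>2 / 2))"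
    and "complex_of_real (\<integral>x. (cmod (ift x))\<^sup>2 * exp (- (s * norm x)\<^sup>2 / 2) \<partial>lborel)
      = (\<integral>w. complex_of_real (kern w) * autocorr (s *\<^sub>R w) \<partial>lborel)"
proof -
  define e where "e x = exp (- (s * norm (x::'a))\<^sup>2 / 2)" for x
  define E where "E x = complex_of_real (e x)" for x
  have [measurable]: "e \<in> borel_measurable borel" unfolding e_def[abs_def] by measurable
  have [measurable]: "E \<in> borel_measurable borel" unfolding E_def[abs_def] by measurable
  have E: "integrable lborel E"
    using gaussian_fourier(1)[OF s, of "0::'a"] unfolding E_def[abs_def] e_def by simp
  define N where "N = (\<integral>\<eta>. cmod (F \<eta>) \<partial>lborel)"
  have fN: "cmod (ift x) \<le> N" for x unfolding N_def by (rule cmod_ift_le)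
  have sq: "complex_of_real ((cmod (ift x))\<^sup>2 * e x) = (cnj (ift x) * E x) * ift x" for x
    by (simp only: E_def of_real_mult complex_norm_square mult_ac)
  have iE: "integrable lborel (\<lambda>x. cnj (ift x) * E x)"
  proof (rule Bochner_Integration.integrable_bound)
    show "integrable lborel (\<lambda>x. N *\<^sub>R E x)" using E by simp
    show "AE x in lborel. norm (cnj (ift x) * E x) \<le> norm (N *\<^sub>R E x)"
      using fN by (intro AE_I2) (auto simp: norm_mult intro!: mult_right_mono order_trans[OF _ abs_ge_self])
  qed simp
  have "integrable lborel (\<lambda>x. (cnj (ift x) * E x) * ift x)"
  proof (rule Bochner_Integration.integrable_bound)
    show "integrable lborel (\<lambda>x. N *\<^sub>R (cnj (ift x) * E x))" using iE by simp
    show "AE x in lborel. norm ((cnj (ift x) * E x) * ift x) \<le> norm (N *\<^sub>R (cnj (ift x) * E x))"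
    proof (rule AE_I2)
      fix x
      have "norm (cnj (ift x) * E x) * norm (ift x) \<le> norm (cnj (ift x) * E x) * \<bar>N\<bar>"
        by (intro mult_left_mono order_trans[OF fN]) auto
      then show "norm ((cnj (ift x) * E x) * ift x) \<le> norm (N *\<^sub>R (cnj (ift x) * E x))"
        by (simp add: norm_mult mult_ac)
    qed
  qed simp
  then have "integrable lborel (\<lambda>x. complex_of_real ((cmod (ift x))\<^sup>2 * e x))"
    unfolding sq .
  then show "integrable lborel (\<lambda>x. (cmod (ift x))\<^sup>2 * exp (- (s * norm x)\<^sup>2 / 2))"
    unfolding complex_of_real_integrable_eq e_def .
  \<comment> \<open>Opening one factor of \<open>|ift|^2\<close> and integrating over
    \<open>x\<close> first leaves the transform of a Gaussian at \<open>\<eta> - \<zeta>\<close>;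
    the substitution \<open>\<zeta> = \<eta> + s *\<^sub>R w\<close> turns it into
    \<open>kern\<close>, the Jacobian cancelling the powers of \<open>s\<close>.\<close>
  have inner: "(\<integral>x. (cnj (ift x) * E x) * cis (2 * pi * (\<eta> \<bullet> x)) \<partial>lborel)
     = (\<integral>w. complex_of_real (kern w) * cnj (F (\<eta> + s *\<^sub>R w)) \<partial>lborel)" for \<eta>
  proof -
    have cn: "cnj (ift x) = (\<integral>\<zeta>. cnj (F \<zeta>) * cnj (cis (2 * pi * (\<zeta> \<bullet> x))) \<partial>lborel)" for x
    proof -
      have "integrable lborel (\<lambda>\<eta>. F \<eta> * cis (2 * pi * (\<eta> \<bullet> x)))"
        by (rule Bochner_Integration.integrable_bound[OF F]) (auto simp: norm_mult)
      from integral_bounded_linear[OF bounded_linear_cnj this] show ?thesis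
        by (simp add: ift_def)
    qed
    have cF: "integrable lborel (\<lambda>\<zeta>. cnj (F \<zeta>))" using F by simp
    have ei: "integrable lborel (\<lambda>x. E x * cis (2 * pi * (\<eta> \<bullet> x)))"
      by (rule Bochner_Integration.integrable_bound[OF E]) (auto simp: norm_mult)
    have "(\<integral>x. (cnj (ift x) * E x) * cis (2 * pi * (\<eta> \<bullet> x)) \<partial>lborel)
      = (\<integral>x. (E x * cis (2 * pi * (\<eta> \<bullet> x))) * (\<integral>\<zeta>. cnj (F \<zeta>) * cnj (cis (2 * pi * (\<zeta> \<bullet> x))) \<partial>lborel) \<partial>lborel)"
      unfolding cn by (simp add: mult_ac)
    also have "\<dots> = (\<integral>\<zeta>. cnj (F \<zeta>) * (\<integral>x. (E x * cis (2 * pi * (\<eta> \<bullet> x))) * cnj (cis (2 * pi * (\<zeta> \<bullet> x))) \<partial>lborel) \<partial>lborel)"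
      by (rule integral_swap_bounded_kernel[OF cF ei, where B = 1]) simp_all
    also have "(\<lambda>\<zeta>. \<integral>x. (E x * cis (2 * pi * (\<eta> \<bullet> x))) * cnj (cis (2 * pi * (\<zeta> \<bullet> x))) \<partial>lborel)
       = (\<lambda>\<zeta>. complex_of_real ((sqrt (2 * pi) / s) ^ DIM('a) * exp (- (norm ((2 * pi) *\<^sub>R (\<eta> - \<zeta>)) / s)\<^sup>2 / 2)))"
    proof
      fix \<zeta>
      have "(E x * cis (2 * pi * (\<eta> \<bullet> x))) * cnj (cis (2 * pi * (\<zeta> \<bullet> x)))
        = cis ((2 * pi) *\<^sub>R (\<eta> - \<zeta>) \<bullet> x) * complex_of_real (exp (- (s * norm x)\<^sup>2 / 2))" for x
        by (simp add: E_def e_def cis_cnj cis_mult mult.assoc inner_diff_left right_diff_distrib)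
      then show "(\<integral>x. (E x * cis (2 * pi * (\<eta> \<bullet> x))) * cnj (cis (2 * pi * (\<zeta> \<bullet> x))) \<partial>lborel)
        = complex_of_real ((sqrt (2 * pi) / s) ^ DIM('a) * exp (- (norm ((2 * pi) *\<^sub>R (\<eta> - \<zeta>)) / s)\<^sup>2 / 2))"
        by (simp only: gaussian_fourier(2)[OF s])
    qed
    also have "(\<integral>\<zeta>. cnj (F \<zeta>) * complex_of_real ((sqrt (2 * pi) / s) ^ DIM('a) * exp (- (norm ((2 * pi) *\<^sub>R (\<eta> - \<zeta>)) / s)\<^sup>2 / 2)) \<partial>lborel)
      = \<bar>s\<bar> ^ DIM('a) *\<^sub>R (\<integral>w. cnj (F (\<eta> + s *\<^sub>R w)) * complex_of_real ((sqrt (2 * pi) / s) ^ DIM('a) *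
           exp (- (norm ((2 * pi) *\<^sub>R (\<eta> - (\<eta> + s *\<^sub>R w))) / s)\<^sup>2 / 2)) \<partial>lborel)"
      by (rule lborel_integral_affine) (use s in auto)
    also have "\<dots> = (\<integral>w. complex_of_real (kern w) * cnj (F (\<eta> + s *\<^sub>R w)) \<partial>lborel)"
    proof -
      have "\<bar>s\<bar> ^ DIM('a) *\<^sub>R (cnj (F (\<eta> + s *\<^sub>R w)) * complex_of_real ((sqrt (2 * pi) / s) ^ DIM('a) *
           exp (- (norm ((2 * pi) *\<^sub>R (\<eta> - (\<eta> + s *\<^sub>R w))) / s)\<^sup>2 / 2)))
         = complex_of_real (kern w) * cnj (F (\<eta> + s *\<^sub>R w))" for w
        using s by (simp add: kern_def scaleR_conv_of_real power_divide field_simps)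
      then show ?thesis by (simp flip: integral_scaleR_right)
    qed
    finally show ?thesis .
  qed
  \<comment> \<open>Now the other factor is opened; the last exchange moves the average over
    \<open>w\<close> outside and produces the autocorrelation.\<close>
  have "complex_of_real (\<integral>x. (cmod (ift x))\<^sup>2 * e x \<partial>lborel) = (\<integral>x. (cnj (ift x) * E x) * ift x \<partial>lborel)"
    unfolding sq[symmetric] integral_complex_of_real ..
  also have "\<dots> = (\<integral>\<eta>. F \<eta> * (\<integral>x. (cnj (ift x) * E x) * cis (2 * pi * (\<eta> \<bullet> x)) \<partial>lborel) \<partial>lborel)"
    by (subst (2) ift_def[abs_def])
       (rule integral_swap_bounded_kernel[OF F iE, where B = 1 and c = "\<lambda>x \<eta>. cis (2 * pi * (\<eta> \<bullet> x))"], simp_all)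
  also have "\<dots> = (\<integral>\<eta>. F \<eta> * (\<integral>w. complex_of_real (kern w) * cnj (F (\<eta> + s *\<^sub>R w)) \<partial>lborel) \<partial>lborel)"
    unfolding inner ..
  also have "\<dots> = (\<integral>w. complex_of_real (kern w) * (\<integral>\<eta>. F \<eta> * cnj (F (\<eta> + s *\<^sub>R w)) \<partial>lborel) \<partial>lborel)"
    by (rule integral_swap_bounded_kernel[OF _ F, where B = C]) (use kern_integral(1) C in \<open>auto\<close>)
  finally show "complex_of_real (\<integral>x. (cmod (ift x))\<^sup>2 * exp (- (s * norm x)\<^sup>2 / 2) \<partial>lborel)
      = (\<integral>w. complex_of_real (kern w) * autocorr (s *\<^sub>R w) \<partial>lborel)"
    unfolding e_def autocorr_def .
qed

lemma autocorr_integrand_bound: "cmod (F \<eta> * cnj (F (\<eta> + v))) \<le> \<bar>C\<bar> * cmod (F \<eta>)"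
proof -
  have "cmod (F (\<eta> + v)) * cmod (F \<eta>) \<le> \<bar>C\<bar> * cmod (F \<eta>)"
    by (rule mult_right_mono[OF order_trans[OF C abs_ge_self]]) simp
  then show ?thesis by (simp only: norm_mult complex_mod_cnj mult.commute[of "cmod (F \<eta>)" "cmod (F (\<eta> + v))"])
qed

lemma autocorr_integrable: "integrable lborel (\<lambda>\<eta>. F \<eta> * cnj (F (\<eta> + v)))"
proof (rule Bochner_Integration.integrable_bound)
  show "integrable lborel (\<lambda>\<eta>. C *\<^sub>R F \<eta>)" using F by simp
  show "AE \<eta> in lborel. norm (F \<eta> * cnj (F (\<eta> + v))) \<le> norm (C *\<^sub>R F \<eta>)"
    using autocorr_integrand_bound by simp
qed simp

lemma autocorr_bound: "cmod (autocorr v) \<le> \<bar>C\<bar> * (\<integral>\<eta>. cmod (F \<eta>) \<partial>lborel)"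
proof -
  have "cmod (autocorr v) \<le> (\<integral>\<eta>. \<bar>C\<bar> * cmod (F \<eta>) \<partial>lborel)"
    unfolding autocorr_def
    by (rule Bochner_Integration.integral_norm_bound_integral[OF autocorr_integrable _ autocorr_integrand_bound])
       (use F in simp)
  then show ?thesis by simp
qed

text \<open>Since \<open>F\<close> is bounded by \<open>C\<close>, the autocorrelation changes by at
  most \<open>|C|\<close> times the L1 distance between \<open>F\<close> and its translate.\<close>

lemma autocorr_tendsto:
  assumes v: "v \<longlonglongrightarrow> 0"
  shows "(\<lambda>n::nat. autocorr (v n)) \<longlonglongrightarrow> autocorr 0"
proof (rule LIM_zero_cancel, rule Lim_null_comparison)
  show "(\<lambda>n. \<bar>C\<bar> * (\<integral>x. norm (F (x + v n) - F x) \<partial>lborel)) \<longlonglongrightarrow> 0"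
    using tendsto_mult_left[OF L1_translation_tendsto[OF F v], of "\<bar>C\<bar>"] by simp
  show "\<forall>\<^sub>F n in sequentially. norm (autocorr (v n) - autocorr 0) \<le> \<bar>C\<bar> * (\<integral>x. norm (F (x + v n) - F x) \<partial>lborel)"
  proof (rule always_eventually, rule allI)
    fix n
    note sh = lborel_integrable_shift[OF F, of "v n"]
    have "norm (autocorr (v n) - autocorr 0) = norm (\<integral>\<eta>. F \<eta> * cnj (F (\<eta> + v n)) - F \<eta> * cnj (F (\<eta> + 0)) \<partial>lborel)"
      unfolding autocorr_def by (subst Bochner_Integration.integral_diff[OF autocorr_integrable autocorr_integrable]) simp
    also have "\<dots> \<le> (\<integral>x. \<bar>C\<bar> * norm (F (x + v n) - F x) \<partial>lborel)"
    proof (rule Bochner_Integration.integral_norm_bound_integral)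
      fix x
      have "F x * cnj (F (x + v n)) - F x * cnj (F (x + 0)) = F x * cnj (F (x + v n) - F x)"
        by (simp add: algebra_simps)
      also have "norm \<dots> \<le> \<bar>C\<bar> * norm (F (x + v n) - F x)"
        unfolding norm_mult complex_mod_cnj by (intro mult_right_mono order_trans[OF C]) auto
      finally show "norm (F x * cnj (F (x + v n)) - F x * cnj (F (x + 0))) \<le> \<bar>C\<bar> * norm (F (x + v n) - F x)" .
    next
      show "integrable lborel (\<lambda>x. F x * cnj (F (x + v n)) - F x * cnj (F (x + 0)))"
        by (rule Bochner_Integration.integrable_diff[OF autocorr_integrable autocorr_integrable])
    qed (use F sh in auto)
    finally show "norm (autocorr (v n) - autocorr 0) \<le> \<bar>C\<bar> * (\<integral>x. norm (F (x + v n) - F x) \<partial>lborel)" by simp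
  qed
qed

text \<open>The averages of the autocorrelation converge by dominated convergence, while the
  Gaussian-weighted integrands increase to \<open>|ift|^2\<close>. Monotone convergence then yields
  the integrability together with the value, so no square integrability of \<open>ift\<close> is
  presupposed.\<close>

lemma plancherel:
  shows "integrable lborel (\<lambda>x. (cmod (ift x))\<^sup>2)"
    and "(\<integral>x. (cmod (ift x))\<^sup>2 \<partial>lborel) = (\<integral>x. (cmod (F x))\<^sup>2 \<partial>lborel)"
proof -
  define s where "s n = inverse (real (Suc n))" for n
  have s: "s n > 0" for n by (simp add: s_def)
  have s0: "s \<longlonglongrightarrow> 0" unfolding s_def[abs_def] by (rule LIMSEQ_inverse_real_of_nat)
  have [measurable]: "autocorr \<in> borel_measurable borel" unfolding autocorr_def[abs_def] by measurable
  have [measurable]: "kern \<in> borel_measurable borel" unfolding kern_def[abs_def] by measurable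
  have "(\<lambda>n. \<integral>w. complex_of_real (kern w) * autocorr (s n *\<^sub>R w) \<partial>lborel) \<longlonglongrightarrow> (\<integral>w. complex_of_real (kern w) * autocorr 0 \<partial>lborel)"
  proof (rule integral_dominated_convergence[where w = "\<lambda>w. kern w * (\<bar>C\<bar> * (\<integral>\<eta>. cmod (F \<eta>) \<partial>lborel))"])
    show "AE w in lborel. (\<lambda>n. complex_of_real (kern w) * autocorr (s n *\<^sub>R w)) \<longlonglongrightarrow> complex_of_real (kern w) * autocorr 0"
    proof (intro AE_I2 tendsto_mult_left autocorr_tendsto)
      fix w :: 'a
      show "(\<lambda>n. s n *\<^sub>R w) \<longlonglongrightarrow> 0" using tendsto_scaleR[OF s0 tendsto_const, of w] by simp
    qed
    show "AE w in lborel. norm (complex_of_real (kern w) * autocorr (s n *\<^sub>R w)) \<le> kern w * (\<bar>C\<bar> * (\<integral>\<eta>. cmod (F \<eta>) \<partial>lborel))" for n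
    proof (rule AE_I2)
      fix w
      have "kern w \<ge> 0" by (simp add: kern_def)
      then show "norm (complex_of_real (kern w) * autocorr (s n *\<^sub>R w)) \<le> kern w * (\<bar>C\<bar> * (\<integral>\<eta>. cmod (F \<eta>) \<partial>lborel))"
        unfolding norm_mult by (intro mult_mono autocorr_bound) auto
    qed
  qed (use kern_integral(1) in auto)
  also have "(\<integral>w. complex_of_real (kern w) * autocorr 0 \<partial>lborel) = complex_of_real (\<integral>x. (cmod (F x))\<^sup>2 \<partial>lborel)"
  proof -
    have "(\<integral>w. complex_of_real (kern w) \<partial>lborel) = 1" using kern_integral(2) by (simp add: integral_complex_of_real)
    then have "(\<integral>w. complex_of_real (kern w) * autocorr 0 \<partial>lborel) = autocorr 0" by simp
    also have "\<dots> = (\<integral>x. complex_of_real ((cmod (F x))\<^sup>2) \<partial>lborel)"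
      unfolding autocorr_def by (simp only: complex_norm_square add_0_right)
    finally show ?thesis by (simp only: integral_complex_of_real)
  qed
  finally have lim: "(\<lambda>n. \<integral>x. (cmod (ift x))\<^sup>2 * exp (- (s n * norm x)\<^sup>2 / 2) \<partial>lborel) \<longlonglongrightarrow> (\<integral>x. (cmod (F x))\<^sup>2 \<partial>lborel)"
    unfolding gaussian_summation(2)[OF s, symmetric] tendsto_of_real_iff .
  \<comment> \<open>The scales \<open>s n\<close> decrease, hence the Gaussian weights increase with
    \<open>n\<close>.\<close>
  have mono: "AE x in lborel. incseq (\<lambda>n. (cmod (ift x))\<^sup>2 * exp (- (s n * norm x)\<^sup>2 / 2))"
  proof (rule AE_I2)
    fix x
    have "s n \<le> s m" if "m \<le> n" for m n using that by (simp add: s_def)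
    then show "incseq (\<lambda>n. (cmod (ift x))\<^sup>2 * exp (- (s n * norm x)\<^sup>2 / 2))"
      unfolding incseq_def using s[THEN less_imp_le]
      by (auto intro!: mult_left_mono power_mono mult_right_mono)
  qed
  have ptw: "AE x in lborel. (\<lambda>n. (cmod (ift x))\<^sup>2 * exp (- (s n * norm x)\<^sup>2 / 2)) \<longlonglongrightarrow> (cmod (ift x))\<^sup>2"
  proof (rule AE_I2)
    fix x
    have "(\<lambda>n. (cmod (ift x))\<^sup>2 * exp (- (s n * norm x)\<^sup>2 / 2)) \<longlonglongrightarrow> (cmod (ift x))\<^sup>2 * exp (- (0 * norm x)\<^sup>2 / 2)"
      by (intro tendsto_intros s0) simp
    then show "(\<lambda>n. (cmod (ift x))\<^sup>2 * exp (- (s n * norm x)\<^sup>2 / 2)) \<longlonglongrightarrow> (cmod (ift x))\<^sup>2" by simp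
  qed
  show "integrable lborel (\<lambda>x. (cmod (ift x))\<^sup>2)"
    by (rule integrable_monotone_convergence[OF gaussian_summation(1)[OF s] mono ptw lim]) simp
  show "(\<integral>x. (cmod (ift x))\<^sup>2 \<partial>lborel) = (\<integral>x. (cmod (F x))\<^sup>2 \<partial>lborel)"
    by (rule integral_monotone_convergence[OF gaussian_summation(1)[OF s] mono ptw lim]) simp
qed

end

text \<open>The squared distance of \<open>F\<close> to the transform of the truncated
  \<open>h\<close> is expanded. Plancherel gives the two squared norms and Fubini the cross term, so
  the distance equals the part of the integral of \<open>h^2\<close> outside the ball, which tends
  to 0.\<close>

lemma fourier_inversion_L2:
  fixes F :: "'a::euclidean_space \<Rightarrow> complex" and h :: "'a \<Rightarrow> real"
  assumes F: "integrable lborel F" and C: "\<And>x. cmod (F x) \<le> C"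
    and h: "\<And>x. complex_of_real (h x) = (\<integral>\<eta>. F \<eta> * cis (2 * pi * (\<eta> \<bullet> x)) \<partial>lborel)"
  shows "h \<in> borel_measurable borel" "integrable lborel (\<lambda>x. (h x)\<^sup>2)" "integrable lborel (\<lambda>x. (cmod (F x))\<^sup>2)"
    "((\<lambda>R. \<integral>\<^sup>+ \<xi>. ennreal ((cmod (F \<xi> - (LINT x:cball 0 R|lborel. complex_of_real (h x) * cis (- 2 * pi * (\<xi> \<bullet> x)))))\<^sup>2) \<partial>lborel)
        \<longlongrightarrow> 0) at_top"
proof -
  have [measurable]: "F \<in> borel_measurable borel" using F by auto
  have hF: "complex_of_real (h x) = ift F x" for x unfolding h ift_def[OF F C] ..
  have "h = (\<lambda>x. Re (ift F x))" by (simp flip: hF)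
  then show [measurable]: "h \<in> borel_measurable borel"
    using measurable_compose[OF ift_meas[OF F C] borel_measurable_Re] by simp
  have ch: "cmod (ift F x) = \<bar>h x\<bar>" for x by (simp flip: hF)
  show h2: "integrable lborel (\<lambda>x. (h x)\<^sup>2)" using plancherel(1)[OF F C] by (simp add: ch)
  have pl: "(\<integral>x. (h x)\<^sup>2 \<partial>lborel) = (\<integral>x. (cmod (F x))\<^sup>2 \<partial>lborel)"
    using plancherel(2)[OF F C] by (simp add: ch)
  show F2: "integrable lborel (\<lambda>x. (cmod (F x))\<^sup>2)" by (rule F_sq_integrable[OF F C])
  define N where "N = (\<integral>\<eta>. cmod (F \<eta>) \<partial>lborel)"
  have hN: "\<bar>h x\<bar> \<le> N" for x using cmod_ift_le[OF F C, of x] by (simp add: ch N_def)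
  \<comment> \<open>The truncation of the bounded function \<open>h\<close> is integrable and
    bounded, so the Plancherel identity applies to it in the place of \<open>F\<close>.\<close>
  define G where "G R x = indicat_real (cball 0 R) x *\<^sub>R complex_of_real (h x)" for R and x :: 'a
  have cb[measurable]: "cball 0 R \<in> sets (borel :: 'a measure)" for R by simp
  have hm[measurable]: "(\<lambda>x. complex_of_real (h x)) \<in> borel_measurable borel" unfolding hF by (rule ift_meas[OF F C])
  have [measurable]: "G R \<in> borel_measurable borel" for R unfolding G_def[abs_def] by measurable
  have N0: "N \<ge> 0" unfolding N_def by simp
  have GN: "cmod (G R x) \<le> N" for R x using hN[of x] N0 by (auto simp: G_def indicator_def)
  have G: "integrable lborel (G R)" for R
  proof (rule Bochner_Integration.integrable_bound)
    show "integrable lborel (\<lambda>x::'a. N * indicat_real (cball 0 R) x)"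
      using emeasure_lborel_cball_finite[of "0::'a" R] by (intro integrable_mult_right) simp
    show "AE x in lborel. norm (G R x) \<le> norm (N * indicat_real (cball 0 R) x)"
      using hN by (intro AE_I2) (auto simp: G_def indicator_def intro: order_trans[OF _ abs_ge_self])
  qed simp
  define FR where "FR R \<xi> = (LINT x:cball 0 R|lborel. complex_of_real (h x) * cis (- 2 * pi * (\<xi> \<bullet> x)))" for R \<xi>
  \<comment> \<open>As \<open>h\<close> is real, its forward transform is the conjugate of the
    inverse transform.\<close>
  have FR: "FR R \<xi> = cnj (ift (G R) \<xi>)" for R \<xi>
  proof -
    have i: "integrable lborel (\<lambda>x. G R x * cis (2 * pi * (x \<bullet> \<xi>)))"
      by (rule Bochner_Integration.integrable_bound[OF G[of R]]) (auto simp: norm_mult)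
    have p: "cnj (G R x * cis (2 * pi * (x \<bullet> \<xi>))) = indicator (cball 0 R) x *\<^sub>R (complex_of_real (h x) * cis (- 2 * pi * (\<xi> \<bullet> x)))" for x
      by (simp add: G_def cis_cnj inner_commute)
    show ?thesis
      unfolding ift_def[OF G GN] integral_bounded_linear[OF bounded_linear_cnj i, symmetric] p
      by (simp add: FR_def set_lebesgue_integral_def)
  qed
  have G2: "(cmod (G R x))\<^sup>2 = indicat_real (cball 0 R) x * (h x)\<^sup>2" for R x
    by (simp add: G_def indicator_def)
  have iR: "integrable lborel (\<lambda>x. indicat_real (cball 0 R) x * (h x)\<^sup>2)" for R
    using F_sq_integrable[OF G GN, of R] by (simp add: G2)
  have FR2: "integrable lborel (\<lambda>\<xi>. (cmod (FR R \<xi>))\<^sup>2)"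
      "(\<integral>\<xi>. (cmod (FR R \<xi>))\<^sup>2 \<partial>lborel) = (\<integral>x. indicat_real (cball 0 R) x * (h x)\<^sup>2 \<partial>lborel)" for R
    using plancherel[OF G GN, of R] by (simp_all add: FR G2)
  have [measurable]: "FR R \<in> borel_measurable borel" for R
    unfolding FR[abs_def] using ift_meas[OF G GN, of R] by measurable
  have cross_int: "integrable lborel (\<lambda>\<xi>. F \<xi> * cnj (FR R \<xi>))" for R
  proof (rule Bochner_Integration.integrable_bound)
    define K where "K = (\<integral>\<eta>. cmod (G R \<eta>) \<partial>lborel)"
    show "integrable lborel (\<lambda>\<xi>. K *\<^sub>R F \<xi>)" using F by simp
    have "cmod (F \<xi>) * cmod (FR R \<xi>) \<le> cmod (F \<xi>) * \<bar>K\<bar>" for \<xi>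
      using cmod_ift_le[OF G GN, of R \<xi>] by (intro mult_left_mono) (auto simp: FR K_def)
    then show "AE \<xi> in lborel. norm (F \<xi> * cnj (FR R \<xi>)) \<le> norm (K *\<^sub>R F \<xi>)"
      by (intro AE_I2) (simp add: norm_mult mult.commute[of "\<bar>K\<bar>"])
  qed simp
  have cross: "(\<integral>\<xi>. F \<xi> * cnj (FR R \<xi>) \<partial>lborel) = complex_of_real (\<integral>x. indicat_real (cball 0 R) x * (h x)\<^sup>2 \<partial>lborel)" for R
  proof -
    have "(\<integral>\<xi>. F \<xi> * cnj (FR R \<xi>) \<partial>lborel) = (\<integral>\<xi>. F \<xi> * (\<integral>x. G R x * cis (2 * pi * (x \<bullet> \<xi>)) \<partial>lborel) \<partial>lborel)"
      by (simp add: FR ift_def[OF G GN])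
    also have "\<dots> = (\<integral>x. G R x * (\<integral>\<xi>. F \<xi> * cis (2 * pi * (x \<bullet> \<xi>)) \<partial>lborel) \<partial>lborel)"
      by (rule integral_swap_bounded_kernel[OF G F, where B = 1]) simp_all
    also have "(\<lambda>x. \<integral>\<xi>. F \<xi> * cis (2 * pi * (x \<bullet> \<xi>)) \<partial>lborel) = (\<lambda>x. complex_of_real (h x))"
      unfolding h by (rule ext, rule Bochner_Integration.integral_cong[OF refl]) (metis inner_commute)
    also have "(\<integral>x. G R x * complex_of_real (h x) \<partial>lborel) = (\<integral>x. complex_of_real (indicat_real (cball 0 R) x * (h x)\<^sup>2) \<partial>lborel)"
      by (rule Bochner_Integration.integral_cong[OF refl])
         (simp add: G_def scaleR_conv_of_real power2_eq_square)
    finally show ?thesis by (simp only: integral_complex_of_real)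
  qed
  have dist: "(\<integral>\<^sup>+ \<xi>. ennreal ((cmod (F \<xi> - FR R \<xi>))\<^sup>2) \<partial>lborel)
     = ennreal ((\<integral>x. (h x)\<^sup>2 \<partial>lborel) - (\<integral>x. indicat_real (cball 0 R) x * (h x)\<^sup>2 \<partial>lborel))" for R
  proof -
    have e: "(cmod (F \<xi> - FR R \<xi>))\<^sup>2 = (cmod (F \<xi>))\<^sup>2 + (cmod (FR R \<xi>))\<^sup>2 - 2 * Re (F \<xi> * cnj (FR R \<xi>))" for \<xi>
      unfolding cmod_power2 by (simp add: power2_eq_square algebra_simps)
    have re: "integrable lborel (\<lambda>\<xi>. Re (F \<xi> * cnj (FR R \<xi>)))"
      "(\<integral>\<xi>. Re (F \<xi> * cnj (FR R \<xi>)) \<partial>lborel) = (\<integral>x. indicat_real (cball 0 R) x * (h x)\<^sup>2 \<partial>lborel)"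
      using integrable_bounded_linear[OF bounded_linear_Re cross_int[of R]]
        integral_bounded_linear[OF bounded_linear_Re cross_int[of R]] cross[of R] by simp_all
    have "(\<integral>\<^sup>+ \<xi>. ennreal ((cmod (F \<xi> - FR R \<xi>))\<^sup>2) \<partial>lborel) = ennreal (\<integral>\<xi>. (cmod (F \<xi> - FR R \<xi>))\<^sup>2 \<partial>lborel)"
    proof (rule nn_integral_eq_integral)
      show "integrable lborel (\<lambda>\<xi>. (cmod (F \<xi> - FR R \<xi>))\<^sup>2)"
        unfolding e
        by (intro Bochner_Integration.integrable_diff Bochner_Integration.integrable_add integrable_mult_right F2 FR2(1) re(1))
    qed simp
    also have "(\<integral>\<xi>. (cmod (F \<xi> - FR R \<xi>))\<^sup>2 \<partial>lborel) = (\<integral>x. (h x)\<^sup>2 \<partial>lborel) - (\<integral>x. indicat_real (cball 0 R) x * (h x)\<^sup>2 \<partial>lborel)"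
    proof -
      have "(\<integral>\<xi>. (cmod (F \<xi> - FR R \<xi>))\<^sup>2 \<partial>lborel)
        = (\<integral>\<xi>. (cmod (F \<xi>))\<^sup>2 \<partial>lborel) + (\<integral>\<xi>. (cmod (FR R \<xi>))\<^sup>2 \<partial>lborel) - 2 * (\<integral>\<xi>. Re (F \<xi> * cnj (FR R \<xi>)) \<partial>lborel)"
        unfolding e
        by (subst Bochner_Integration.integral_diff, intro Bochner_Integration.integrable_add F2 FR2(1),
            intro integrable_mult_right re(1), subst Bochner_Integration.integral_add[OF F2 FR2(1)],
            subst integral_mult_right_zero, rule refl)
      then show ?thesis using FR2(2)[of R] re(2) pl by simp
    qed
    finally show ?thesis .
  qed
  have "((\<lambda>R. \<integral>x. indicat_real (cball 0 R) x * (h x)\<^sup>2 \<partial>lborel) \<longlongrightarrow> (\<integral>x. (h x)\<^sup>2 \<partial>lborel)) at_top"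
  proof (rule integral_dominated_convergence_at_top[where w = "\<lambda>x. (h x)\<^sup>2"])
    show "AE x in lborel. ((\<lambda>R. indicat_real (cball 0 R) x * (h x)\<^sup>2) \<longlongrightarrow> (h x)\<^sup>2) at_top"
    proof (rule AE_I2, rule tendsto_eventually)
      fix x :: 'a
      show "\<forall>\<^sub>F R in at_top. indicat_real (cball 0 R) x * (h x)\<^sup>2 = (h x)\<^sup>2"
        using eventually_ge_at_top[of "norm x"] by eventually_elim simp
    qed
    show "\<forall>\<^sub>F R in at_top. AE x in lborel. norm (indicat_real (cball 0 R) x * (h x)\<^sup>2) \<le> (h x)\<^sup>2"
      by (intro always_eventually allI AE_I2) (simp add: indicator_def)
  qed (use h2 in simp_all)
  from tendsto_diff[OF tendsto_const[of "\<integral>x. (h x)\<^sup>2 \<partial>lborel"] this]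
  have "((\<lambda>R. (\<integral>x. (h x)\<^sup>2 \<partial>lborel) - (\<integral>x. indicat_real (cball 0 R) x * (h x)\<^sup>2 \<partial>lborel)) \<longlongrightarrow> 0) at_top" by simp
  from tendsto_ennrealI[OF this]
  show "((\<lambda>R. \<integral>\<^sup>+ \<xi>. ennreal ((cmod (F \<xi> - (LINT x:cball 0 R|lborel. complex_of_real (h x) * cis (- 2 * pi * (\<xi> \<bullet> x)))))\<^sup>2) \<partial>lborel)
        \<longlongrightarrow> 0) at_top"
    unfolding FR_def[symmetric] dist by simp
qed

text \<open>Needed because the symbol, and with it every transform built from it, is only Lebesgue
  measurable, whereas the inversion argument works with Borel functions.\<close>

lemma lebesgue_ex_borel_complex:
  fixes F :: "'a::euclidean_space \<Rightarrow> complex"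
  assumes F: "F \<in> borel_measurable lebesgue" and C: "\<And>x. cmod (F x) \<le> C"
  shows "\<exists>F'\<in>borel_measurable borel. (AE x in lebesgue. F x = F' x) \<and> (\<forall>x. cmod (F' x) \<le> C)"
proof -
  have "(\<lambda>x. Re (F x)) \<in> borel_measurable lebesgue" "(\<lambda>x. Im (F x)) \<in> borel_measurable lebesgue"
    using F by measurable
  then obtain r i where r[measurable]: "r \<in> borel_measurable lborel" and "AE x in lborel. Re (F x) = r x"
    and i[measurable]: "i \<in> borel_measurable lborel" and "AE x in lborel. Im (F x) = i x"
    using completion_ex_borel_measurable_real by metis
  then have ae: "AE x in lebesgue. F x = Complex (r x) (i x)"
    using AE_completion by (auto simp: complex_eq_iff)
  have [measurable]: "(\<lambda>x. Complex (r x) (i x)) \<in> borel_measurable borel"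
    using r i by (simp add: borel_measurable_complex_iff)
  \<comment> \<open>Resetting the values that are too large to 0 changes \<open>F'\<close> only on a
    null set and keeps the bound at every point.\<close>
  define F' where "F' x = (if cmod (Complex (r x) (i x)) \<le> C then Complex (r x) (i x) else 0)" for x
  have "0 \<le> C" using C[of undefined] norm_ge_zero order_trans by blast
  then have "\<forall>x. cmod (F' x) \<le> C" by (simp add: F'_def)
  moreover have "F' \<in> borel_measurable borel" unfolding F'_def[abs_def] by measurable
  moreover have "AE x in lebesgue. F x = F' x"
    using ae
  proof eventually_elim
    case (elim x)
    then show ?case using C[of x] by (simp add: F'_def)
  qed
  ultimately show ?thesis by blast
qed

text \<open>All requirements on \<open>F\<close> are insensitive to null sets, so the inversion
  theorem for a Borel representative carries over.\<close>

lemma is_fourier_transform_Euclidean: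
  fixes F :: "real^'n \<Rightarrow> complex" and h :: "real^'n \<Rightarrow> real"
  assumes F: "integrable lebesgue F" and C: "\<And>x. cmod (F x) \<le> C"
    and h: "\<And>x. complex_of_real (h x) = (\<integral>\<eta>. F \<eta> * cis (2 * pi * (\<eta> \<bullet> x)) \<partial>lebesgue)"
  shows "is_fourier_transform Euclidean h F"
proof -
  have Fm: "F \<in> borel_measurable lebesgue" using F by auto
  obtain F' where F'[measurable]: "F' \<in> borel_measurable borel" and ae: "AE x in lebesgue. F x = F' x"
    and C': "\<And>x. cmod (F' x) \<le> C" using lebesgue_ex_borel_complex[OF Fm C] by blast
  have F'l: "F' \<in> borel_measurable lebesgue" using F' by (simp add: measurable_completion)
  have "integrable lebesgue F'" using F integrable_cong_AE[OF Fm F'l ae] by simp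
  then have iF': "integrable lborel F'" by (simp add: integrable_completion)
  have h': "complex_of_real (h x) = (\<integral>\<eta>. F' \<eta> * cis (2 * pi * (\<eta> \<bullet> x)) \<partial>lborel)" for x
  proof -
    have m: "(\<lambda>\<eta>. F' \<eta> * cis (2 * pi * (\<eta> \<bullet> x))) \<in> borel_measurable lborel" by measurable
    have cm: "(\<lambda>\<eta>. cis (2 * pi * (\<eta> \<bullet> x))) \<in> borel_measurable lebesgue"
      by (intro measurable_completion) measurable
    have "(\<integral>\<eta>. F \<eta> * cis (2 * pi * (\<eta> \<bullet> x)) \<partial>lebesgue) = (\<integral>\<eta>. F' \<eta> * cis (2 * pi * (\<eta> \<bullet> x)) \<partial>lebesgue)"
      using ae by (intro integral_cong_AE borel_measurable_times Fm F'l cm) auto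
    then show ?thesis using h integral_completion[OF m] by simp
  qed
  note inv = fourier_inversion_L2[OF iF' C' h']
  note [measurable] = inv(1)
  have cb[measurable]: "cball 0 R \<in> sets (borel :: (real^'n) measure)" for R by simp
  have hm[measurable]: "(\<lambda>x. complex_of_real (h x)) \<in> borel_measurable borel"
    using measurable_compose[OF inv(1) borel_measurable_of_real] by simp
  have fo: "fourier_on (cball 0 R) h \<xi> = (LINT x:cball 0 R|lborel. complex_of_real (h x) * cis (- 2 * pi * (\<xi> \<bullet> x)))" for R \<xi>
    unfolding fourier_on_def set_lebesgue_integral_def by (rule integral_completion) measurable
  have F2: "integrable lebesgue (\<lambda>x. (cmod (F x))\<^sup>2)"
  proof (subst integrable_cong_AE)
    show "AE x in lebesgue. (cmod (F x))\<^sup>2 = (cmod (F' x))\<^sup>2" using ae by eventually_elim simp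
    show "integrable lebesgue (\<lambda>x. (cmod (F' x))\<^sup>2)" using inv(3) by (simp add: integrable_completion)
  qed (use Fm F'l in measurable)
  have nn: "(\<integral>\<^sup>+ \<xi>. ennreal ((cmod (F \<xi> - fourier_on (cball 0 R) h \<xi>))\<^sup>2) \<partial>lebesgue)
     = (\<integral>\<^sup>+ \<xi>. ennreal ((cmod (F' \<xi> - (LINT x:cball 0 R|lborel. complex_of_real (h x) * cis (- 2 * pi * (\<xi> \<bullet> x)))))\<^sup>2) \<partial>lborel)" for R
    unfolding fo by (subst nn_integral_completion[symmetric], rule nn_integral_cong_AE) (use ae in auto)
  have "h \<in> borel_measurable lebesgue" by (rule measurable_completion) measurable
  moreover have "integrable lebesgue (\<lambda>x. (h x)\<^sup>2)" using inv(2) by (simp add: integrable_completion)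
  ultimately show ?thesis
    unfolding is_fourier_transform_def using Fm F2 inv(4) by (simp add: nn)
qed

section \<open>Superpositions of waves\<close>

lemma norm_fst_le_norm: "norm (fst w) \<le> norm w" and norm_snd_le_norm: "norm (snd w) \<le> norm w"
  by (metis norm_fst_le prod.collapse) (metis norm_snd_le prod.collapse)

lemma param_integral_continuous:
  fixes G :: "'p \<Rightarrow> 'e::real_normed_vector \<Rightarrow> 'b::{banach,second_countable_topology}"
  assumes "finite_measure M"
    and m: "\<And>z. (\<lambda>\<eta>. G \<eta> z) \<in> borel_measurable M"
    and c: "\<And>\<eta>. \<eta> \<in> space M \<Longrightarrow> continuous_on UNIV (G \<eta>)"
    and b: "\<And>R. \<exists>C. \<forall>\<eta>\<in>space M. \<forall>z. norm z \<le> R \<longrightarrow> norm (G \<eta> z) \<le> C"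
  shows "continuous_on UNIV (\<lambda>z. LINT \<eta>|M. G \<eta> z)"
  unfolding continuous_on_sequentially
proof (intro allI ballI impI, elim conjE)
  fix Z :: "nat \<Rightarrow> 'e" and z assume Z: "Z \<longlonglongrightarrow> z"
  interpret finite_measure M by fact
  obtain R where R: "\<And>n. norm (Z n) \<le> R"
    using convergent_imp_Bseq[of Z] Z by (auto simp: convergent_def Bseq_def)
  obtain C where C: "\<And>\<eta> z. \<eta> \<in> space M \<Longrightarrow> norm z \<le> R \<Longrightarrow> norm (G \<eta> z) \<le> C"
    using b[of R] by blast
  show "((\<lambda>z. LINT \<eta>|M. G \<eta> z) \<circ> Z) \<longlonglongrightarrow> (LINT \<eta>|M. G \<eta> z)"
    unfolding o_def
  proof (rule integral_dominated_convergence[where w = "\<lambda>_. C"])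
    show "AE \<eta> in M. (\<lambda>n. G \<eta> (Z n)) \<longlonglongrightarrow> G \<eta> z"
    proof (rule AE_I2)
      fix \<eta> assume "\<eta> \<in> space M"
      then have "isCont (G \<eta>) z" using c by (simp add: continuous_on_eq_continuous_at)
      then show "(\<lambda>n. G \<eta> (Z n)) \<longlonglongrightarrow> G \<eta> z" using Z by (rule isCont_tendsto_compose)
    qed
    show "AE \<eta> in M. norm (G \<eta> (Z n)) \<le> C" for n
      using C R by (intro AE_I2) blast
  qed (simp_all add: m)
qed

text \<open>The remainder quotients converge pointwise to 0 and, by the mean value inequality on the
  unit ball around \<open>z\<close>, are bounded by \<open>2 * C\<close>; constants are integrable
  since the measure is finite.\<close>

lemma param_integral_has_derivative:
  fixes G :: "'p \<Rightarrow> 'e::real_normed_vector \<Rightarrow> 'b::{banach,second_countable_topology}"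
  assumes "finite_measure M"
    and m: "\<And>z. (\<lambda>\<eta>. G \<eta> z) \<in> borel_measurable M"
    and m': "\<And>z v. (\<lambda>\<eta>. G' \<eta> z v) \<in> borel_measurable M"
    and d: "\<And>\<eta> z. \<eta> \<in> space M \<Longrightarrow> (G \<eta> has_derivative G' \<eta> z) (at z)"
    and b: "\<And>R. \<exists>C. \<forall>\<eta>\<in>space M. \<forall>z. norm z \<le> R \<longrightarrow> norm (G \<eta> z) \<le> C"
    and b': "\<And>R. \<exists>C. \<forall>\<eta>\<in>space M. \<forall>z v. norm z \<le> R \<longrightarrow> norm (G' \<eta> z v) \<le> C * norm v"
  shows "((\<lambda>z. LINT \<eta>|M. G \<eta> z) has_derivative (\<lambda>v. LINT \<eta>|M. G' \<eta> z v)) (at z)"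
proof -
  interpret finite_measure M by fact
  obtain C where C: "\<And>\<eta> x v. \<eta> \<in> space M \<Longrightarrow> norm x \<le> norm z + 1 \<Longrightarrow> norm (G' \<eta> x v) \<le> C * norm v"
    using b'[of "norm z + 1"] by blast
  have I: "integrable M (\<lambda>\<eta>. G \<eta> x)" for x
  proof -
    obtain B where "\<And>\<eta>. \<eta> \<in> space M \<Longrightarrow> norm (G \<eta> x) \<le> B" using b[of "norm x"] by blast
    then show ?thesis using m by (intro integrable_const_bound[of _ B]) auto
  qed
  have I': "integrable M (\<lambda>\<eta>. G' \<eta> z v)" for v
    using C[of _ z v] m' by (intro integrable_const_bound[of _ "C * norm v"]) auto
  have lin: "linear (G' \<eta> z)" if "\<eta> \<in> space M" for \<eta>
    using d[OF that] has_derivative_linear by blast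
  have "bounded_linear (\<lambda>v. LINT \<eta>|M. G' \<eta> z v)"
  proof (rule bounded_linear_intro[where K = "C * measure M (space M)"])
    show "(LINT \<eta>|M. G' \<eta> z (v + w)) = (LINT \<eta>|M. G' \<eta> z v) + (LINT \<eta>|M. G' \<eta> z w)" for v w
      by (subst Bochner_Integration.integral_add[symmetric, OF I' I'], rule Bochner_Integration.integral_cong)
         (simp_all add: linear_add[OF lin])
    show "(LINT \<eta>|M. G' \<eta> z (r *\<^sub>R v)) = r *\<^sub>R (LINT \<eta>|M. G' \<eta> z v)" for r v
      by (subst integral_scaleR_right[symmetric], rule Bochner_Integration.integral_cong)
         (simp_all add: linear_scale[OF lin])
    show "norm (LINT \<eta>|M. G' \<eta> z v) \<le> norm v * (C * measure M (space M))" for v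
    proof -
      have "norm (LINT \<eta>|M. G' \<eta> z v) \<le> (LINT \<eta>|M. C * norm v)"
        by (rule order_trans[OF integral_norm_bound integral_mono]) (use C[of _ z v] I' in auto)
      then show ?thesis by (simp add: mult_ac)
    qed
  qed
  moreover have "((\<lambda>x. ((LINT \<eta>|M. G \<eta> x) - (LINT \<eta>|M. G \<eta> z) - (LINT \<eta>|M. G' \<eta> z (x - z))) /\<^sub>R norm (x - z)) \<longlongrightarrow> 0) (at z)"
    unfolding tendsto_at_iff_sequentially
  proof (intro allI impI)
    fix X :: "nat \<Rightarrow> 'e" assume X: "\<forall>n. X n \<in> UNIV - {z}" "X \<longlonglongrightarrow> z"
    define Q where "Q \<eta> x = (G \<eta> x - G \<eta> z - G' \<eta> z (x - z)) /\<^sub>R norm (x - z)" for \<eta> x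
    have "((LINT \<eta>|M. G \<eta> x) - (LINT \<eta>|M. G \<eta> z) - (LINT \<eta>|M. G' \<eta> z (x - z))) /\<^sub>R norm (x - z) = (LINT \<eta>|M. Q \<eta> x)" for x
      unfolding Q_def using I I' by simp
    moreover have "(\<lambda>n. LINT \<eta>|M. Q \<eta> (X n)) \<longlonglongrightarrow> (LINT \<eta>|M. 0)"
    proof -
      have "\<forall>\<^sub>F n in sequentially. dist (X n) z < 1" using X(2) by (rule tendstoD) simp
      \<comment> \<open>Only the late terms of the sequence lie in the ball on which the bound
        \<open>C\<close> of the derivatives holds, hence the shift by \<open>N\<close>.\<close>
      then obtain N where N: "\<And>n. n \<ge> N \<Longrightarrow> dist (X n) z < 1" by (auto simp: eventually_sequentially)
      have lim: "(\<lambda>n. LINT \<eta>|M. Q \<eta> (X (n + N))) \<longlonglongrightarrow> (LINT \<eta>|M. 0)"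
      proof (rule integral_dominated_convergence[where w = "\<lambda>_. 2 * C"])
        show "(\<lambda>\<eta>. Q \<eta> (X (n + N))) \<in> borel_measurable M" for n
          unfolding Q_def using m m' by measurable
        show "AE \<eta> in M. (\<lambda>n. Q \<eta> (X (n + N))) \<longlonglongrightarrow> 0"
        proof (rule AE_I2)
          fix \<eta> assume "\<eta> \<in> space M"
          then have "((\<lambda>x. Q \<eta> x) \<longlongrightarrow> 0) (at z)"
            using d[of \<eta> z] by (simp add: has_derivative_at_within Q_def)
          then have "(Q \<eta> \<circ> X) \<longlonglongrightarrow> 0"
            using X unfolding tendsto_at_iff_sequentially by blast
          then show "(\<lambda>n. Q \<eta> (X (n + N))) \<longlonglongrightarrow> 0"
            unfolding o_def by (rule LIMSEQ_ignore_initial_segment)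
        qed
        show "AE \<eta> in M. norm (Q \<eta> (X (n + N))) \<le> 2 * C" for n
        proof (rule AE_I2)
          fix \<eta> assume \<eta>: "\<eta> \<in> space M"
          define x where "x = X (n + N)"
          have x: "x \<noteq> z" "dist x z < 1" using X(1) N[of "n + N"] by (auto simp: x_def)
          have seg: "norm w \<le> norm z + 1" if "w \<in> cball z 1" for w
            using that norm_triangle_ineq2[of w z] by (simp add: dist_norm norm_minus_commute)
          have "0 \<le> C * norm (x - z)"
            by (rule order_trans[OF norm_ge_zero C[OF \<eta>, of z]]) simp
          then have C0: "0 \<le> C" using x(1) by (simp add: zero_le_mult_iff)
          have "norm (G \<eta> x - G \<eta> z) \<le> C * norm (x - z)"
          proof (rule differentiable_bound[of "cball z 1"])
            show "(G \<eta> has_derivative G' \<eta> w) (at w within cball z 1)" for w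
              using d[OF \<eta>] by (rule has_derivative_at_withinI)
            show "onorm (G' \<eta> w) \<le> C" if "w \<in> cball z 1" for w
              by (rule onorm_bound[OF C0]) (rule C[OF \<eta> seg[OF that]])
          qed (use x in \<open>auto simp: dist_commute\<close>)
          moreover have "norm (G' \<eta> z (x - z)) \<le> C * norm (x - z)" using C[OF \<eta>, of z] by simp
          ultimately have "norm (G \<eta> x - G \<eta> z - G' \<eta> z (x - z)) \<le> 2 * C * norm (x - z)"
            using norm_triangle_ineq4[of "G \<eta> x - G \<eta> z" "G' \<eta> z (x - z)"] by simp
          then show "norm (Q \<eta> (X (n + N))) \<le> 2 * C"
            using x by (simp add: Q_def flip: x_def) (simp add: field_simps)
        qed
      qed auto
      show ?thesis by (rule LIMSEQ_offset[OF lim])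
    qed
    ultimately show "((\<lambda>x. ((LINT \<eta>|M. G \<eta> x) - (LINT \<eta>|M. G \<eta> z) - (LINT \<eta>|M. G' \<eta> z (x - z))) /\<^sub>R norm (x - z)) \<circ> X) \<longlonglongrightarrow> 0"
      by (simp add: o_def)
  qed
  ultimately show ?thesis by (simp add: has_derivative_at_within)
qed

section \<open>Waves: oscillations in the horizontal variable with profiles in the height,
  integrated over the frequencies\<close>

locale frequency_measure = finite_measure M
  for M :: "(real^'n) measure" +
  fixes K :: real and lam :: "real^'n \<Rightarrow> real"
  assumes id_meas[measurable]: "(\<lambda>\<eta>. \<eta>) \<in> borel_measurable M"
    and lam_meas[measurable]: "lam \<in> borel_measurable M"
    and norm_le: "\<And>\<eta>. \<eta> \<in> space M \<Longrightarrow> norm \<eta> \<le> K"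
    and lam_le: "\<And>\<eta>. \<eta> \<in> space M \<Longrightarrow> \<bar>lam \<eta>\<bar> \<le> K"
begin

text \<open>Exactly the conditions that dominated convergence over the frequencies requires: bounds
  uniform in \<open>\<eta>\<close>, but only local in the height, since hyperbolic functions
  grow.\<close>

definition profile :: "(real^'n \<Rightarrow> real \<Rightarrow> 'b::{banach,second_countable_topology}) \<Rightarrow> bool" where
  "profile f \<longleftrightarrow> (\<forall>y. (\<lambda>\<eta>. f \<eta> y) \<in> borel_measurable M) \<and>
    (\<forall>\<eta>\<in>space M. continuous_on UNIV (f \<eta>)) \<and>
    (\<forall>R. \<exists>C. \<forall>\<eta>\<in>space M. \<forall>y. \<bar>y\<bar> \<le> R \<longrightarrow> norm (f \<eta> y) \<le> C)"

definition profile_deriv where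
  "profile_deriv f f' \<longleftrightarrow> profile f \<and> profile f' \<and> (\<forall>\<eta>\<in>space M. \<forall>y. (f \<eta> has_vector_derivative f' \<eta> y) (at y))"

abbreviation osc :: "(real^'n \<Rightarrow> real \<Rightarrow> 'b) \<Rightarrow> (real^'n \<Rightarrow> real \<Rightarrow> 'b) \<Rightarrow> real \<Rightarrow> 'n point \<Rightarrow> real^'n \<Rightarrow> 'b::real_vector" where
  "osc f g t z \<eta> \<equiv> exp (- lam \<eta> * t) *\<^sub>R
     (cos (2 * pi * (\<eta> \<bullet> fst z)) *\<^sub>R f \<eta> (snd z) + sin (2 * pi * (\<eta> \<bullet> fst z)) *\<^sub>R g \<eta> (snd z))"

text \<open>The coefficients \<open>f\<close> of the cosine and \<open>g\<close> of the sine may be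
  vector-valued, so velocity, pressure and height are all instances.\<close>

definition wave :: "(real^'n \<Rightarrow> real \<Rightarrow> 'b) \<Rightarrow> (real^'n \<Rightarrow> real \<Rightarrow> 'b) \<Rightarrow> real \<Rightarrow> 'n point \<Rightarrow> 'b::{banach,second_countable_topology}" where
  "wave f g t z = (LINT \<eta>|M. osc f g t z \<eta>)"

lemma profile_bound:
  assumes "profile f"
  shows "\<exists>C\<ge>0. \<forall>\<eta>\<in>space M. \<forall>y. \<bar>y\<bar> \<le> R \<longrightarrow> norm (f \<eta> y) \<le> C"
proof -
  obtain C where C: "\<And>\<eta> y. \<eta> \<in> space M \<Longrightarrow> \<bar>y\<bar> \<le> R \<Longrightarrow> norm (f \<eta> y) \<le> C"
    using assms unfolding profile_def by blast
  show ?thesis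
    by (intro exI[of _ "\<bar>C\<bar>"] conjI ballI allI impI abs_ge_zero order_trans[OF C abs_ge_self])
qed

lemma profile_continuous: "profile f \<Longrightarrow> \<eta> \<in> space M \<Longrightarrow> continuous_on UNIV (f \<eta>)"
  by (simp add: profile_def)

lemma profile_add: "profile f \<Longrightarrow> profile g \<Longrightarrow> profile (\<lambda>\<eta> y. f \<eta> y + g \<eta> y)"
proof -
  assume f: "profile f" and g: "profile g"
  have "\<exists>C. \<forall>\<eta>\<in>space M. \<forall>y. \<bar>y\<bar> \<le> R \<longrightarrow> norm (f \<eta> y + g \<eta> y) \<le> C" for R
  proof -
    obtain C where C: "\<And>\<eta> y. \<eta> \<in> space M \<Longrightarrow> \<bar>y\<bar> \<le> R \<Longrightarrow> norm (f \<eta> y) \<le> C"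
      using f unfolding profile_def by blast
    obtain D where D: "\<And>\<eta> y. \<eta> \<in> space M \<Longrightarrow> \<bar>y\<bar> \<le> R \<Longrightarrow> norm (g \<eta> y) \<le> D"
      using g unfolding profile_def by blast
    have "norm (f \<eta> y + g \<eta> y) \<le> C + D" if "\<eta> \<in> space M" "\<bar>y\<bar> \<le> R" for \<eta> y
      by (rule norm_triangle_mono[OF C[OF that] D[OF that]])
    then show ?thesis by blast
  qed
  then show ?thesis using f g unfolding profile_def by (auto intro!: continuous_intros borel_measurable_add borel_measurable_scaleR)
qed

lemma profile_scaleR:
  fixes f :: "real^'n \<Rightarrow> real \<Rightarrow> 'b::{banach,second_countable_topology}"
  assumes f: "profile f" and c: "c \<in> borel_measurable M" and B: "\<And>\<eta>. \<eta> \<in> space M \<Longrightarrow> \<bar>c \<eta>\<bar> \<le> B"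
  shows "profile (\<lambda>\<eta> y. c \<eta> *\<^sub>R f \<eta> y)"
proof -
  have "\<exists>C. \<forall>\<eta>\<in>space M. \<forall>y. \<bar>y\<bar> \<le> R \<longrightarrow> norm (c \<eta> *\<^sub>R f \<eta> y) \<le> C" for R
  proof -
    obtain C where C: "C \<ge> 0" "\<forall>\<eta>\<in>space M. \<forall>y. \<bar>y\<bar> \<le> R \<longrightarrow> norm (f \<eta> y) \<le> C"
      using profile_bound[OF f] by blast
    have "norm (c \<eta> *\<^sub>R f \<eta> y) \<le> \<bar>B\<bar> * C" if "\<eta> \<in> space M" "\<bar>y\<bar> \<le> R" for \<eta> y
      unfolding norm_scaleR using C that by (intro mult_mono order_trans[OF B abs_ge_self]) auto
    then show ?thesis by blast
  qed
  then show ?thesis using f c unfolding profile_def by (auto intro!: continuous_intros borel_measurable_add borel_measurable_scaleR)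
qed

lemma profile_vec:
  fixes w :: "real^'n \<Rightarrow> 'b::{banach,second_countable_topology}"
  assumes f: "profile f" and w: "w \<in> borel_measurable M" and B: "\<And>\<eta>. \<eta> \<in> space M \<Longrightarrow> norm (w \<eta>) \<le> B"
  shows "profile (\<lambda>\<eta> y. f \<eta> y *\<^sub>R w \<eta>)"
proof -
  have "\<exists>C. \<forall>\<eta>\<in>space M. \<forall>y. \<bar>y\<bar> \<le> R \<longrightarrow> norm (f \<eta> y *\<^sub>R w \<eta>) \<le> C" for R
  proof -
    obtain C where C: "C \<ge> 0" "\<forall>\<eta>\<in>space M. \<forall>y. \<bar>y\<bar> \<le> R \<longrightarrow> norm (f \<eta> y) \<le> C"
      using profile_bound[OF f] by blast
    have "norm (f \<eta> y *\<^sub>R w \<eta>) \<le> C * \<bar>B\<bar>" if "\<eta> \<in> space M" "\<bar>y\<bar> \<le> R" for \<eta> y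
      unfolding norm_scaleR using C that
      by (intro mult_mono order_trans[OF B abs_ge_self]) auto
    then show ?thesis by blast
  qed
  then show ?thesis using f w unfolding profile_def by (auto intro!: continuous_intros borel_measurable_add borel_measurable_scaleR)
qed

lemma profile_zero: "profile (\<lambda>_ _. 0)"
  by (auto simp: profile_def)

lemma profile_deriv_zero: "profile_deriv (\<lambda>_ _. 0) (\<lambda>_ _. 0)"
  by (simp add: profile_deriv_def profile_zero)

lemma profile_deriv_add:
  "profile_deriv f f' \<Longrightarrow> profile_deriv g g' \<Longrightarrow> profile_deriv (\<lambda>\<eta> y. f \<eta> y + g \<eta> y) (\<lambda>\<eta> y. f' \<eta> y + g' \<eta> y)"
  by (auto simp: profile_deriv_def intro!: profile_add has_vector_derivative_add)

lemma profile_deriv_scaleR: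
  assumes f: "profile_deriv f f'" and c: "c \<in> borel_measurable M" "\<And>\<eta>. \<eta> \<in> space M \<Longrightarrow> \<bar>c \<eta>\<bar> \<le> B"
  shows "profile_deriv (\<lambda>\<eta> y. c \<eta> *\<^sub>R f \<eta> y) (\<lambda>\<eta> y. c \<eta> *\<^sub>R f' \<eta> y)"
  using f profile_scaleR[OF _ c, of f] profile_scaleR[OF _ c, of f'] unfolding profile_deriv_def
  by (auto intro!: derivative_eq_intros)

lemma profile_deriv_vec:
  fixes w :: "real^'n \<Rightarrow> 'b::{banach,second_countable_topology}"
  assumes f: "profile_deriv f f'" and w: "w \<in> borel_measurable M" "\<And>\<eta>. \<eta> \<in> space M \<Longrightarrow> norm (w \<eta>) \<le> B"
  shows "profile_deriv (\<lambda>\<eta> y. f \<eta> y *\<^sub>R w \<eta>) (\<lambda>\<eta> y. f' \<eta> y *\<^sub>R w \<eta>)"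
  using f profile_vec[OF _ w, of f] profile_vec[OF _ w, of f'] unfolding profile_deriv_def
  by (auto intro!: derivative_eq_intros simp: has_real_derivative_iff_has_vector_derivative)

lemma inner_freq_bound: "\<eta> \<in> space M \<Longrightarrow> \<bar>2 * pi * (\<eta> \<bullet> v)\<bar> \<le> 2 * pi * (K * norm v)"
  using norm_le[of \<eta>] Cauchy_Schwarz_ineq2[of \<eta> v]
  by (simp add: abs_mult) (meson mult_right_mono norm_ge_zero order_trans)

lemma K_nonneg: "\<eta> \<in> space M \<Longrightarrow> K \<ge> 0"
  using norm_le norm_ge_zero order_trans by blast

lemma wave_integrand_bound:
  assumes "\<eta> \<in> space M" "\<bar>t\<bar> \<le> R" "norm a \<le> C" "norm b \<le> D"
  shows "norm (exp (- lam \<eta> * t) *\<^sub>R (cos x *\<^sub>R a + sin x *\<^sub>R b)) \<le> exp (K * R) * (C + D)"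
proof -
  have "- lam \<eta> * t \<le> \<bar>lam \<eta>\<bar> * \<bar>t\<bar>" by (simp add: abs_mult[symmetric])
  also have "\<dots> \<le> K * R" using assms lam_le[of \<eta>] by (intro mult_mono K_nonneg) auto
  finally have e: "exp (- lam \<eta> * t) \<le> exp (K * R)" by simp
  have "norm (cos x *\<^sub>R a + sin x *\<^sub>R b) \<le> \<bar>cos x\<bar> * norm a + \<bar>sin x\<bar> * norm b"
    using norm_triangle_ineq[of "cos x *\<^sub>R a" "sin x *\<^sub>R b"] by simp
  also have "\<dots> \<le> 1 * norm a + 1 * norm b"
    by (intro add_mono mult_right_mono) auto
  also have "\<dots> \<le> C + D" using assms by simp
  finally show ?thesis unfolding norm_scaleR using e by (intro mult_mono) auto
qed

lemma wave_integrable: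
  assumes f: "profile f" and g: "profile g"
  shows "integrable M (\<lambda>\<eta>. exp (- lam \<eta> * t) *\<^sub>R
     (cos (2 * pi * (\<eta> \<bullet> x)) *\<^sub>R f \<eta> y + sin (2 * pi * (\<eta> \<bullet> x)) *\<^sub>R g \<eta> y))"
proof -
  obtain C D where "\<forall>\<eta>\<in>space M. \<forall>z. \<bar>z\<bar> \<le> \<bar>y\<bar> \<longrightarrow> norm (f \<eta> z) \<le> C" "\<forall>\<eta>\<in>space M. \<forall>z. \<bar>z\<bar> \<le> \<bar>y\<bar> \<longrightarrow> norm (g \<eta> z) \<le> D"
    using f g unfolding profile_def by metis
  moreover have [measurable]: "(\<lambda>\<eta>. f \<eta> y) \<in> borel_measurable M" "(\<lambda>\<eta>. g \<eta> y) \<in> borel_measurable M"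
    using f g by (auto simp: profile_def)
  ultimately show ?thesis
    by (intro integrable_const_bound[of _ "exp (K * \<bar>t\<bar>) * (C + D)"] AE_I2 wave_integrand_bound) auto
qed

lemma wave_continuous:
  assumes f: "profile f" and g: "profile g"
  shows "continuous_on UNIV (\<lambda>(t, z). wave f g t z)"
proof -
  have "continuous_on UNIV (\<lambda>w. LINT \<eta>|M. osc f g (fst w) (snd w) \<eta>)"
  proof (rule param_integral_continuous)
    show "finite_measure M" by (rule finite_measure_axioms)
    have [measurable]: "(\<lambda>\<eta>. f \<eta> y) \<in> borel_measurable M" "(\<lambda>\<eta>. g \<eta> y) \<in> borel_measurable M" for y
      using f g by (auto simp: profile_def)
    show "(\<lambda>\<eta>. osc f g (fst w) (snd w) \<eta>) \<in> borel_measurable M" for w :: "real \<times> 'n point"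
      by measurable
    show "continuous_on UNIV (\<lambda>w. osc f g (fst w) (snd w) \<eta>)"
      if "\<eta> \<in> space M" for \<eta>
      by (intro continuous_intros continuous_on_compose2[OF profile_continuous[OF f that]]
            continuous_on_compose2[OF profile_continuous[OF g that]]) auto
    fix R
    obtain C D where *: "\<forall>\<eta>\<in>space M. \<forall>z. \<bar>z\<bar> \<le> R \<longrightarrow> norm (f \<eta> z) \<le> C" "\<forall>\<eta>\<in>space M. \<forall>z. \<bar>z\<bar> \<le> R \<longrightarrow> norm (g \<eta> z) \<le> D"
      using f g unfolding profile_def by metis
    show "\<exists>C. \<forall>\<eta>\<in>space M. \<forall>w. norm w \<le> R \<longrightarrow> norm (osc f g (fst w) (snd w) \<eta>) \<le> C"
    proof (intro exI[of _ "exp (K * R) * (C + D)"] ballI allI impI)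
      fix \<eta> and w :: "real \<times> 'n point" assume "\<eta> \<in> space M" and w: "norm w \<le> R"
      moreover have "\<bar>fst w\<bar> \<le> R" "\<bar>snd (snd w)\<bar> \<le> R"
        using w norm_fst_le_norm[of w] norm_snd_le_norm[of w] norm_snd_le_norm[of "snd w"] by auto
      ultimately show "norm (osc f g (fst w) (snd w) \<eta>) \<le> exp (K * R) * (C + D)"
        using * by (intro wave_integrand_bound) auto
    qed
  qed
  then show ?thesis unfolding wave_def by (simp add: case_prod_beta')
qed

text \<open>Differentiation rotates the pair of cosine and sine coefficients, so the directional
  derivatives of waves are again waves. Second derivatives therefore need no separate
  argument.\<close>

lemma wave_has_derivative_space:
  assumes f: "profile_deriv f f'" and g: "profile_deriv g g'"
  shows "(wave f g t has_derivative (\<lambda>b.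
      wave (\<lambda>\<eta> y. snd b *\<^sub>R f' \<eta> y + (2 * pi * (\<eta> \<bullet> fst b)) *\<^sub>R g \<eta> y)
           (\<lambda>\<eta> y. snd b *\<^sub>R g' \<eta> y + (- (2 * pi * (\<eta> \<bullet> fst b))) *\<^sub>R f \<eta> y) t z)) (at z)"
  unfolding wave_def[abs_def]
proof (rule param_integral_has_derivative)
  let ?G' = "\<lambda>\<eta> z b. osc (\<lambda>\<eta> y. snd b *\<^sub>R f' \<eta> y + (2 * pi * (\<eta> \<bullet> fst b)) *\<^sub>R g \<eta> y)
    (\<lambda>\<eta> y. snd b *\<^sub>R g' \<eta> y + (- (2 * pi * (\<eta> \<bullet> fst b))) *\<^sub>R f \<eta> y) t z \<eta>"
  note fg = f[unfolded profile_deriv_def] g[unfolded profile_deriv_def]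
  have [measurable]: "(\<lambda>\<eta>. f \<eta> y) \<in> borel_measurable M" "(\<lambda>\<eta>. g \<eta> y) \<in> borel_measurable M"
     "(\<lambda>\<eta>. f' \<eta> y) \<in> borel_measurable M" "(\<lambda>\<eta>. g' \<eta> y) \<in> borel_measurable M" for y
    using fg by (auto simp: profile_def)
  show "finite_measure M" by (rule finite_measure_axioms)
  show "(\<lambda>\<eta>. osc f g t z \<eta>) \<in> borel_measurable M" for z :: "'n point"
    by measurable
  show "(\<lambda>\<eta>. ?G' \<eta> z b) \<in> borel_measurable M" for z b :: "'n point"
    by measurable
  show "((\<lambda>z. osc f g t z \<eta>) has_derivative
      (\<lambda>b. ?G' \<eta> z b)) (at z)"
    if "\<eta> \<in> space M" for \<eta> z
  proof -
    have df: "((\<lambda>z. f \<eta> (snd z)) has_derivative (\<lambda>b. snd b *\<^sub>R f' \<eta> (snd z))) (at z)"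
      using fg that by (auto intro!: has_derivative_compose[OF has_derivative_snd[OF has_derivative_ident], of "f \<eta>"] simp: has_vector_derivative_def)
    have dg: "((\<lambda>z. g \<eta> (snd z)) has_derivative (\<lambda>b. snd b *\<^sub>R g' \<eta> (snd z))) (at z)"
      using fg that by (auto intro!: has_derivative_compose[OF has_derivative_snd[OF has_derivative_ident], of "g \<eta>"] simp: has_vector_derivative_def)
    show ?thesis
      by (auto intro!: derivative_eq_intros df dg simp: fun_eq_iff algebra_simps)
  qed
  fix R
  obtain C D where CD: "\<forall>\<eta>\<in>space M. \<forall>z. \<bar>z\<bar> \<le> R \<longrightarrow> norm (f \<eta> z) \<le> C" "\<forall>\<eta>\<in>space M. \<forall>z. \<bar>z\<bar> \<le> R \<longrightarrow> norm (g \<eta> z) \<le> D"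
    using fg unfolding profile_def by metis
  obtain C' D' where CD': "\<forall>\<eta>\<in>space M. \<forall>z. \<bar>z\<bar> \<le> R \<longrightarrow> norm (f' \<eta> z) \<le> C'" "\<forall>\<eta>\<in>space M. \<forall>z. \<bar>z\<bar> \<le> R \<longrightarrow> norm (g' \<eta> z) \<le> D'"
    using fg unfolding profile_def by metis
  show "\<exists>C. \<forall>\<eta>\<in>space M. \<forall>z. norm z \<le> R \<longrightarrow> norm (osc f g t z \<eta>) \<le> C"
  proof (intro exI[of _ "exp (K * \<bar>t\<bar>) * (C + D)"] ballI allI impI)
    fix \<eta> and z :: "'n point" assume "\<eta> \<in> space M" and z: "norm z \<le> R"
    moreover have "\<bar>snd z\<bar> \<le> R" using z norm_snd_le_norm[of z] by auto
    ultimately show "norm (osc f g t z \<eta>) \<le> exp (K * \<bar>t\<bar>) * (C + D)"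
      using CD by (intro wave_integrand_bound) auto
  qed
  show "\<exists>C. \<forall>\<eta>\<in>space M. \<forall>z b. norm z \<le> R \<longrightarrow> norm (?G' \<eta> z b) \<le> C * norm b"
  proof (intro exI[of _ "exp (K * \<bar>t\<bar>) * ((C' + 2 * pi * K * D) + (D' + 2 * pi * K * C))"] ballI allI impI)
    fix \<eta> and z b :: "'n point" assume \<eta>: "\<eta> \<in> space M" and z: "norm z \<le> R"
    have zR: "\<bar>snd z\<bar> \<le> R" using z norm_snd_le_norm[of z] by auto
    have sb: "\<bar>snd b\<bar> \<le> norm b" using norm_snd_le_norm[of b] by simp
    have fb: "\<bar>2 * pi * (\<eta> \<bullet> fst b)\<bar> \<le> 2 * pi * K * norm b"
    proof -
      have "2 * pi * (K * norm (fst b)) \<le> 2 * pi * (K * norm b)"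
        using K_nonneg[OF \<eta>] norm_fst_le_norm[of b] by (intro mult_left_mono) auto
      from order_trans[OF inner_freq_bound[OF \<eta>, of "fst b"] this] show ?thesis by (simp add: mult.assoc)
    qed
    have one: "norm (snd b *\<^sub>R v + r *\<^sub>R w) \<le> (V + 2 * pi * K * W) * norm b"
      if "norm v \<le> V" "norm w \<le> W" "\<bar>r\<bar> \<le> 2 * pi * K * norm b" for v w :: 'a and V W r
    proof -
      have "norm (snd b *\<^sub>R v + r *\<^sub>R w) \<le> \<bar>snd b\<bar> * norm v + \<bar>r\<bar> * norm w"
        using norm_triangle_ineq[of "snd b *\<^sub>R v" "r *\<^sub>R w"] by simp
      also have "\<dots> \<le> norm b * V + (2 * pi * K * norm b) * W"
        using that sb K_nonneg[OF \<eta>] by (intro add_mono mult_mono) auto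
      finally show ?thesis by (simp add: algebra_simps)
    qed
    have "norm (?G' \<eta> z b)
      \<le> exp (K * \<bar>t\<bar>) * ((C' + 2 * pi * K * D) * norm b + (D' + 2 * pi * K * C) * norm b)"
      by (rule wave_integrand_bound[OF \<eta> order_refl]; rule one) (use CD CD' \<eta> zR fb in auto)
    then show "norm (?G' \<eta> z b)
      \<le> exp (K * \<bar>t\<bar>) * ((C' + 2 * pi * K * D) + (D' + 2 * pi * K * C)) * norm b"
      by (simp only: mult.assoc distrib_right[symmetric])
  qed
qed

text \<open>Time differentiation multiplies both coefficients by \<open>- lam \<eta>\<close>, which
  is bounded by \<open>K\<close> and so keeps them profiles.\<close>

lemma wave_has_vector_derivative_time:
  assumes f: "profile f" and g: "profile g"
  shows "((\<lambda>s. wave f g s z) has_vector_derivative wave (\<lambda>\<eta> y. (- lam \<eta>) *\<^sub>R f \<eta> y) (\<lambda>\<eta> y. (- lam \<eta>) *\<^sub>R g \<eta> y) t z) (at t)"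
proof -
  define P where "P \<eta> = cos (2 * pi * (\<eta> \<bullet> fst z)) *\<^sub>R f \<eta> (snd z) + sin (2 * pi * (\<eta> \<bullet> fst z)) *\<^sub>R g \<eta> (snd z)" for \<eta>
  have [measurable]: "(\<lambda>\<eta>. f \<eta> y) \<in> borel_measurable M" "(\<lambda>\<eta>. g \<eta> y) \<in> borel_measurable M" for y
    using f g by (auto simp: profile_def)
  have [measurable]: "P \<in> borel_measurable M" unfolding P_def[abs_def] by measurable
  obtain C D where CD: "\<forall>\<eta>\<in>space M. \<forall>w. \<bar>w\<bar> \<le> \<bar>snd z\<bar> \<longrightarrow> norm (f \<eta> w) \<le> C" "\<forall>\<eta>\<in>space M. \<forall>w. \<bar>w\<bar> \<le> \<bar>snd z\<bar> \<longrightarrow> norm (g \<eta> w) \<le> D"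
    using f g unfolding profile_def by metis
  have bnd: "norm (exp (- lam \<eta> * s) *\<^sub>R P \<eta>) \<le> exp (K * R) * (C + D)" if "\<eta> \<in> space M" "norm s \<le> R" for \<eta> s R
    unfolding P_def using that CD by (intro wave_integrand_bound) auto
  have "((\<lambda>s. LINT \<eta>|M. exp (- lam \<eta> * s) *\<^sub>R P \<eta>) has_derivative (\<lambda>v. LINT \<eta>|M. v *\<^sub>R ((- lam \<eta>) *\<^sub>R (exp (- lam \<eta> * t) *\<^sub>R P \<eta>)))) (at t)"
  proof (rule param_integral_has_derivative)
    show "finite_measure M" by (rule finite_measure_axioms)
    show "((\<lambda>s. exp (- lam \<eta> * s) *\<^sub>R P \<eta>) has_derivative (\<lambda>v. v *\<^sub>R ((- lam \<eta>) *\<^sub>R (exp (- lam \<eta> * s) *\<^sub>R P \<eta>)))) (at s)" for \<eta> s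
      by (auto intro!: derivative_eq_intros simp: fun_eq_iff)
    show "\<exists>C. \<forall>\<eta>\<in>space M. \<forall>s. norm s \<le> R \<longrightarrow> norm (exp (- lam \<eta> * s) *\<^sub>R P \<eta>) \<le> C" for R
      using bnd by blast
    show "\<exists>C. \<forall>\<eta>\<in>space M. \<forall>s v. norm s \<le> R \<longrightarrow> norm (v *\<^sub>R ((- lam \<eta>) *\<^sub>R (exp (- lam \<eta> * s) *\<^sub>R P \<eta>))) \<le> C * norm v" for R
    proof (intro exI[of _ "K * (exp (K * R) * (C + D))"] ballI allI impI)
      fix \<eta> s v assume \<eta>: "\<eta> \<in> space M" and s: "norm (s::real) \<le> R"
      have "\<bar>lam \<eta>\<bar> * norm (exp (- lam \<eta> * s) *\<^sub>R P \<eta>) \<le> K * (exp (K * R) * (C + D))"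
        using lam_le[OF \<eta>] K_nonneg[OF \<eta>] by (intro mult_mono bnd \<eta> s) auto
      from mult_right_mono[OF this, of "\<bar>v\<bar>"]
      have "\<bar>v\<bar> * (\<bar>lam \<eta>\<bar> * norm (exp (- lam \<eta> * s) *\<^sub>R P \<eta>)) \<le> K * (exp (K * R) * (C + D)) * \<bar>v\<bar>"
        by (simp only: mult.commute[of _ "\<bar>v\<bar>"])
      then show "norm (v *\<^sub>R ((- lam \<eta>) *\<^sub>R (exp (- lam \<eta> * s) *\<^sub>R P \<eta>))) \<le> K * (exp (K * R) * (C + D)) * norm v"
        by (simp only: norm_scaleR[of v] norm_scaleR[of "- lam \<eta>"] abs_minus_cancel real_norm_def)
    qed
  qed measurable
  then show ?thesis
    unfolding has_vector_derivative_def wave_def P_def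
    by (simp add: algebra_simps flip: integral_scaleR_right)
qed

end

section \<open>Partial derivatives within the closed layer and one-sided time derivatives\<close>

lemma sum_Basis_point:
  fixes f :: "'n::finite point \<Rightarrow> 'c::comm_monoid_add"
  shows "sum f Basis = (\<Sum>i\<in>Basis. f (i, 0)) + f (0, 1)"
proof -
  have "sum f Basis = sum f ((\<lambda>i. (i, 0)) ` Basis) + sum f ((\<lambda>i. (0, i)) ` Basis)"
    unfolding Basis_prod_def by (rule sum.union_disjoint) auto
  also have "sum f ((\<lambda>i. (i, 0)) ` Basis) = (\<Sum>i\<in>Basis. f (i, 0))"
    by (subst sum.reindex) (auto simp: inj_on_def)
  finally show ?thesis by simp
qed

text \<open>A derivative within a set is unique once short steps along every basis direction stay in
  the set. Upward steps serve in the lower half of the layer and downward steps in the upper half,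
  so the boundary planes are included.\<close>

lemma pdv_eq:
  fixes z :: "'n::finite point"
  assumes "L > 0" "z \<in> closed_layer L" and F: "(F has_derivative D) (at z within closed_layer L)"
  shows "pdv L b F z = D b"
proof -
  have "(F has_derivative frechet_derivative F (at z within closed_layer L)) (at z within closed_layer L)"
    using F by (simp add: frechet_derivative_works[symmetric] differentiableI)
  then have "frechet_derivative F (at z within closed_layer L) = D"
  proof (rule frechet_derivative_unique_within[OF _ F])
    fix i :: "'n point" and e :: real assume i: "i \<in> Basis" and e: "e > 0"
    have si: "snd i = 0 \<or> snd i = 1" using i by (auto simp: Basis_prod_def)
    define d where "d = min (e / 2) (L / 2)"
    have d: "0 < d" "d < e" "d \<le> L / 2" using e assms by (auto simp: d_def)
    have y: "0 \<le> snd z" "snd z \<le> L" using assms(2) by (auto simp: closed_layer_def)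
    have mem: "z + r *\<^sub>R i \<in> closed_layer L \<longleftrightarrow> 0 \<le> snd z + r * snd i \<and> snd z + r * snd i \<le> L" for r
      by (auto simp: closed_layer_def mem_Times_iff)
    show "\<exists>r. 0 < \<bar>r\<bar> \<and> \<bar>r\<bar> < e \<and> z + r *\<^sub>R i \<in> closed_layer L"
    proof (cases "snd z \<le> L / 2")
      case True
      then show ?thesis using d y si by (intro exI[of _ d]) (auto simp: mem)
    next
      case False
      have "z + (- d) *\<^sub>R i \<in> closed_layer L" unfolding mem using False d y si by auto
      then show ?thesis using d by (intro exI[of _ "- d"]) auto
    qed
  qed
  then show ?thesis by (simp add: pdv_def)
qed

lemma has_derivative_cong_on:
  assumes "z \<in> S" and eq: "\<And>w. w \<in> S \<Longrightarrow> f w = g w"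
  shows "(f has_derivative D) (at z within S) \<longleftrightarrow> (g has_derivative D) (at z within S)"
  using has_derivative_transform[OF assms(1), of f g D] has_derivative_transform[OF assms(1), of g f D] eq
  by metis

lemma pdv_cong:
  assumes "z \<in> closed_layer L" and eq: "\<And>w. w \<in> closed_layer L \<Longrightarrow> f w = g w"
  shows "pdv L b f z = pdv L b g z"
  using has_derivative_cong_on[OF assms] by (simp add: pdv_def frechet_derivative_def)

lemma C0_field_cong:
  assumes "\<And>t z. t \<ge> 0 \<Longrightarrow> z \<in> A \<Longrightarrow> f t z = g t z"
  shows "C0_field A f \<longleftrightarrow> C0_field A g"
  unfolding C0_field_def using assms by (intro continuous_on_cong) auto

lemma C1_space_cong:
  assumes eq: "\<And>t z. t \<ge> 0 \<Longrightarrow> z \<in> closed_layer L \<Longrightarrow> f t z = g t z"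
  shows "C1_space L f \<longleftrightarrow> C1_space L g"
proof -
  have "C0_field (closed_layer L) f \<longleftrightarrow> C0_field (closed_layer L) g" by (rule C0_field_cong) (rule eq)
  moreover have "f t differentiable_on closed_layer L \<longleftrightarrow> g t differentiable_on closed_layer L" if "t \<ge> 0" for t
    using has_derivative_cong_on[of _ "closed_layer L" "f t" "g t", OF _ eq[OF that]]
    by (simp add: differentiable_on_def differentiable_def)
  moreover have "C0_field (closed_layer L) (\<lambda>t. pdv L b (f t)) \<longleftrightarrow> C0_field (closed_layer L) (\<lambda>t. pdv L b (g t))" for b
    by (rule C0_field_cong, rule pdv_cong) (auto intro: eq)
  ultimately show ?thesis unfolding C1_space_def by simp
qed

text \<open>At \<open>t = 0\<close> the derivative is one-sided; it is still unique because the
  filter lies above \<open>at_right t\<close>, which is nontrivial.\<close>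

lemma dt_eq:
  assumes "t \<ge> 0" and d: "((\<lambda>s. f s z) has_vector_derivative D) (at t)"
  shows "dt f t z = D"
proof -
  have "at_right t \<le> at t within {0..}" using assms(1) by (intro at_le) auto
  then have "at t within {0..} \<noteq> bot" using trivial_limit_at_right_real[of t] by (metis bot.extremum_uniqueI)
  then show ?thesis
    unfolding dt_def using has_vector_derivative_at_within[OF d] by (rule vector_derivative_within)
qed

section \<open>The differential operators of the system applied to waves\<close>

context frequency_measure begin

text \<open>The cosine coefficient of the derivative of a wave in the direction \<open>b\<close>;
  \<open>dsin\<close> is the sine coefficient, with the opposite sign from differentiating the
  cosine.\<close>

definition dcos :: "'n point \<Rightarrow> (real^'n \<Rightarrow> real \<Rightarrow> 'b::{banach,second_countable_topology}) \<Rightarrow> (real^'n \<Rightarrow> real \<Rightarrow> 'b) \<Rightarrow> real^'n \<Rightarrow> real \<Rightarrow> 'b" where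
  "dcos b f' g \<eta> y = snd b *\<^sub>R f' \<eta> y + (2 * pi * (\<eta> \<bullet> fst b)) *\<^sub>R g \<eta> y"
definition dsin :: "'n point \<Rightarrow> (real^'n \<Rightarrow> real \<Rightarrow> 'b::{banach,second_countable_topology}) \<Rightarrow> (real^'n \<Rightarrow> real \<Rightarrow> 'b) \<Rightarrow> real^'n \<Rightarrow> real \<Rightarrow> 'b" where
  "dsin b g' f \<eta> y = snd b *\<^sub>R g' \<eta> y + (- (2 * pi * (\<eta> \<bullet> fst b))) *\<^sub>R f \<eta> y"

lemma wave_cong:
  assumes "\<And>\<eta>. \<eta> \<in> space M \<Longrightarrow> f \<eta> (snd z) = f2 \<eta> (snd z)" "\<And>\<eta>. \<eta> \<in> space M \<Longrightarrow> g \<eta> (snd z) = g2 \<eta> (snd z)"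
  shows "wave f g t z = wave f2 g2 t z"
  unfolding wave_def by (rule Bochner_Integration.integral_cong) (simp_all add: assms)

lemma wave_zero: "wave (\<lambda>_ _. 0) (\<lambda>_ _. 0) t z = 0"
  by (simp add: wave_def)

lemma wave_bounded_linear:
  assumes T: "bounded_linear T" and "profile f" "profile g"
  shows "T (wave f g t z) = wave (\<lambda>\<eta> y. T (f \<eta> y)) (\<lambda>\<eta> y. T (g \<eta> y)) t z"
proof -
  interpret bounded_linear T by fact
  show ?thesis unfolding wave_def
    by (subst integral_bounded_linear[OF T wave_integrable[OF assms(2,3)], symmetric]) (simp add: add scaleR)
qed

lemma wave_sum:
  assumes "finite B" "\<And>b. b \<in> B \<Longrightarrow> profile (f b)" "\<And>b. b \<in> B \<Longrightarrow> profile (g b)"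
  shows "(\<Sum>b\<in>B. wave (f b) (g b) t z) = wave (\<lambda>\<eta> y. \<Sum>b\<in>B. f b \<eta> y) (\<lambda>\<eta> y. \<Sum>b\<in>B. g b \<eta> y) t z"
proof -
  have "(\<Sum>b\<in>B. wave (f b) (g b) t z) = (LINT \<eta>|M. (\<Sum>b\<in>B. exp (- lam \<eta> * t) *\<^sub>R
     (cos (2 * pi * (\<eta> \<bullet> fst z)) *\<^sub>R f b \<eta> (snd z) + sin (2 * pi * (\<eta> \<bullet> fst z)) *\<^sub>R g b \<eta> (snd z))))"
    unfolding wave_def
    by (rule Bochner_Integration.integral_sum[symmetric]) (rule wave_integrable[OF assms(2,3)])
  also have "\<dots> = wave (\<lambda>\<eta> y. \<Sum>b\<in>B. f b \<eta> y) (\<lambda>\<eta> y. \<Sum>b\<in>B. g b \<eta> y) t z"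
    unfolding wave_def by (simp add: scaleR_sum_right sum.distrib scaleR_add_right)
  finally show ?thesis .
qed

lemma wave_add:
  assumes "profile f" "profile g" "profile f2" "profile g2"
  shows "wave f g t z + wave f2 g2 t z = wave (\<lambda>\<eta> y. f \<eta> y + f2 \<eta> y) (\<lambda>\<eta> y. g \<eta> y + g2 \<eta> y) t z"
  unfolding wave_def
  by (subst Bochner_Integration.integral_add[symmetric, OF wave_integrable wave_integrable])
     (auto intro!: assms simp: algebra_simps)

lemma profile_inner:
  fixes f :: "real^'n \<Rightarrow> real \<Rightarrow> 'n point"
  assumes f: "profile f"
  shows "profile (\<lambda>\<eta> y. f \<eta> y \<bullet> b)"
proof -
  have "\<exists>C. \<forall>\<eta>\<in>space M. \<forall>y. \<bar>y\<bar> \<le> R \<longrightarrow> norm (f \<eta> y \<bullet> b) \<le> C" for R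
  proof -
    obtain C where C: "\<And>\<eta> y. \<eta> \<in> space M \<Longrightarrow> \<bar>y\<bar> \<le> R \<Longrightarrow> norm (f \<eta> y) \<le> C"
      using profile_bound[OF f] by metis
    have "norm (f \<eta> y \<bullet> b) \<le> C * norm b" if "\<eta> \<in> space M" "\<bar>y\<bar> \<le> R" for \<eta> y
      using Cauchy_Schwarz_ineq2[of "f \<eta> y" b] mult_right_mono[OF C[OF that] norm_ge_zero[of b]] by simp
    then show ?thesis by blast
  qed
  then show ?thesis using f unfolding profile_def by (auto intro!: continuous_intros borel_measurable_inner)
qed

lemma inner_coeff:
  "(\<lambda>\<eta>. 2 * pi * (\<eta> \<bullet> v)) \<in> borel_measurable M" "\<eta> \<in> space M \<Longrightarrow> \<bar>2 * pi * (\<eta> \<bullet> v)\<bar> \<le> 2 * pi * (K * norm v)"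
  "(\<lambda>\<eta>. - (2 * pi * (\<eta> \<bullet> v))) \<in> borel_measurable M" "\<eta> \<in> space M \<Longrightarrow> \<bar>- (2 * pi * (\<eta> \<bullet> v))\<bar> \<le> 2 * pi * (K * norm v)"
  using inner_freq_bound by (auto intro!: borel_measurable_uminus borel_measurable_times borel_measurable_inner id_meas)

lemma profile_dcos: "profile f' \<Longrightarrow> profile g \<Longrightarrow> profile (dcos b f' g)"
  unfolding dcos_def[abs_def]
  by (intro profile_add profile_scaleR[of g, OF _ inner_coeff(1,2)] profile_scaleR[of f' "\<lambda>_. snd b" "\<bar>snd b\<bar>"]) auto

lemma profile_dsin: "profile g' \<Longrightarrow> profile f \<Longrightarrow> profile (dsin b g' f)"
  unfolding dsin_def[abs_def]
  by (intro profile_add profile_scaleR[of f, OF _ inner_coeff(3,4)] profile_scaleR[of g' "\<lambda>_. snd b" "\<bar>snd b\<bar>"]) auto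

lemma profile_deriv_dcos: "profile_deriv f' f'' \<Longrightarrow> profile_deriv g g' \<Longrightarrow> profile_deriv (dcos b f' g) (dcos b f'' g')"
  unfolding dcos_def[abs_def]
  by (intro profile_deriv_add profile_deriv_scaleR[of g, OF _ inner_coeff(1,2)] profile_deriv_scaleR[of f' _ "\<lambda>_. snd b" "\<bar>snd b\<bar>"]) auto

lemma profile_deriv_dsin: "profile_deriv g' g'' \<Longrightarrow> profile_deriv f f' \<Longrightarrow> profile_deriv (dsin b g' f) (dsin b g'' f')"
  unfolding dsin_def[abs_def]
  by (intro profile_deriv_add profile_deriv_scaleR[of f, OF _ inner_coeff(3,4)] profile_deriv_scaleR[of g' _ "\<lambda>_. snd b" "\<bar>snd b\<bar>"]) auto

lemma profile_derivD: "profile_deriv f f' \<Longrightarrow> profile f" "profile_deriv f f' \<Longrightarrow> profile f'"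
  by (simp_all add: profile_deriv_def)

lemma pdv_wave:
  assumes "L > 0" "z \<in> closed_layer L" "profile_deriv f f'" "profile_deriv g g'"
  shows "pdv L b (wave f g t) z = wave (dcos b f' g) (dsin b g' f) t z"
  unfolding dcos_def dsin_def
  by (rule pdv_eq[OF assms(1,2)]) (rule has_derivative_at_withinI[OF wave_has_derivative_space[OF assms(3,4)]])

lemma C0_field_wave: "profile f \<Longrightarrow> profile g \<Longrightarrow> C0_field A (wave f g)"
  unfolding C0_field_def by (rule continuous_on_subset[OF wave_continuous]) auto

lemma C1_space_wave:
  assumes "L > 0" and f: "profile_deriv f f'" and g: "profile_deriv g g'"
  shows "C1_space L (wave f g)"
  unfolding C1_space_def
proof (intro conjI allI impI ballI)
  show "C0_field (closed_layer L) (wave f g)" using f g by (intro C0_field_wave profile_derivD)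
  show "wave f g t differentiable_on closed_layer L" for t
    using wave_has_derivative_space[OF f g] differentiableI differentiable_at_imp_differentiable_on by blast
  show "C0_field (closed_layer L) (\<lambda>t. pdv L b (wave f g t))" for b
  proof (subst C0_field_cong)
    show "pdv L b (wave f g t) z = wave (dcos b f' g) (dsin b g' f) t z" if "z \<in> closed_layer L" for t z
      by (rule pdv_wave[OF assms(1) that f g])
    show "C0_field (closed_layer L) (wave (dcos b f' g) (dsin b g' f))"
      using f g by (intro C0_field_wave profile_dcos profile_dsin profile_derivD)
  qed
qed

lemma C2_space_wave:
  assumes "L > 0" and f: "profile_deriv f f'" "profile_deriv f' f''" and g: "profile_deriv g g'" "profile_deriv g' g''"
  shows "C2_space L (wave f g)"
  unfolding C2_space_def
proof (intro conjI ballI)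
  show "C1_space L (wave f g)" by (rule C1_space_wave[OF assms(1) f(1) g(1)])
  show "C1_space L (\<lambda>t. pdv L b (wave f g t))" for b
  proof (subst C1_space_cong)
    show "pdv L b (wave f g t) z = wave (dcos b f' g) (dsin b g' f) t z" if "z \<in> closed_layer L" for t z
      by (rule pdv_wave[OF assms(1) that f(1) g(1)])
    show "C1_space L (wave (dcos b f' g) (dsin b g' f))"
      by (rule C1_space_wave[OF assms(1) profile_deriv_dcos[OF f(2) g(1)] profile_deriv_dsin[OF g(2) f(1)]])
  qed
qed

lemma C1_time_wave:
  assumes f: "profile f" and g: "profile g"
  shows "C1_time A (wave f g)"
  unfolding C1_time_def
proof (intro conjI allI impI ballI)
  show "C0_field A (wave f g)" by (rule C0_field_wave[OF f g])
  show "(\<lambda>s. wave f g s z) differentiable at t within {0..}" for t z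
    by (rule differentiableI[OF has_vector_derivative_at_within[OF wave_has_vector_derivative_time[OF f g], unfolded has_vector_derivative_def]])
  show "C0_field A (dt (wave f g))"
  proof (subst C0_field_cong)
    show "dt (wave f g) t z = wave (\<lambda>\<eta> y. (- lam \<eta>) *\<^sub>R f \<eta> y) (\<lambda>\<eta> y. (- lam \<eta>) *\<^sub>R g \<eta> y) t z" if "t \<ge> 0" for t z
      by (rule dt_eq[where f = "wave f g", OF that wave_has_vector_derivative_time[OF f g]])
    show "C0_field A (wave (\<lambda>\<eta> y. (- lam \<eta>) *\<^sub>R f \<eta> y) (\<lambda>\<eta> y. (- lam \<eta>) *\<^sub>R g \<eta> y))"
      using f g lam_le by (intro C0_field_wave profile_scaleR[where B = K]) auto
  qed
qed

lemma laplacian_wave: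
  fixes f :: "real^'n \<Rightarrow> real \<Rightarrow> 'n point"
  assumes "L > 0" "z \<in> closed_layer L" and f: "profile_deriv f f'" "profile_deriv f' f''" and g: "profile_deriv g g'" "profile_deriv g' g''"
  shows "laplacian L (wave f g t) z = wave (\<lambda>\<eta> y. f'' \<eta> y - (2 * pi * norm \<eta>)\<^sup>2 *\<^sub>R f \<eta> y) (\<lambda>\<eta> y. g'' \<eta> y - (2 * pi * norm \<eta>)\<^sup>2 *\<^sub>R g \<eta> y) t z"
proof -
  have 1: "pdv L b (pdv L b (wave f g t)) z
    = wave (dcos b (dcos b f'' g') (dsin b g' f)) (dsin b (dsin b g'' f') (dcos b f' g)) t z" for b
  proof -
    have "pdv L b (pdv L b (wave f g t)) z = pdv L b (wave (dcos b f' g) (dsin b g' f) t) z"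
      by (rule pdv_cong[OF assms(2)]) (rule pdv_wave[OF assms(1) _ f(1) g(1)])
    also have "\<dots> = wave (dcos b (dcos b f'' g') (dsin b g' f)) (dsin b (dsin b g'' f') (dcos b f' g)) t z"
      by (rule pdv_wave[OF assms(1,2) profile_deriv_dcos[OF f(2) g(1)] profile_deriv_dsin[OF g(2) f(1)]])
    finally show ?thesis .
  qed
  have sq: "(\<Sum>i\<in>Basis. (2 * pi * (\<eta> \<bullet> i))\<^sup>2) = (2 * pi * norm \<eta>)\<^sup>2" for \<eta> :: "real^'n"
  proof -
    have "(norm \<eta>)\<^sup>2 = (\<Sum>i\<in>Basis. (\<eta> \<bullet> i)\<^sup>2)"
      unfolding power2_norm_eq_inner by (subst euclidean_inner) (simp add: power2_eq_square)
    then show ?thesis by (simp add: power_mult_distrib sum_distrib_left)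
  qed
  \<comment> \<open>A basis vector is either horizontal or vertical, so no mixed terms occur; two
    horizontal rotations give \<open>-(2 * pi * (\<eta> \<bullet> i))\<^sup>2\<close>, and these sum
    to the squared wave number.\<close>
  have s1: "(\<Sum>b\<in>Basis. dcos b (dcos b f'' g') (dsin b g' f) \<eta> y) = f'' \<eta> y - (2 * pi * norm \<eta>)\<^sup>2 *\<^sub>R f \<eta> y"
    and s2: "(\<Sum>b\<in>Basis. dsin b (dsin b g'' f') (dcos b f' g) \<eta> y) = g'' \<eta> y - (2 * pi * norm \<eta>)\<^sup>2 *\<^sub>R g \<eta> y" for \<eta> y
    unfolding sum_Basis_point
    by (simp_all add: dcos_def dsin_def power2_eq_square[symmetric] sum_negf scaleR_sum_left[symmetric] sq)
  show ?thesis
    unfolding laplacian_def 1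
    by (subst wave_sum) (auto simp: s1 s2 intro!: profile_dcos profile_dsin f g profile_derivD[OF f(1)] profile_derivD[OF f(2)]
      profile_derivD[OF g(1)] profile_derivD[OF g(2)])
qed

end

section \<open>Superpositions of modes\<close>

locale mode_superposition = frequency_measure M K lam
  for M :: "(real^'n) measure" and K :: real and lam +
  fixes L :: real and \<mu> H :: "real^'n \<Rightarrow> real" and A A' A'' B Q Q' :: "real^'n \<Rightarrow> real \<Rightarrow> real"
  assumes L_pos: "L > 0"
    and pA: "profile_deriv A A'" and pA': "profile_deriv A' A''" and pQ: "profile_deriv Q Q'"
    and pB: "profile_deriv B (\<lambda>\<eta> y. (2 * pi * norm \<eta>) *\<^sub>R A \<eta> y)"
    and pH: "profile (\<lambda>\<eta> y. H \<eta>)"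
    and A''_eq: "\<And>\<eta> y. \<eta> \<in> space M \<Longrightarrow> A'' \<eta> y = ((2 * pi * norm \<eta>)\<^sup>2 - lam \<eta>) * A \<eta> y + 2 * pi * norm \<eta> * Q \<eta> y"
    and Q'_eq: "\<And>\<eta> y. \<eta> \<in> space M \<Longrightarrow> Q' \<eta> y = 2 * pi * norm \<eta> * A' \<eta> y - ((2 * pi * norm \<eta>)\<^sup>2 - lam \<eta>) * B \<eta> y"
    and A_0: "\<And>\<eta>. \<eta> \<in> space M \<Longrightarrow> A \<eta> 0 = 0" and B_0: "\<And>\<eta>. \<eta> \<in> space M \<Longrightarrow> B \<eta> 0 = 0"
    and tangential: "\<And>\<eta>. \<eta> \<in> space M \<Longrightarrow> A' \<eta> L + 2 * pi * norm \<eta> * B \<eta> L = 0"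
    and normal: "\<And>\<eta>. \<eta> \<in> space M \<Longrightarrow> Q \<eta> L - 2 * (2 * pi * norm \<eta>) * A \<eta> L = \<mu> \<eta> * H \<eta>"
    and kinematic: "\<And>\<eta>. \<eta> \<in> space M \<Longrightarrow> - lam \<eta> * H \<eta> = B \<eta> L"
begin

text \<open>The minus sign is forced by incompressibility: the divergence of the horizontal part has
  to cancel \<open>b' = k a\<close>.\<close>

definition dir :: "real^'n \<Rightarrow> 'n point" where "dir \<eta> = (- sgn \<eta>, 0)"

definition u where "u = wave (\<lambda>\<eta> y. B \<eta> y *\<^sub>R e_N) (\<lambda>\<eta> y. A \<eta> y *\<^sub>R dir \<eta>)"
definition p where "p = wave Q (\<lambda>_ _. 0)"
text \<open>The amplitude of the surface is treated as a profile that is constant in the height, so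
  the evaluation at height 0 is an arbitrary choice.\<close>

definition h where "h t x = wave (\<lambda>\<eta> y. H \<eta>) (\<lambda>_ _. 0) t (x, 0)"

lemma dir_meas: "dir \<in> borel_measurable M"
proof -
  have "(\<lambda>\<eta>. - (\<eta> /\<^sub>R norm \<eta>)) \<in> borel_measurable M" by measurable
  then show ?thesis unfolding dir_def[abs_def] sgn_div_norm
    by (intro borel_measurable_Pair) auto
qed

lemma dir_le: "norm (dir \<eta>) \<le> 1"
  by (simp add: dir_def norm_Pair norm_sgn)

lemma e_N_simps [simp]: "fst (e_N :: 'n point) = 0" "snd (e_N :: 'n point) = 1" "e_N \<bullet> b = snd b" "b \<bullet> e_N = snd (b :: 'n point)"
  by (simp_all add: e_N_def inner_prod_def)

lemma norm_sgn_eq: "norm \<eta> * (sgn \<eta> \<bullet> v) = \<eta> \<bullet> (v :: real^'n)" "norm \<eta> *\<^sub>R sgn \<eta> = (\<eta> :: real^'n)"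
  by (cases "\<eta> = 0"; simp add: sgn_div_norm)+

lemma wave_number_coeff: "(\<lambda>\<eta>. 2 * pi * norm \<eta>) \<in> borel_measurable M" "\<eta> \<in> space M \<Longrightarrow> \<bar>2 * pi * norm \<eta>\<bar> \<le> 2 * pi * K"
  using norm_le by auto

lemma u_cos_profile: "profile_deriv (\<lambda>\<eta> y. B \<eta> y *\<^sub>R (e_N :: 'n point)) (\<lambda>\<eta> y. ((2 * pi * norm \<eta>) *\<^sub>R A \<eta> y) *\<^sub>R e_N)"
    "profile_deriv (\<lambda>\<eta> y. ((2 * pi * norm \<eta>) *\<^sub>R A \<eta> y) *\<^sub>R (e_N :: 'n point)) (\<lambda>\<eta> y. ((2 * pi * norm \<eta>) *\<^sub>R A' \<eta> y) *\<^sub>R e_N)"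
  and u_sin_profile: "profile_deriv (\<lambda>\<eta> y. A \<eta> y *\<^sub>R dir \<eta>) (\<lambda>\<eta> y. A' \<eta> y *\<^sub>R dir \<eta>)"
    "profile_deriv (\<lambda>\<eta> y. A' \<eta> y *\<^sub>R dir \<eta>) (\<lambda>\<eta> y. A'' \<eta> y *\<^sub>R dir \<eta>)"
proof -
  have *: "profile_deriv (\<lambda>\<eta> y. (2 * pi * norm \<eta>) *\<^sub>R A \<eta> y) (\<lambda>\<eta> y. (2 * pi * norm \<eta>) *\<^sub>R A' \<eta> y)"
    by (rule profile_deriv_scaleR[OF pA wave_number_coeff])
  show "profile_deriv (\<lambda>\<eta> y. B \<eta> y *\<^sub>R (e_N :: 'n point)) (\<lambda>\<eta> y. ((2 * pi * norm \<eta>) *\<^sub>R A \<eta> y) *\<^sub>R e_N)"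
    "profile_deriv (\<lambda>\<eta> y. ((2 * pi * norm \<eta>) *\<^sub>R A \<eta> y) *\<^sub>R (e_N :: 'n point)) (\<lambda>\<eta> y. ((2 * pi * norm \<eta>) *\<^sub>R A' \<eta> y) *\<^sub>R e_N)"
    by (rule profile_deriv_vec[OF pB, of "\<lambda>_. e_N" "norm (e_N :: 'n point)"] profile_deriv_vec[OF *, of "\<lambda>_. e_N" "norm (e_N :: 'n point)"]; simp)+
  show "profile_deriv (\<lambda>\<eta> y. A \<eta> y *\<^sub>R dir \<eta>) (\<lambda>\<eta> y. A' \<eta> y *\<^sub>R dir \<eta>)"
    "profile_deriv (\<lambda>\<eta> y. A' \<eta> y *\<^sub>R dir \<eta>) (\<lambda>\<eta> y. A'' \<eta> y *\<^sub>R dir \<eta>)"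
    by (rule profile_deriv_vec[OF pA dir_meas dir_le] profile_deriv_vec[OF pA' dir_meas dir_le])+
qed

lemma regular: "regular_fields L u p h"
  unfolding regular_fields_def
proof (intro conjI)
  show "C2_space L u" unfolding u_def by (rule C2_space_wave[OF L_pos u_cos_profile u_sin_profile])
  show "C1_time (closed_layer L) u" unfolding u_def by (intro C1_time_wave profile_derivD(1)[OF u_cos_profile(1)] profile_derivD(1)[OF u_sin_profile(1)])
  show "C1_space L p" unfolding p_def by (rule C1_space_wave[OF L_pos pQ profile_deriv_zero])
  have C: "C1_time UNIV (wave (\<lambda>\<eta> y. H \<eta>) (\<lambda>_ _. 0))" by (rule C1_time_wave[OF pH profile_zero])
  have comp: "continuous_on ({0..} \<times> UNIV) (\<lambda>w. (fst w, (snd w :: real^'n, 0 :: real)))"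
    by (intro continuous_intros)
  have dth: "dt h t x = dt (wave (\<lambda>\<eta> y. H \<eta>) (\<lambda>_ _. 0)) t (x, 0)" for t x
    by (simp add: dt_def h_def)
  show "C1_time UNIV h"
    unfolding C1_time_def
  proof (intro conjI allI impI ballI)
    show "C0_field UNIV h"
      using continuous_on_compose2[OF C[unfolded C1_time_def C0_field_def, THEN conjunct1] comp]
      by (simp add: C0_field_def h_def case_prod_beta' image_subset_iff)
    show "C0_field UNIV (dt h)"
      using continuous_on_compose2[OF C[unfolded C1_time_def C0_field_def, THEN conjunct2, THEN conjunct2] comp]
      by (simp add: C0_field_def dth case_prod_beta' image_subset_iff)
    show "(\<lambda>s. h s x) differentiable at t within {0..}" if "0 \<le> t" for t x
      using C that unfolding C1_time_def h_def by blast
  qed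
qed

lemma dt_u: "t \<ge> 0 \<Longrightarrow> dt u t z = wave (\<lambda>\<eta> y. (- lam \<eta>) *\<^sub>R B \<eta> y *\<^sub>R e_N) (\<lambda>\<eta> y. (- lam \<eta>) *\<^sub>R A \<eta> y *\<^sub>R dir \<eta>) t z"
  unfolding u_def
  by (rule dt_eq[where f = "wave (\<lambda>\<eta> y. B \<eta> y *\<^sub>R e_N) (\<lambda>\<eta> y. A \<eta> y *\<^sub>R dir \<eta>)",
        OF _ wave_has_vector_derivative_time[OF profile_derivD(1)[OF u_cos_profile(1)] profile_derivD(1)[OF u_sin_profile(1)]]])

lemma dt_h: "t \<ge> 0 \<Longrightarrow> dt h t x = u t (x, L) \<bullet> e_N"
proof -
  assume t: "t \<ge> 0"
  have "dt h t x = wave (\<lambda>\<eta> y. (- lam \<eta>) *\<^sub>R H \<eta>) (\<lambda>\<eta> y. (- lam \<eta>) *\<^sub>R 0) t (x, 0)"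
    unfolding h_def[abs_def]
    by (rule dt_eq[where f = "\<lambda>t x. wave (\<lambda>\<eta> y. H \<eta>) (\<lambda>_ _. 0) t (x, 0)", OF t]) (rule wave_has_vector_derivative_time[OF pH profile_zero])
  also have "\<dots> = wave (\<lambda>\<eta> y. B \<eta> y) (\<lambda>\<eta> y. 0) t (x, L)"
    unfolding wave_def by (rule Bochner_Integration.integral_cong) (simp_all flip: kinematic)
  also have "\<dots> = u t (x, L) \<bullet> e_N"
    unfolding u_def
    by (subst wave_bounded_linear[OF bounded_linear_inner_left profile_derivD(1)[OF u_cos_profile(1)] profile_derivD(1)[OF u_sin_profile(1)]])
       (simp add: dir_def)
  finally show ?thesis .
qed

lemma grad_p:
  assumes z: "z \<in> closed_layer L"
  shows "grad L (p t) z = wave (\<lambda>\<eta> y. Q' \<eta> y *\<^sub>R e_N) (\<lambda>\<eta> y. (2 * pi * norm \<eta> * Q \<eta> y) *\<^sub>R dir \<eta>) t z"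
proof -
  have pc: "profile (dcos b Q' (\<lambda>_ _. 0))" "profile (dsin b (\<lambda>_ _. 0) Q)" for b
    using profile_derivD[OF pQ] by (auto intro!: profile_dcos profile_dsin profile_zero)
  have pb: "profile (\<lambda>\<eta> y. f \<eta> y *\<^sub>R b)" if "profile f" for f :: "real^'n \<Rightarrow> real \<Rightarrow> real" and b :: "'n point"
    by (rule profile_vec[OF that, of _ "norm b"]) auto
  have "grad L (p t) z = (\<Sum>b\<in>Basis. wave (dcos b Q' (\<lambda>_ _. 0)) (dsin b (\<lambda>_ _. 0) Q) t z *\<^sub>R b)"
    unfolding grad_def p_def by (simp add: pdv_wave[OF L_pos z pQ profile_deriv_zero])
  also have "\<dots> = (\<Sum>b\<in>Basis. wave (\<lambda>\<eta> y. dcos b Q' (\<lambda>_ _. 0) \<eta> y *\<^sub>R b) (\<lambda>\<eta> y. dsin b (\<lambda>_ _. 0) Q \<eta> y *\<^sub>R b) t z)"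
    by (intro sum.cong refl wave_bounded_linear[OF bounded_linear_scaleR_left pc])
  also have "\<dots> = wave (\<lambda>\<eta> y. \<Sum>b\<in>Basis. dcos b Q' (\<lambda>_ _. 0) \<eta> y *\<^sub>R b) (\<lambda>\<eta> y. \<Sum>b\<in>Basis. dsin b (\<lambda>_ _. 0) Q \<eta> y *\<^sub>R b) t z"
    by (intro wave_sum pb pc) auto
  also have "(\<lambda>\<eta> y. \<Sum>b\<in>Basis. dcos b Q' (\<lambda>_ _. 0) \<eta> y *\<^sub>R b) = (\<lambda>\<eta> y. Q' \<eta> y *\<^sub>R e_N)"
    unfolding sum_Basis_point by (simp add: dcos_def e_N_def flip: zero_prod_def)
  also have "(\<lambda>\<eta> y. \<Sum>b\<in>Basis. dsin b (\<lambda>_ _. 0) Q \<eta> y *\<^sub>R b) = (\<lambda>\<eta> y. (2 * pi * norm \<eta> * Q \<eta> y) *\<^sub>R dir \<eta>)"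
  proof (intro ext)
    fix \<eta> y
    have "(\<Sum>i\<in>Basis. ((- (2 * pi * (\<eta> \<bullet> i))) * Q \<eta> y) *\<^sub>R i) = (- (2 * pi * Q \<eta> y)) *\<^sub>R (\<Sum>i\<in>Basis. (\<eta> \<bullet> i) *\<^sub>R i)"
      by (simp add: scaleR_sum_right mult_ac)
    also have "\<dots> = (2 * pi * norm \<eta> * Q \<eta> y) *\<^sub>R (- sgn \<eta>)"
      by (cases "\<eta> = 0") (simp_all add: euclidean_representation sgn_div_norm)
    finally have "(\<Sum>i\<in>Basis. ((- (2 * pi * (\<eta> \<bullet> i))) * Q \<eta> y) *\<^sub>R i) = (2 * pi * norm \<eta> * Q \<eta> y) *\<^sub>R (- sgn \<eta>)" .
    then show "(\<Sum>b\<in>Basis. dsin b (\<lambda>_ _. 0) Q \<eta> y *\<^sub>R b) = (2 * pi * norm \<eta> * Q \<eta> y) *\<^sub>R dir \<eta>"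
      unfolding sum_Basis_point by (intro prod_eqI) (simp_all add: dsin_def dir_def fst_sum snd_sum)
  qed
  finally show ?thesis .
qed

lemma momentum:
  assumes t: "t \<ge> 0" and z: "z \<in> closed_layer L"
  shows "dt u t z + grad L (p t) z = laplacian L (u t) z"
proof -
  have pv: "profile (\<lambda>\<eta> y. (- lam \<eta>) *\<^sub>R B \<eta> y *\<^sub>R (e_N :: 'n point))" "profile (\<lambda>\<eta> y. (- lam \<eta>) *\<^sub>R A \<eta> y *\<^sub>R dir \<eta>)"
    by (rule profile_scaleR[where B = K and c = "\<lambda>\<eta>. - lam \<eta>", OF profile_derivD(1)[OF u_cos_profile(1)]]
          profile_scaleR[where B = K and c = "\<lambda>\<eta>. - lam \<eta>", OF profile_derivD(1)[OF u_sin_profile(1)]];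
        use lam_le in simp)+
  have pw: "profile (\<lambda>\<eta> y. Q' \<eta> y *\<^sub>R (e_N :: 'n point))"
    by (rule profile_vec[OF profile_derivD(2)[OF pQ], of _ "norm (e_N :: 'n point)"]) auto
  have px: "profile (\<lambda>\<eta> y. (2 * pi * norm \<eta> * Q \<eta> y) *\<^sub>R dir \<eta>)"
    using profile_vec[OF profile_scaleR[OF profile_derivD(1)[OF pQ] wave_number_coeff] dir_meas dir_le] by simp
  show ?thesis
    unfolding dt_u[OF t] grad_p[OF z] wave_add[OF pv pw px]
    unfolding u_def laplacian_wave[OF L_pos z u_cos_profile u_sin_profile]
    by (rule wave_cong) (simp_all add: Q'_eq A''_eq algebra_simps flip: scaleR_add_left scaleR_diff_left)
qed

text \<open>The vertical derivative contributes \<open>k A\<close> to the cosine part and the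
  horizontal ones \<open>- k A\<close>; the sine part vanishes since \<open>dir\<close> is
  horizontal and \<open>e_N\<close> vertical.\<close>

lemma divergence_u:
  assumes z: "z \<in> closed_layer L"
  shows "divergence L (u t) z = 0"
proof -
  define F where "F b = dcos b (\<lambda>\<eta> y. ((2 * pi * norm \<eta>) *\<^sub>R A \<eta> y) *\<^sub>R e_N) (\<lambda>\<eta> y. A \<eta> y *\<^sub>R dir \<eta>)" for b :: "'n point"
  define G where "G b = dsin b (\<lambda>\<eta> y. A' \<eta> y *\<^sub>R dir \<eta>) (\<lambda>\<eta> y. B \<eta> y *\<^sub>R e_N)" for b :: "'n point"
  have pc: "profile (F b)" "profile (G b)" for b
    unfolding F_def G_def by (intro profile_dcos profile_dsin profile_derivD(1)[OF u_cos_profile(1)] profile_derivD(1)[OF u_sin_profile(1)] profile_derivD(2)[OF u_cos_profile(1)] profile_derivD(2)[OF u_sin_profile(1)])+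
  have "divergence L (u t) z = (\<Sum>b\<in>Basis. wave (F b) (G b) t z \<bullet> b)"
    unfolding divergence_def u_def F_def G_def by (simp add: pdv_wave[OF L_pos z u_cos_profile(1) u_sin_profile(1)])
  also have "\<dots> = (\<Sum>b\<in>Basis. wave (\<lambda>\<eta> y. F b \<eta> y \<bullet> b) (\<lambda>\<eta> y. G b \<eta> y \<bullet> b) t z)"
    by (intro sum.cong refl wave_bounded_linear[OF bounded_linear_inner_left pc])
  also have "\<dots> = wave (\<lambda>\<eta> y. \<Sum>b\<in>Basis. F b \<eta> y \<bullet> b) (\<lambda>\<eta> y. \<Sum>b\<in>Basis. G b \<eta> y \<bullet> b) t z"
    by (intro wave_sum profile_inner pc) auto
  also have "(\<lambda>\<eta> y. \<Sum>b\<in>Basis. F b \<eta> y \<bullet> b) = (\<lambda>\<eta> y. 0)"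
  proof (intro ext)
    fix \<eta> :: "real^'n" and y
    have "(\<Sum>i\<in>Basis. (\<eta> \<bullet> i) * (sgn \<eta> \<bullet> i)) = norm \<eta>"
      unfolding euclidean_inner[of \<eta> "sgn \<eta>", symmetric] by (cases "\<eta> = 0") (simp_all add: sgn_div_norm dot_square_norm power2_eq_square)
    then show "(\<Sum>b\<in>Basis. F b \<eta> y \<bullet> b) = 0"
      unfolding sum_Basis_point
      by (simp add: F_def dcos_def dir_def inner_prod_def sum_negf mult.assoc flip: sum_distrib_left)
         (simp add: mult.left_commute[of _ "A \<eta> y"] flip: sum_distrib_left)
  qed
  also have "(\<lambda>\<eta> y. \<Sum>b\<in>Basis. G b \<eta> y \<bullet> b) = (\<lambda>\<eta> y. 0)"
    unfolding sum_Basis_point by (simp add: G_def dsin_def dir_def inner_prod_def)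
  finally show ?thesis by (simp add: wave_zero)
qed

text \<open>The tangential components cancel frequency by frequency through
  \<open>tangential\<close>. What is left is the pressure minus twice the vertical derivative of the
  vertical velocity, identified by \<open>normal\<close>.\<close>

lemma stress_top:
  "stress L (u t) (p t) (x, L) e_N = wave (\<lambda>\<eta> y. \<mu> \<eta> * H \<eta>) (\<lambda>_ _. 0) t (x, L) *\<^sub>R e_N"
proof -
  have z: "(x, L) \<in> closed_layer L" using L_pos by (auto simp: closed_layer_def)
  define F where "F b = dcos b (\<lambda>\<eta> y. ((2 * pi * norm \<eta>) *\<^sub>R A \<eta> y) *\<^sub>R e_N) (\<lambda>\<eta> y. A \<eta> y *\<^sub>R dir \<eta>)" for b :: "'n point"
  define G where "G b = dsin b (\<lambda>\<eta> y. A' \<eta> y *\<^sub>R dir \<eta>) (\<lambda>\<eta> y. B \<eta> y *\<^sub>R e_N)" for b :: "'n point"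
  have pc: "profile (F b)" "profile (G b)" for b
    unfolding F_def G_def by (intro profile_dcos profile_dsin profile_derivD(1)[OF u_cos_profile(1)] profile_derivD(1)[OF u_sin_profile(1)] profile_derivD(2)[OF u_cos_profile(1)] profile_derivD(2)[OF u_sin_profile(1)])+
  define W where "W = wave (\<lambda>\<eta> y. 2 * (2 * pi * norm \<eta>) * A \<eta> y) (\<lambda>_ _. 0) t (x, L)"
  have sg: "sym_grad L (u t) (x, L) b e_N = snd b * W" for b
  proof -
    have "sym_grad L (u t) (x, L) b e_N = wave (F b) (G b) t (x, L) \<bullet> e_N + wave (F e_N) (G e_N) t (x, L) \<bullet> b"
      unfolding sym_grad_def u_def F_def G_def by (simp add: pdv_wave[OF L_pos z u_cos_profile(1) u_sin_profile(1)])
    also have "\<dots> = wave (\<lambda>\<eta> y. F b \<eta> y \<bullet> e_N + F e_N \<eta> y \<bullet> b) (\<lambda>\<eta> y. G b \<eta> y \<bullet> e_N + G e_N \<eta> y \<bullet> b) t (x, L)"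
      unfolding wave_bounded_linear[OF bounded_linear_inner_left pc] by (intro wave_add profile_inner pc)
    also have "\<dots> = wave (\<lambda>\<eta> y. snd b * (2 * (2 * pi * norm \<eta>) * A \<eta> y)) (\<lambda>_ _. snd b * 0) t (x, L)"
    proof (rule wave_cong)
      fix \<eta> assume \<eta>: "\<eta> \<in> space M"
      show "F b \<eta> (snd (x, L)) \<bullet> e_N + F e_N \<eta> (snd (x, L)) \<bullet> b = snd b * (2 * (2 * pi * norm \<eta>) * A \<eta> (snd (x, L)))"
        by (simp add: F_def dcos_def dir_def inner_add_left flip: zero_prod_def)
      have "A' \<eta> L = - (2 * pi * norm \<eta> * B \<eta> L)" using tangential[OF \<eta>] by simp
      then show "G b \<eta> (snd (x, L)) \<bullet> e_N + G e_N \<eta> (snd (x, L)) \<bullet> b = snd b * 0"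
        by (simp add: G_def dsin_def dir_def inner_prod_def mult.assoc mult.left_commute[of "norm \<eta>"] norm_sgn_eq)
    qed
    also have "\<dots> = snd b * W" unfolding W_def wave_def by (simp add: mult.left_commute[of _ "snd b"])
    finally show ?thesis .
  qed
  have inner: "(\<Sum>c\<in>Basis. sym_grad L (u t) (x, L) b c * (e_N \<bullet> c)) = sym_grad L (u t) (x, L) b e_N" for b
    unfolding sum_Basis_point by (simp add: e_N_def)
  have "(\<Sum>b\<in>Basis. (snd b * W) *\<^sub>R b) = W *\<^sub>R (e_N :: 'n point)"
    unfolding sum_Basis_point by (simp add: e_N_def flip: zero_prod_def)
  then have "stress L (u t) (p t) (x, L) e_N = (p t (x, L) - W) *\<^sub>R e_N"
    unfolding stress_def inner sg by (simp add: scaleR_diff_left)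
  also have "p t (x, L) - W = wave (\<lambda>\<eta> y. Q \<eta> y - 2 * (2 * pi * norm \<eta>) * A \<eta> y) (\<lambda>_ _. 0) t (x, L)"
  proof -
    have pA2: "profile (\<lambda>\<eta> y. (- (2 * (2 * pi * norm \<eta>))) *\<^sub>R A \<eta> y)"
      using norm_le by (intro profile_scaleR[where B = "2 * (2 * pi * K)"] profile_derivD(1)[OF pA]) (auto simp: abs_mult)
    have "- W = wave (\<lambda>\<eta> y. (- (2 * (2 * pi * norm \<eta>))) *\<^sub>R A \<eta> y) (\<lambda>_ _. 0) t (x, L)"
      unfolding W_def wave_def by (simp flip: Bochner_Integration.integral_minus)
    then have "p t (x, L) - W = p t (x, L) + wave (\<lambda>\<eta> y. (- (2 * (2 * pi * norm \<eta>))) *\<^sub>R A \<eta> y) (\<lambda>_ _. 0) t (x, L)" by simp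
    then show ?thesis unfolding p_def wave_add[OF profile_derivD(1)[OF pQ] profile_zero pA2 profile_zero] by simp
  qed
  also have "\<dots> = wave (\<lambda>\<eta> y. \<mu> \<eta> * H \<eta>) (\<lambda>_ _. 0) t (x, L)"
    by (rule wave_cong) (simp_all flip: normal)
  finally show ?thesis .
qed

lemma u_bottom: "u t (x, 0) = 0"
  unfolding u_def
  by (subst wave_cong[where ?f2.0 = "\<lambda>_ _. 0" and ?g2.0 = "\<lambda>_ _. 0"]) (simp_all add: A_0 B_0 wave_zero)

text \<open>Separates the local equations, which hold for any frequency measure, from the conditions
  that depend on the cross-section.\<close>

lemma superposition_is_solution:
  assumes "S = Torus \<longrightarrow> torus_conditions L u p h"
    and "\<And>t y. t \<ge> 0 \<Longrightarrow> y \<in> {0..L} \<Longrightarrow> \<exists>P. is_fourier_transform S (\<lambda>x. p t (x, y)) P"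
    and "\<And>t. t \<ge> 0 \<Longrightarrow> is_multiplier_image S \<mu> (h t) (\<lambda>x. wave (\<lambda>\<eta> y. \<mu> \<eta> * H \<eta>) (\<lambda>_ _. 0) t (x, L))"
  shows "is_solution S L \<mu> u p h"
proof -
  have "layer L \<subseteq> closed_layer L" by (auto simp: layer_def closed_layer_def)
  moreover have "\<exists>Mh. is_multiplier_image S \<mu> (h t) Mh \<and> (\<forall>x. stress L (u t) (p t) (x, L) e_N = Mh x *\<^sub>R e_N)"
    if "t \<ge> 0" for t
    using assms(3)[OF that] stress_top by blast
  ultimately show ?thesis
    unfolding is_solution_def
    using assms(1,2) regular momentum divergence_u dt_h u_bottom by blast
qed

end

section \<open>Transforms of superpositions\<close>

lemma lebesgue_reflect:
  "(uminus :: 'a::euclidean_space \<Rightarrow> 'a) \<in> lebesgue \<rightarrow>\<^sub>M lebesgue"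
  "lebesgue = distr lebesgue lebesgue (uminus :: 'a::euclidean_space \<Rightarrow> 'a)"
proof -
  have e: "(\<lambda>x::'a. 0 + (\<Sum>j\<in>Basis. (-1 * (x \<bullet> j)) *\<^sub>R j)) = uminus"
    by (simp add: fun_eq_iff sum_negf euclidean_representation)
  show m: "(uminus :: 'a \<Rightarrow> 'a) \<in> lebesgue \<rightarrow>\<^sub>M lebesgue"
    using lebesgue_affine_measurable[of "\<lambda>_. -1" "0::'a"] unfolding e by simp
  have "(lebesgue :: 'a measure) = density (distr lebesgue lebesgue uminus) (\<lambda>_. 1)"
    using lebesgue_affine_euclidean[of "\<lambda>_. -1" "0::'a"] unfolding e by simp
  then show "lebesgue = distr lebesgue lebesgue (uminus :: 'a \<Rightarrow> 'a)"
    by (simp add: density_1)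
qed

lemma integral_lebesgue_reflect:
  fixes f :: "'a::euclidean_space \<Rightarrow> 'b::{banach,second_countable_topology}"
  assumes "integrable lebesgue f"
  shows "integrable lebesgue (\<lambda>x. f (- x))" "(\<integral>x. f (- x) \<partial>lebesgue) = integral\<^sup>L lebesgue f"
proof -
  have f: "f \<in> borel_measurable lebesgue" using assms by auto
  have "integrable (distr lebesgue lebesgue (uminus :: 'a \<Rightarrow> 'a)) f"
    using assms by (subst lebesgue_reflect(2)[symmetric])
  then show "integrable lebesgue (\<lambda>x. f (- x))"
    by (subst (asm) integrable_distr_eq[OF lebesgue_reflect(1) f])
  show "(\<integral>x. f (- x) \<partial>lebesgue) = integral\<^sup>L lebesgue f"
    unfolding integral_distr[OF lebesgue_reflect(1) f, symmetric] by (subst lebesgue_reflect(2)[symmetric]) (rule refl)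
qed

text \<open>Comes from \<open>a cos t + b sin t = (a - i b)/2 e^(it) + (a + i b)/2 e^(-it)\<close>:
  a real wave with frequencies in \<open>D\<close> has its transform on \<open>D\<close> and on the
  reflection of \<open>D\<close>.\<close>

definition spectrum :: "(real^'n) set \<Rightarrow> (real^'n \<Rightarrow> real) \<Rightarrow> (real^'n \<Rightarrow> real) \<Rightarrow> real^'n \<Rightarrow> complex" where
  "spectrum D a b \<zeta> = (if \<zeta> \<in> D then Complex (a \<zeta>) (- b \<zeta>) / 2 else 0)
     + (if - \<zeta> \<in> D then Complex (a (- \<zeta>)) (b (- \<zeta>)) / 2 else 0)"

text \<open>The only information about transforms that the construction of solutions uses, so that
  both cross-sections can be treated at once.\<close>

definition has_spectral_transforms :: "cross_section \<Rightarrow> (real^'n) measure \<Rightarrow> bool" where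
  "has_spectral_transforms S M \<longleftrightarrow> (\<forall>a b C. a \<in> borel_measurable M \<longrightarrow> b \<in> borel_measurable M \<longrightarrow>
    (\<forall>\<eta>\<in>space M. \<bar>a \<eta>\<bar> \<le> C \<and> \<bar>b \<eta>\<bar> \<le> C) \<longrightarrow>
    is_fourier_transform S (\<lambda>x. LINT \<eta>|M. a \<eta> * cos (2 * pi * (\<eta> \<bullet> x)) + b \<eta> * sin (2 * pi * (\<eta> \<bullet> x)))
      (spectrum (space M) a b))"

lemma cos_sin_cis:
  "complex_of_real (a * cos t + b * sin t) = Complex a (- b) / 2 * cis t + Complex a b / 2 * cis (- t)"
  by (simp add: complex_eq_iff field_simps)

text \<open>Orthogonality of characters: the coefficient at \<open>\<zeta>\<close> receives
  contributions only from \<open>\<zeta> = \<xi>\<close> and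
  \<open>\<zeta> = - \<xi>\<close>.\<close>

lemma torus_transform:
  fixes \<xi> :: "real^'n"
  assumes \<xi>: "\<xi> \<in> dual_group Torus"
  shows "is_fourier_transform Torus (\<lambda>x. a \<xi> * cos (2 * pi * (\<xi> \<bullet> x)) + b \<xi> * sin (2 * pi * (\<xi> \<bullet> x))) (spectrum {\<xi>} a b)"
  unfolding is_fourier_transform_def
proof (simp, intro conjI ballI)
  let ?h = "\<lambda>x. a \<xi> * cos (2 * pi * (\<xi> \<bullet> x)) + b \<xi> * sin (2 * pi * (\<xi> \<bullet> x))"
  have "integrable lborel (\<lambda>x. indicator (cbox 0 One) x *\<^sub>R ?h x)"
    by (rule borel_integrable_compact) (auto intro!: continuous_intros)
  then show "set_integrable lebesgue (cbox 0 One) ?h"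
    unfolding set_integrable_def by (subst integrable_completion) auto
  fix \<zeta> :: "real^'n" assume \<zeta>: "\<zeta> \<in> dual_group Torus"
  have ch: "(LINT x:cbox 0 One|lborel. cis (2 * pi * (k \<bullet> x))) = (if k = 0 then 1 else 0)"
    "set_integrable lborel (cbox 0 One) (\<lambda>x. cis (2 * pi * (k \<bullet> x)))"
    if "k \<in> dual_group Torus" for k :: "real^'n"
  proof -
    show "(LINT x:cbox 0 One|lborel. cis (2 * pi * (k \<bullet> x))) = (if k = 0 then 1 else 0)"
      using that by (intro torus_character_integral) (auto simp: dual_group_def Basis_vec_def inner_axis)
    show "set_integrable lborel (cbox 0 One) (\<lambda>x. cis (2 * pi * (k \<bullet> x)))"
      unfolding set_integrable_def by (rule borel_integrable_compact) (auto intro!: continuous_intros)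
  qed
  have d: "\<xi> - \<zeta> \<in> dual_group Torus" "- \<xi> - \<zeta> \<in> dual_group Torus"
    using \<xi> \<zeta> by (auto simp: dual_group_def)
  have "fourier_on (cbox 0 One) ?h \<zeta> = (LINT x:cbox 0 One|lborel. complex_of_real (?h x) * cis (- 2 * pi * (\<zeta> \<bullet> x)))"
    unfolding fourier_on_def set_lebesgue_integral_def by (rule integral_completion) auto
  also have "\<dots> = (LINT x:cbox 0 One|lborel. Complex (a \<xi>) (- b \<xi>) / 2 * cis (2 * pi * ((\<xi> - \<zeta>) \<bullet> x))
      + Complex (a \<xi>) (b \<xi>) / 2 * cis (2 * pi * ((- \<xi> - \<zeta>) \<bullet> x)))"
  proof (intro set_lebesgue_integral_cong ballI allI impI)
    fix x :: "real^'n"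
    have e: "cis (2 * pi * ((\<xi> - \<zeta>) \<bullet> x)) = cis (2 * pi * (\<xi> \<bullet> x)) * cis (- 2 * pi * (\<zeta> \<bullet> x))"
      "cis (2 * pi * ((- \<xi> - \<zeta>) \<bullet> x)) = cis (- (2 * pi * (\<xi> \<bullet> x))) * cis (- 2 * pi * (\<zeta> \<bullet> x))"
      unfolding cis_mult by (simp_all add: inner_diff_left algebra_simps)
    show "complex_of_real (?h x) * cis (- 2 * pi * (\<zeta> \<bullet> x)) = Complex (a \<xi>) (- b \<xi>) / 2 * cis (2 * pi * ((\<xi> - \<zeta>) \<bullet> x))
      + Complex (a \<xi>) (b \<xi>) / 2 * cis (2 * pi * ((- \<xi> - \<zeta>) \<bullet> x))"
      unfolding cos_sin_cis e by (simp only: distrib_right mult.assoc)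
  qed auto
  also have "\<dots> = Complex (a \<xi>) (- b \<xi>) / 2 * (if \<xi> - \<zeta> = 0 then 1 else 0) + Complex (a \<xi>) (b \<xi>) / 2 * (if - \<xi> - \<zeta> = 0 then 1 else 0)"
    by (subst set_integral_add(2)) (auto simp: ch[OF d(1)] ch[OF d(2)])
  also have "\<dots> = spectrum {\<xi>} a b \<zeta>"
  proof -
    have "\<xi> - \<zeta> = 0 \<longleftrightarrow> \<zeta> = \<xi>" "- \<xi> - \<zeta> = 0 \<longleftrightarrow> - \<zeta> = \<xi>" by (auto simp: algebra_simps)
    then show ?thesis by (simp add: spectrum_def cong: if_cong)
  qed
  finally show "spectrum {\<xi>} a b \<zeta> = fourier_on (cbox 0 One) ?h \<zeta>" ..
qed

text \<open>The synthesis integral is an inverse Fourier transform of a bounded, compact-like datum: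
  an integrable function \<open>P\<close> on \<open>V\<close> plus its Hermitian reflection. The
  inversion theorem then returns that function.\<close>

lemma euclidean_transform:
  fixes a b :: "real^'n \<Rightarrow> real"
  assumes V: "V \<in> sets lebesgue" "emeasure lebesgue V < \<infinity>"
    and ab: "a \<in> borel_measurable (lebesgue_on V)" "b \<in> borel_measurable (lebesgue_on V)"
    and C: "\<And>\<eta>. \<eta> \<in> V \<Longrightarrow> \<bar>a \<eta>\<bar> \<le> C" "\<And>\<eta>. \<eta> \<in> V \<Longrightarrow> \<bar>b \<eta>\<bar> \<le> C"
  shows "is_fourier_transform Euclidean
     (\<lambda>x. LINT \<eta>|lebesgue_on V. a \<eta> * cos (2 * pi * (\<eta> \<bullet> x)) + b \<eta> * sin (2 * pi * (\<eta> \<bullet> x))) (spectrum V a b)"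
proof -
  define P where "P \<eta> = (if \<eta> \<in> V then Complex (a \<eta>) (- b \<eta>) / 2 else 0)" for \<eta>
  have Pm: "P \<in> borel_measurable lebesgue"
  proof -
    have "(\<lambda>\<eta>. Complex (a \<eta>) (- b \<eta>) / 2) \<in> borel_measurable (lebesgue_on V)"
      using ab by (simp add: borel_measurable_complex_iff)
    then show ?thesis
      unfolding P_def[abs_def] using V(1) by (simp add: borel_measurable_if_lebesgue_on flip: borel_measurable_if)
  qed
  have cle: "cmod (Complex x y / 2) \<le> \<bar>x\<bar> + \<bar>y\<bar>" for x y
    using cmod_le[of "Complex x y"] by (simp add: norm_divide)
  have PC: "cmod (P \<eta>) \<le> indicat_real V \<eta> * (2 * C)" for \<eta>
    using C[of \<eta>] cle[of "a \<eta>" "- b \<eta>"] by (cases "\<eta> \<in> V") (auto simp: P_def)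
  have Pi: "integrable lebesgue P"
  proof (rule Bochner_Integration.integrable_bound)
    show "integrable lebesgue (\<lambda>\<eta>. indicat_real V \<eta> * (2 * C))" using V by simp
    show "AE \<eta> in lebesgue. norm (P \<eta>) \<le> norm (indicat_real V \<eta> * (2 * C))"
      using PC by (intro AE_I2) (auto intro: order_trans[OF _ abs_ge_self])
  qed (rule Pm)
  \<comment> \<open>Hermitian symmetry makes the inverse transform twice the real part of that of
    \<open>P\<close>, hence real.\<close>
  have spec: "spectrum V a b \<eta> = P \<eta> + cnj (P (- \<eta>))" for \<eta>
    by (auto simp: spectrum_def P_def complex_cnj complex_cnj_divide)
  have Ri: "integrable lebesgue (\<lambda>\<eta>. cnj (P (- \<eta>)))"
    using integrable_bounded_linear[OF bounded_linear_cnj integral_lebesgue_reflect(1)[OF Pi]] .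
  show ?thesis
  proof (rule is_fourier_transform_Euclidean)
    show "integrable lebesgue (spectrum V a b)"
      unfolding spec[abs_def] using Pi Ri by (rule Bochner_Integration.integrable_add)
    show "cmod (spectrum V a b \<eta>) \<le> 2 * \<bar>C\<bar> + 2 * \<bar>C\<bar>" for \<eta>
    proof -
      have "cmod (P \<eta>) \<le> 2 * \<bar>C\<bar>" for \<eta> using PC[of \<eta>] by (cases "\<eta> \<in> V") auto
      then show ?thesis unfolding spec by (intro norm_triangle_mono) simp_all
    qed
    fix x :: "real^'n"
    have cm: "(\<lambda>\<eta>. cis (2 * pi * (\<eta> \<bullet> x))) \<in> borel_measurable lebesgue"
      by (intro measurable_completion) measurable
    have Pci: "integrable lebesgue (\<lambda>\<eta>. P \<eta> * cis (2 * pi * (\<eta> \<bullet> x)))"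
      by (rule Bochner_Integration.integrable_bound[OF Pi]) (use Pm cm in \<open>auto simp: norm_mult\<close>)
    have r: "cnj (P (- \<eta>)) * cis (2 * pi * (\<eta> \<bullet> x)) = (\<lambda>\<eta>. cnj (P \<eta> * cis (2 * pi * (\<eta> \<bullet> x)))) (- \<eta>)" for \<eta>
      by (simp add: cis_cnj)
    have ci: "integrable lebesgue (\<lambda>\<eta>. cnj (P \<eta> * cis (2 * pi * (\<eta> \<bullet> x))))"
      by (rule integrable_bounded_linear[OF bounded_linear_cnj Pci])
    have "(\<integral>\<eta>. spectrum V a b \<eta> * cis (2 * pi * (\<eta> \<bullet> x)) \<partial>lebesgue)
      = (\<integral>\<eta>. P \<eta> * cis (2 * pi * (\<eta> \<bullet> x)) + cnj (P (- \<eta>)) * cis (2 * pi * (\<eta> \<bullet> x)) \<partial>lebesgue)"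
      unfolding spec distrib_right ..
    also have "\<dots> = (\<integral>\<eta>. P \<eta> * cis (2 * pi * (\<eta> \<bullet> x)) \<partial>lebesgue) + (\<integral>\<eta>. cnj (P \<eta> * cis (2 * pi * (\<eta> \<bullet> x))) \<partial>lebesgue)"
      unfolding r
      by (subst Bochner_Integration.integral_add[OF Pci integral_lebesgue_reflect(1)[OF ci]])
         (simp only: integral_lebesgue_reflect(2)[OF ci])
    also have "\<dots> = (\<integral>\<eta>. P \<eta> * cis (2 * pi * (\<eta> \<bullet> x)) + cnj (P \<eta> * cis (2 * pi * (\<eta> \<bullet> x))) \<partial>lebesgue)"
      by (rule Bochner_Integration.integral_add[OF Pci ci, symmetric])
    also have "\<dots> = (\<integral>\<eta>. complex_of_real (indicat_real V \<eta> *\<^sub>R (a \<eta> * cos (2 * pi * (\<eta> \<bullet> x)) + b \<eta> * sin (2 * pi * (\<eta> \<bullet> x)))) \<partial>lebesgue)"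
      by (rule Bochner_Integration.integral_cong[OF refl]) (auto simp: P_def complex_eq_iff)
    also have "\<dots> = complex_of_real (LINT \<eta>|lebesgue_on V. a \<eta> * cos (2 * pi * (\<eta> \<bullet> x)) + b \<eta> * sin (2 * pi * (\<eta> \<bullet> x)))"
      using V(1) by (simp only: integral_complex_of_real) (subst integral_restrict_space, simp_all)
    finally show "complex_of_real (LINT \<eta>|lebesgue_on V. a \<eta> * cos (2 * pi * (\<eta> \<bullet> x)) + b \<eta> * sin (2 * pi * (\<eta> \<bullet> x)))
      = (\<integral>\<eta>. spectrum V a b \<eta> * cis (2 * pi * (\<eta> \<bullet> x)) \<partial>lebesgue)" ..
  qed
qed

lemma has_spectral_transforms_Torus:
  "\<xi> \<in> dual_group Torus \<Longrightarrow> has_spectral_transforms Torus (count_space {\<xi>})"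
  using torus_transform[of \<xi>] by (simp add: has_spectral_transforms_def lebesgue_integral_count_space_finite)

lemma has_spectral_transforms_Euclidean:
  fixes V :: "(real^'n) set"
  assumes "V \<in> sets lebesgue" "emeasure lebesgue V < \<infinity>"
  shows "has_spectral_transforms Euclidean (lebesgue_on V)"
  unfolding has_spectral_transforms_def
proof (intro allI impI)
  have sp: "space (lebesgue_on V) = V" by simp
  fix a b :: "real^'n \<Rightarrow> real" and C
  assume "a \<in> borel_measurable (lebesgue_on V)" "b \<in> borel_measurable (lebesgue_on V)"
    "\<forall>\<eta>\<in>space (lebesgue_on V). \<bar>a \<eta>\<bar> \<le> C \<and> \<bar>b \<eta>\<bar> \<le> C"
  then show "is_fourier_transform Euclidean (\<lambda>x. LINT \<eta>|lebesgue_on V. a \<eta> * cos (2 * pi * (\<eta> \<bullet> x)) + b \<eta> * sin (2 * pi * (\<eta> \<bullet> x)))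
      (spectrum (space (lebesgue_on V)) a b)"
    unfolding sp by (intro euclidean_transform[OF assms]) auto
qed

section \<open>Measurability of the decay rate in the frequency\<close>

lemma continuous_on_mode [continuous_intros]:
  assumes f: "continuous_on X k" "continuous_on X m" "continuous_on X y"
  shows "continuous_on X (\<lambda>w. mode_a L (k w) (m w) (y w))" "continuous_on X (\<lambda>w. mode_a' L (k w) (m w) (y w))"
    "continuous_on X (\<lambda>w. mode_b L (k w) (m w) (y w))" "continuous_on X (\<lambda>w. mode_q L (k w) (m w) (y w))"
  unfolding mode_a_def mode_a'_def mode_b_def mode_q_def mode_P_def mode_Q_def
  by (intro continuous_intros f)+

text \<open>The rate is only defined implicitly, so its sublevel sets are examined. Thresholds
  \<open>c \<le> 0\<close> give the empty set, those above \<open>k^2/16\<close> impose nothing, and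
  in between \<open>decay_rate_le_iff\<close> gives an explicit inequality.\<close>

lemma decay_rate_measurable:
  assumes L: "L > 0" and k[measurable]: "k \<in> borel_measurable M" and v[measurable]: "v \<in> borel_measurable M"
    and k_pos: "\<And>x. x \<in> space M \<Longrightarrow> k x > 0" and v_pos: "\<And>x. x \<in> space M \<Longrightarrow> 0 < v x"
    and v_le: "\<And>x. x \<in> space M \<Longrightarrow> v x \<le> k x ^ 3 / 16"
  shows "(\<lambda>x. decay_rate L (k x) (v x)) \<in> borel_measurable M"
  unfolding borel_measurable_iff_le
proof
  fix c
  show "{x \<in> space M. decay_rate L (k x) (v x) \<le> c} \<in> sets M"
  proof (cases "c \<le> 0")
    case True
    then have "\<not> decay_rate L (k x) (v x) \<le> c" if "x \<in> space M" for x
      using decay_rate(1)[OF L k_pos[OF that] v_pos[OF that] v_le[OF that]] by linarith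
    then have e: "{x \<in> space M. decay_rate L (k x) (v x) \<le> c} = {}" by blast
    show ?thesis unfolding e by simp
  next
    case False
    have "decay_rate L (k x) (v x) \<le> c \<longleftrightarrow> (k x)\<^sup>2 / 16 \<le> c \<or> v x \<le> c * stress_ratio L (k x) c"
      if "x \<in> space M" for x
    proof (cases "(k x)\<^sup>2 / 16 \<le> c")
      case True
      then show ?thesis
        using order_trans[OF decay_rate(2)[OF L k_pos[OF that] v_pos[OF that] v_le[OF that]] True] by simp
    next
      case F: False
      then show ?thesis
        using decay_rate_le_iff[OF L k_pos[OF that] v_pos[OF that] v_le[OF that], of c] False by simp
    qed
    then have "{x \<in> space M. decay_rate L (k x) (v x) \<le> c}
      = {x \<in> space M. (k x)\<^sup>2 / 16 \<le> c \<or> v x \<le> c * stress_ratio L (k x) c}" by blast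
    also have "\<dots> \<in> sets M"
    proof -
      \<comment> \<open>The total function \<open>sqrt\<close> is continuous on negative arguments
        too, so numerator and denominator are continuous for all \<open>z\<close>; their quotient is
        Borel without excluding zeros of the denominator.\<close>
      have c: "continuous_on UNIV (\<lambda>z::real. 2 * z * mode_a L z (sqrt (z\<^sup>2 - c)) L - mode_q L z (sqrt (z\<^sup>2 - c)) L)"
        "continuous_on UNIV (\<lambda>z::real. mode_b L z (sqrt (z\<^sup>2 - c)) L)"
        by (intro continuous_intros)+
      have [measurable]: "(\<lambda>x. stress_ratio L (k x) c) \<in> borel_measurable M"
        unfolding stress_ratio_def Let_def
        by (intro borel_measurable_divide borel_measurable_continuous_on[OF c(1) k] borel_measurable_continuous_on[OF c(2) k])
      show ?thesis by measurable
    qed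
    finally show ?thesis .
  qed
qed

section \<open>Profiles built from modes, and the transforms of waves\<close>

context frequency_measure begin

lemma profile_compose:
  fixes \<Psi> :: "real \<times> real \<times> real \<Rightarrow> real"
  assumes cont: "continuous_on UNIV \<Psi>" and [measurable]: "k \<in> borel_measurable M" "m \<in> borel_measurable M"
    and B: "\<And>\<eta>. \<eta> \<in> space M \<Longrightarrow> \<bar>k \<eta>\<bar> \<le> Ck" "\<And>\<eta>. \<eta> \<in> space M \<Longrightarrow> \<bar>m \<eta>\<bar> \<le> Cm"
  shows "profile (\<lambda>\<eta> y. \<Psi> (k \<eta>, m \<eta>, y))"
  unfolding profile_def
proof (intro conjI allI ballI)
  have [measurable]: "\<Psi> \<in> borel_measurable (borel \<Otimes>\<^sub>M borel \<Otimes>\<^sub>M borel)"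
    using borel_measurable_continuous_onI[OF cont] by (simp add: borel_prod)
  show "(\<lambda>\<eta>. \<Psi> (k \<eta>, m \<eta>, y)) \<in> borel_measurable M" for y by measurable
  show "continuous_on UNIV (\<lambda>y. \<Psi> (k \<eta>, m \<eta>, y))" for \<eta>
    by (rule continuous_on_compose2[OF cont]) (auto intro!: continuous_intros)
  fix R :: real
  have "compact ({- Ck..Ck} \<times> {- Cm..Cm} \<times> {- R..R})" by (intro compact_Times compact_Icc)
  then have "bounded (\<Psi> ` ({- Ck..Ck} \<times> {- Cm..Cm} \<times> {- R..R}))"
    by (intro compact_imp_bounded compact_continuous_image continuous_on_subset[OF cont]) auto
  then obtain C where C: "\<And>z. z \<in> {- Ck..Ck} \<times> {- Cm..Cm} \<times> {- R..R} \<Longrightarrow> norm (\<Psi> z) \<le> C"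
    unfolding bounded_iff by blast
  show "\<exists>C. \<forall>\<eta>\<in>space M. \<forall>y. \<bar>y\<bar> \<le> R \<longrightarrow> norm (\<Psi> (k \<eta>, m \<eta>, y)) \<le> C"
  proof (intro exI[of _ C] ballI allI impI C)
    fix \<eta> y assume "\<eta> \<in> space M" "\<bar>y\<bar> \<le> R"
    then show "(k \<eta>, m \<eta>, y) \<in> {- Ck..Ck} \<times> {- Cm..Cm} \<times> {- R..R}"
      using B[of \<eta>] by (auto simp: abs_le_iff)
  qed
qed

lemma profile_derivI:
  fixes f :: "real^'n \<Rightarrow> real \<Rightarrow> real"
  assumes "profile f" "profile f'" "\<And>\<eta> y. \<eta> \<in> space M \<Longrightarrow> (f \<eta> has_real_derivative f' \<eta> y) (at y)"
  shows "profile_deriv f f'"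
  using assms by (simp add: profile_deriv_def has_real_derivative_iff_has_vector_derivative)

lemma wave_fourier:
  fixes f g :: "real^'n \<Rightarrow> real \<Rightarrow> real"
  assumes spectral: "has_spectral_transforms S M"
    and f: "profile f" and g: "profile g"
  shows "is_fourier_transform S (\<lambda>x. wave f g t (x, y))
     (spectrum (space M) (\<lambda>\<eta>. exp (- lam \<eta> * t) * f \<eta> y) (\<lambda>\<eta>. exp (- lam \<eta> * t) * g \<eta> y))"
proof -
  have [measurable]: "(\<lambda>\<eta>. f \<eta> y) \<in> borel_measurable M" "(\<lambda>\<eta>. g \<eta> y) \<in> borel_measurable M"
    using f g by (auto simp: profile_def)
  obtain Cf where Cf: "Cf \<ge> 0" "\<forall>\<eta>\<in>space M. \<forall>z. \<bar>z\<bar> \<le> \<bar>y\<bar> \<longrightarrow> norm (f \<eta> z) \<le> Cf"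
    using profile_bound[OF f, of "\<bar>y\<bar>"] by blast
  obtain Cg where Cg: "Cg \<ge> 0" "\<forall>\<eta>\<in>space M. \<forall>z. \<bar>z\<bar> \<le> \<bar>y\<bar> \<longrightarrow> norm (g \<eta> z) \<le> Cg"
    using profile_bound[OF g, of "\<bar>y\<bar>"] by blast
  have "is_fourier_transform S (\<lambda>x. LINT \<eta>|M. (exp (- lam \<eta> * t) * f \<eta> y) * cos (2 * pi * (\<eta> \<bullet> x)) + (exp (- lam \<eta> * t) * g \<eta> y) * sin (2 * pi * (\<eta> \<bullet> x)))
     (spectrum (space M) (\<lambda>\<eta>. exp (- lam \<eta> * t) * f \<eta> y) (\<lambda>\<eta>. exp (- lam \<eta> * t) * g \<eta> y))"
  proof (rule spectral[unfolded has_spectral_transforms_def, rule_format])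
    \<comment> \<open>The angles 0 and \<open>pi / 2\<close> in \<open>wave_integrand_bound\<close>
      isolate the cosine and the sine coefficient.\<close>
    show "\<bar>exp (- lam \<eta> * t) * f \<eta> y\<bar> \<le> exp (K * \<bar>t\<bar>) * (Cf + Cg) \<and> \<bar>exp (- lam \<eta> * t) * g \<eta> y\<bar> \<le> exp (K * \<bar>t\<bar>) * (Cf + Cg)"
      if \<eta>: "\<eta> \<in> space M" for \<eta>
      using wave_integrand_bound[OF \<eta>, of t "\<bar>t\<bar>" "f \<eta> y" Cf 0 Cg 0]
        wave_integrand_bound[OF \<eta>, of t "\<bar>t\<bar>" 0 Cf "g \<eta> y" Cg "pi / 2"] Cf Cg \<eta> by simp
  qed measurable
  moreover have "wave f g t (x, y) = (LINT \<eta>|M. (exp (- lam \<eta> * t) * f \<eta> y) * cos (2 * pi * (\<eta> \<bullet> x)) + (exp (- lam \<eta> * t) * g \<eta> y) * sin (2 * pi * (\<eta> \<bullet> x)))" for x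
    unfolding wave_def by (simp add: algebra_simps)
  ultimately show ?thesis by simp
qed

lemma wave_periodic:
  assumes M: "space M \<subseteq> dual_group Torus" and j: "j \<in> dual_group Torus"
  shows "wave f g t (x + j, y) = wave f g t (x, y)"
proof -
  have cs: "cos (2 * pi * (\<eta> \<bullet> (x + j))) = cos (2 * pi * (\<eta> \<bullet> x))" "sin (2 * pi * (\<eta> \<bullet> (x + j))) = sin (2 * pi * (\<eta> \<bullet> x))"
    if "\<eta> \<in> space M" for \<eta>
  proof -
    have "\<eta> \<bullet> j = (\<Sum>i\<in>UNIV. \<eta> $ i * j $ i)" by (simp add: inner_vec_def)
    also have "\<dots> \<in> \<int>" using that M j by (intro Ints_sum Ints_mult) (auto simp: dual_group_def)
    finally obtain n where "\<eta> \<bullet> j = of_int n" by (auto elim: Ints_cases)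
    then have e: "2 * pi * (\<eta> \<bullet> (x + j)) = 2 * pi * (\<eta> \<bullet> x) + 2 * pi * of_int n"
      by (simp add: inner_add_right distrib_left)
    show "cos (2 * pi * (\<eta> \<bullet> (x + j))) = cos (2 * pi * (\<eta> \<bullet> x))" "sin (2 * pi * (\<eta> \<bullet> (x + j))) = sin (2 * pi * (\<eta> \<bullet> x))"
      unfolding e by (simp_all add: cos_add sin_add cos_int_2pin sin_int_2pin)
  qed
  show ?thesis unfolding wave_def by (rule Bochner_Integration.integral_cong) (simp_all add: cs)
qed

lemma spectrum_continuous:
  assumes f: "profile f" and g: "profile g" and D: "D \<subseteq> space M"
  shows "continuous_on A (\<lambda>(t, y). spectrum D (\<lambda>\<eta>. exp (- lam \<eta> * t) * f \<eta> y) (\<lambda>\<eta>. exp (- lam \<eta> * t) * g \<eta> y) \<zeta>)"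
proof -
  have c: "continuous_on A (\<lambda>w. Complex (exp (- lam \<eta> * fst w) * f \<eta> (snd w)) (r * (exp (- lam \<eta> * fst w) * g \<eta> (snd w))) / 2)"
    if "\<eta> \<in> D" for \<eta> r
  proof -
    have fc: "continuous_on A (\<lambda>w. f \<eta> (snd w))" "continuous_on A (\<lambda>w. g \<eta> (snd w))"
      using D that
      by (auto intro!: continuous_intros continuous_on_compose2[OF profile_continuous[OF f]] continuous_on_compose2[OF profile_continuous[OF g]])
    show ?thesis unfolding Complex_eq by (intro continuous_intros fc) simp
  qed
  have "continuous_on A (\<lambda>w. if \<zeta> \<in> D then Complex (exp (- lam \<zeta> * fst w) * f \<zeta> (snd w)) (- (exp (- lam \<zeta> * fst w) * g \<zeta> (snd w))) / 2 else 0)"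
    using c[of \<zeta> "-1"] by (cases "\<zeta> \<in> D") simp_all
  moreover have "continuous_on A (\<lambda>w. if - \<zeta> \<in> D then Complex (exp (- lam (- \<zeta>) * fst w) * f (- \<zeta>) (snd w)) (exp (- lam (- \<zeta>) * fst w) * g (- \<zeta>) (snd w)) / 2 else 0)"
    using c[of "- \<zeta>" 1] by (cases "- \<zeta> \<in> D") simp_all
  ultimately show ?thesis
    unfolding case_prod_beta' spectrum_def by (rule continuous_on_add)
qed

end

section \<open>Slowly decaying solutions\<close>

lemma cube_le_two_pi_cube: "0 \<le> (x::real) \<Longrightarrow> x ^ 3 \<le> (2 * pi * x) ^ 3 / 16"
proof -
  assume x: "0 \<le> x"
  have "3 \<le> pi" using pi_gt3 by simp
  then have "(6 :: real) ^ 3 \<le> (2 * pi) ^ 3" by (intro power_mono) auto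
  then have "16 * x ^ 3 \<le> (2 * pi) ^ 3 * x ^ 3" using x by (intro mult_right_mono) auto
  then show ?thesis by (simp add: power_mult_distrib)
qed

text \<open>The cross-section enters through the measure on the frequencies in \<open>V\<close>.
  Disjointness from the reflected set prevents the two terms of \<open>spectrum\<close> from
  overlapping, and evenness of the symbol lets it act on both of them in the same way.\<close>

lemma slow_solution:
  fixes S :: cross_section and \<mu> :: "real^'n \<Rightarrow> real"
  assumes L: "L > 0" and fin: "finite_measure M"
    and id: "(\<lambda>\<eta>. \<eta>) \<in> borel_measurable M" and \<mu>m: "\<mu> \<in> borel_measurable M"
    and D: "space M = V \<inter> dual_group S" and V: "open V" "\<xi> \<in> V"
    and R: "\<And>\<eta>. \<eta> \<in> space M \<Longrightarrow> norm \<eta> \<le> R"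
    and \<mu>: "\<And>\<eta>. \<eta> \<in> space M \<Longrightarrow> 0 < \<mu> \<eta>" "\<And>\<eta>. \<eta> \<in> space M \<Longrightarrow> \<mu> \<eta> \<le> norm \<eta> ^ 3"
    and disj: "\<And>\<eta>. \<eta> \<in> space M \<Longrightarrow> - \<eta> \<notin> space M"
    and even: "\<And>\<eta>. \<eta> \<in> space M \<Longrightarrow> \<mu> (- \<eta>) = \<mu> \<eta>"
    and spectral: "has_spectral_transforms S M"
  shows "\<exists>u p h U H. is_solution S L \<mu> u p h \<and> horizontal_transforms S L u h U H \<and> slow_decay_at S L \<mu> 1 1 U H \<xi>"
proof -
  define k where "k \<eta> = 2 * pi * norm \<eta>" for \<eta> :: "real^'n"
  define lam where "lam \<eta> = decay_rate L (k \<eta>) (\<mu> \<eta>)" for \<eta>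
  define m where "m \<eta> = sqrt ((k \<eta>)\<^sup>2 - lam \<eta>)" for \<eta>
  \<comment> \<open>One constant bounding the frequencies by \<open>R\<close> and the rates by the
    square of the largest wave number.\<close>
  define K where "K = R + (2 * pi * R)\<^sup>2"
  note id[measurable] \<mu>m[measurable]
  have nz: "\<eta> \<noteq> 0" if "\<eta> \<in> space M" for \<eta>
    using \<mu>[OF that] by auto
  have kp: "k \<eta> > 0" if "\<eta> \<in> space M" for \<eta> using nz[OF that] by (simp add: k_def)
  have km[measurable]: "k \<in> borel_measurable M" unfolding k_def[abs_def] by measurable
  have \<mu>k: "\<mu> \<eta> \<le> k \<eta> ^ 3 / 16" if "\<eta> \<in> space M" for \<eta>
    using order_trans[OF \<mu>(2)[OF that] cube_le_two_pi_cube[OF norm_ge_zero]] by (simp add: k_def)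
  have lamm[measurable]: "lam \<in> borel_measurable M"
    unfolding lam_def[abs_def] by (rule decay_rate_measurable[OF L km \<mu>m kp \<mu>(1) \<mu>k])
  have mm[measurable]: "m \<in> borel_measurable M" unfolding m_def[abs_def] by measurable
  have lam: "0 < lam \<eta>" "lam \<eta> \<le> (k \<eta>)\<^sup>2 / 16" "lam \<eta> * stress_ratio L (k \<eta>) (lam \<eta>) = \<mu> \<eta>" "lam \<eta> \<le> \<mu> \<eta> / k \<eta>"
    if "\<eta> \<in> space M" for \<eta>
    using decay_rate[OF L kp[OF that] \<mu>(1)[OF that] \<mu>k[OF that]] by (simp_all add: lam_def)
  have m: "0 < m \<eta>" "m \<eta> < k \<eta>" "(m \<eta>)\<^sup>2 = (k \<eta>)\<^sup>2 - lam \<eta>" "mode_b L (k \<eta>) (m \<eta>) L \<noteq> 0" if "\<eta> \<in> space M" for \<eta>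
    using mode_sqrt[OF L kp[OF that] lam(1,2)[OF that]] by (simp_all add: m_def)
  have Rp: "0 \<le> R" if "\<eta> \<in> space M" for \<eta> using R[OF that] norm_ge_zero[of \<eta>] by linarith
  have kR: "k \<eta> \<le> 2 * pi * R" if "\<eta> \<in> space M" for \<eta> using R[OF that] by (simp add: k_def)
  have kR2: "(k \<eta>)\<^sup>2 \<le> (2 * pi * R)\<^sup>2" if "\<eta> \<in> space M" for \<eta> using kR[OF that] kp[OF that] by (intro power_mono) auto
  have fm: "frequency_measure M K lam"
  proof (rule frequency_measure.intro[OF fin], unfold_locales)
    show "norm \<eta> \<le> K" if "\<eta> \<in> space M" for \<eta> using R[OF that] by (simp add: K_def add_increasing2)
    show "\<bar>lam \<eta>\<bar> \<le> K" if "\<eta> \<in> space M" for \<eta>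
    proof -
      have "lam \<eta> \<le> (2 * pi * R)\<^sup>2" using lam(1,2)[OF that] kR2[OF that] zero_le_power2[of "2 * pi * R"] by linarith
      then show ?thesis using lam(1)[OF that] Rp[OF that] by (simp add: K_def)
    qed
  qed measurable
  interpret frequency_measure M K lam by (rule fm)
  have lamK: "\<bar>lam \<eta>\<bar> \<le> K" if "\<eta> \<in> space M" for \<eta> by (rule lam_le[OF that])
  \<comment> \<open>The kinematic condition would give the height amplitude as
    \<open>- b L / lam\<close>. Scaling the whole mode by \<open>lam\<close> avoids this division,
    which could be unbounded as no uniform lower bound for the rate is available.\<close>
  define lift where "lift \<Psi> \<eta> y = lam \<eta> * \<Psi> (k \<eta>) (m \<eta>) y" for \<Psi> :: "real \<Rightarrow> real \<Rightarrow> real \<Rightarrow> real" and \<eta> and y :: real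
  have mode_prof: "profile (\<lambda>\<eta> y. \<Psi> (k \<eta>, m \<eta>, y))" if "continuous_on UNIV \<Psi>" for \<Psi> :: "real \<times> real \<times> real \<Rightarrow> real"
  proof (rule profile_compose[OF that km mm])
    show "\<bar>k \<eta>\<bar> \<le> 2 * pi * R" if "\<eta> \<in> space M" for \<eta> using kR[OF that] kp[OF that] by simp
    show "\<bar>m \<eta>\<bar> \<le> 2 * pi * R" if "\<eta> \<in> space M" for \<eta> using kR[OF that] m(1,2)[OF that] by simp
  qed
  have lift: "profile (lift \<Psi>)" if "continuous_on UNIV (\<lambda>z. \<Psi> (fst z) (fst (snd z)) (snd (snd z)))" for \<Psi>
    using profile_scaleR[OF mode_prof[OF that] lamm lamK] by (simp add: lift_def[abs_def])
  define a where "a = lift (mode_a L)"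
  define a' where "a' = lift (mode_a' L)"
  define a'' where "a'' = lift (\<lambda>k m y. m\<^sup>2 * mode_a L k m y + k * mode_q L k m y)"
  define b where "b = lift (mode_b L)"
  define q where "q = lift (mode_q L)"
  define q' where "q' = lift (\<lambda>k m y. k * mode_a' L k m y - m\<^sup>2 * mode_b L k m y)"
  define Hf where "Hf \<eta> = - mode_b L (k \<eta>) (m \<eta>) L" for \<eta>
  note defs = a_def a'_def a''_def b_def q_def q'_def lift_def[abs_def]
  have pa: "profile a" "profile a'" "profile a''" "profile b" "profile q" "profile q'"
    unfolding a_def a'_def a''_def b_def q_def q'_def by (intro lift continuous_intros)+
  have pH: "profile (\<lambda>\<eta> y. Hf \<eta>)"
    using mode_prof[of "\<lambda>z. - mode_b L (fst z) (fst (snd z)) L"] by (simp add: Hf_def continuous_intros)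
  have pka: "profile (\<lambda>\<eta> y. (2 * pi * norm \<eta>) *\<^sub>R a \<eta> y)"
    by (rule profile_scaleR[OF pa(1), where B = "2 * pi * R"]) (use R in auto)
  have nzH: "Hf \<eta> \<noteq> 0" if "\<eta> \<in> space M" for \<eta> using m(4)[OF that] by (simp add: Hf_def)
  interpret mode_superposition M K lam L \<mu> Hf a a' a'' b q q'
  proof
    show "L > 0" by (rule L)
    show "profile_deriv a a'"
      by (rule profile_derivI[OF pa(1,2)]) (simp add: defs DERIV_cmult[OF mode_a_deriv])
    show "profile_deriv a' a''"
      by (rule profile_derivI[OF pa(2,3)]) (simp add: defs DERIV_cmult[OF mode_a'_deriv])
    show "profile_deriv q q'"
      by (rule profile_derivI[OF pa(5,6)]) (simp add: defs DERIV_cmult[OF mode_q_deriv])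
    show "profile_deriv b (\<lambda>\<eta> y. (2 * pi * norm \<eta>) *\<^sub>R a \<eta> y)"
      by (rule profile_derivI[OF pa(4) pka])
         (rule DERIV_cong, unfold defs, rule DERIV_cmult[OF mode_b_deriv], simp add: k_def)
    show "profile (\<lambda>\<eta> y. Hf \<eta>)" by (rule pH)
    fix \<eta> assume \<eta>: "\<eta> \<in> space M"
    note mo = mode_sqrt(5)[OF L kp[OF \<eta>] lam(1,2)[OF \<eta>], folded m_def]
    show "a'' \<eta> y = ((2 * pi * norm \<eta>)\<^sup>2 - lam \<eta>) * a \<eta> y + 2 * pi * norm \<eta> * q \<eta> y" for y
      unfolding defs m(3)[OF \<eta>] k_def[symmetric] by (simp add: algebra_simps)
    show "q' \<eta> y = 2 * pi * norm \<eta> * a' \<eta> y - ((2 * pi * norm \<eta>)\<^sup>2 - lam \<eta>) * b \<eta> y" for y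
      unfolding defs m(3)[OF \<eta>] k_def[symmetric] by (simp add: algebra_simps)
    show "a \<eta> 0 = 0" "b \<eta> 0 = 0"
      using stokes_mode.a_0[OF mo] stokes_mode.b_0[OF mo] by (simp_all add: defs)
    have "a' \<eta> L + 2 * pi * norm \<eta> * b \<eta> L = lam \<eta> * (mode_a' L (k \<eta>) (m \<eta>) L + k \<eta> * mode_b L (k \<eta>) (m \<eta>) L)"
      by (simp add: defs k_def algebra_simps)
    then show "a' \<eta> L + 2 * pi * norm \<eta> * b \<eta> L = 0" by (simp add: mode_tangential)
    have "lam \<eta> * ((2 * k \<eta> * mode_a L (k \<eta>) (m \<eta>) L - mode_q L (k \<eta>) (m \<eta>) L) / mode_b L (k \<eta>) (m \<eta>) L) = \<mu> \<eta>"
      using lam(3)[OF \<eta>] unfolding stress_ratio_def Let_def m_def[symmetric] .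
    then have "lam \<eta> * (2 * k \<eta> * mode_a L (k \<eta>) (m \<eta>) L - mode_q L (k \<eta>) (m \<eta>) L) = \<mu> \<eta> * mode_b L (k \<eta>) (m \<eta>) L"
      using m(4)[OF \<eta>] by (simp add: field_simps)
    then show "q \<eta> L - 2 * (2 * pi * norm \<eta>) * a \<eta> L = \<mu> \<eta> * Hf \<eta>"
      unfolding defs Hf_def k_def[symmetric] by (simp add: algebra_simps)
    show "- lam \<eta> * Hf \<eta> = b \<eta> L" by (simp add: defs Hf_def)
  qed
  note wf = wave_fourier[OF spectral]
  define spec where "spec f g t \<zeta> y = spectrum (space M) (\<lambda>\<eta>. exp (- lam \<eta> * t) * f \<eta> y) (\<lambda>\<eta>. exp (- lam \<eta> * t) * g \<eta> y) \<zeta>"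
    for f g t \<zeta> and y :: real
  define H where "H t \<zeta> = spec (\<lambda>\<eta> y. Hf \<eta>) (\<lambda>_ _. 0) t \<zeta> 0" for t \<zeta>
  define U where "U t \<zeta> y e = spec (\<lambda>\<eta> y. (b \<eta> y *\<^sub>R e_N) \<bullet> e) (\<lambda>\<eta> y. (a \<eta> y *\<^sub>R dir \<eta>) \<bullet> e) t \<zeta> y" for t \<zeta> y and e :: "'n point"
  have fh: "is_fourier_transform S (h t) (H t)" for t
    using wf[OF pH profile_zero, of t 0] unfolding h_def[abs_def] H_def[abs_def] spec_def .
  have pu: "profile (\<lambda>\<eta> y. (b \<eta> y *\<^sub>R e_N) \<bullet> e)" "profile (\<lambda>\<eta> y. (a \<eta> y *\<^sub>R dir \<eta>) \<bullet> e)" for e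
    by (intro profile_inner profile_derivD(1)[OF u_cos_profile(1)] profile_derivD(1)[OF u_sin_profile(1)])+
  have fU: "is_fourier_transform S (\<lambda>x. u t (x, y) \<bullet> e) (\<lambda>\<zeta>. U t \<zeta> y e)" for t y e
  proof -
    have "u t (x, y) \<bullet> e = wave (\<lambda>\<eta> y. (b \<eta> y *\<^sub>R e_N) \<bullet> e) (\<lambda>\<eta> y. (a \<eta> y *\<^sub>R dir \<eta>) \<bullet> e) t (x, y)" for x
      unfolding u_def by (rule wave_bounded_linear[OF bounded_linear_inner_left profile_derivD(1)[OF u_cos_profile(1)] profile_derivD(1)[OF u_sin_profile(1)]])
    then show ?thesis using wf[OF pu(1)[of e] pu(2)[of e], of t y] unfolding U_def[abs_def] spec_def by simp
  qed
  have fp: "\<exists>P. is_fourier_transform S (\<lambda>x. p t (x, y)) P" for t y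
    using wf[OF pa(5) profile_zero, of t y] unfolding p_def by blast
  have pmH: "profile (\<lambda>\<eta> y. \<mu> \<eta> * Hf \<eta>)"
  proof -
    have "\<bar>\<mu> \<eta>\<bar> \<le> R ^ 3" if "\<eta> \<in> space M" for \<eta>
      using \<mu>[OF that] power_mono[OF R[OF that] norm_ge_zero, of 3] by simp
    from profile_scaleR[OF pH \<mu>m this] show ?thesis by simp
  qed
  \<comment> \<open>On the reflected frequencies the symbol appears as
    \<open>\<mu> (- \<zeta>)\<close>, and evenness turns it into
    \<open>\<mu> \<zeta>\<close>.\<close>
  have mult: "is_multiplier_image S \<mu> (h t) (\<lambda>x. wave (\<lambda>\<eta> y. \<mu> \<eta> * Hf \<eta>) (\<lambda>_ _. 0) t (x, L))" for t
  proof -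
    have "spectrum (space M) (\<lambda>\<eta>. exp (- lam \<eta> * t) * (\<mu> \<eta> * Hf \<eta>)) (\<lambda>\<eta>. exp (- lam \<eta> * t) * 0)
        = (\<lambda>\<zeta>. complex_of_real (\<mu> \<zeta>) * H t \<zeta>)"
    proof
      fix \<zeta>
      show "spectrum (space M) (\<lambda>\<eta>. exp (- lam \<eta> * t) * (\<mu> \<eta> * Hf \<eta>)) (\<lambda>\<eta>. exp (- lam \<eta> * t) * 0) \<zeta>
        = complex_of_real (\<mu> \<zeta>) * H t \<zeta>"
        using even[of "- \<zeta>"] by (auto simp: spectrum_def H_def spec_def Complex_eq algebra_simps)
    qed
    with wf[OF pmH profile_zero, of t L]
    have "is_fourier_transform S (\<lambda>x. wave (\<lambda>\<eta> y. \<mu> \<eta> * Hf \<eta>) (\<lambda>_ _. 0) t (x, L)) (\<lambda>\<zeta>. complex_of_real (\<mu> \<zeta>) * H t \<zeta>)"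
      by (simp only:)
    then show ?thesis
      unfolding is_multiplier_image_def using fh by blast
  qed
  have tor: "torus_conditions L u p h" if S: "S = Torus"
    unfolding torus_conditions_def
  proof (intro conjI allI impI ballI)
    have sub: "space M \<subseteq> dual_group Torus" using D S by simp
    fix t :: real
    show "u t (x + j, y) = u t (x, y)" "p t (x + j, y) = p t (x, y)" "h t (x + j) = h t x"
      if "j \<in> dual_group Torus" for j x y
      unfolding u_def p_def h_def by (simp_all add: wave_periodic[OF sub that])
    \<comment> \<open>The mean of \<open>h\<close> is its transform at 0, and 0 is not among the
      frequencies because there \<open>\<mu>\<close> is positive but at most
      \<open>norm \<eta> ^ 3\<close>.\<close>
    have "H t 0 = 0" using nz by (auto simp: H_def spec_def spectrum_def)
    moreover have "H t 0 = fourier_on (cbox 0 One) (h t) 0"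
      using fh[of t] unfolding S by (simp add: is_fourier_transform_def dual_group_def)
    moreover have "fourier_on (cbox 0 One) (h t) 0 = complex_of_real (LINT x:cbox 0 One|lebesgue. h t x)"
      unfolding fourier_on_def set_lebesgue_integral_def
      by (simp add: scaleR_conv_of_real flip: integral_complex_of_real)
    ultimately show "(LINT x:cbox 0 One|lebesgue. h t x) = 0" by simp
  qed
  have sol: "is_solution S L \<mu> u p h"
    by (rule superposition_is_solution) (use tor fp mult in auto)
  have spec_cont: "continuous_on X (\<lambda>(t, y). spec f g t \<zeta> y)" if "profile f" "profile g" for f g \<zeta> X
    unfolding spec_def by (rule spectrum_continuous[OF that order_refl])
  have tr: "horizontal_transforms S L u h U H"
    unfolding horizontal_transforms_def
  proof (intro conjI allI impI ballI fh fU)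
    fix \<zeta> :: "real^'n"
    have "continuous_on {0::real..} (\<lambda>t. (t, 0::real))" by (intro continuous_intros)
    from continuous_on_compose2[OF spec_cont[OF pH profile_zero, of UNIV \<zeta>] this]
    show "continuous_on {0..} (\<lambda>t. H t \<zeta>)" by (simp add: H_def)
    show "continuous_on ({0..} \<times> {0..L}) (\<lambda>(t, y). U t \<zeta> y e)" for e
      unfolding U_def by (rule spec_cont[OF pu])
  qed
  \<comment> \<open>Since \<open>- \<eta>\<close> is not a frequency, only one term of
    \<open>spectrum\<close> is present, so the time dependence is a pure exponential.\<close>
  have spec_exp: "spec f g t \<eta> y = exp (- lam \<eta> * t) * spec f g 0 \<eta> y" if "\<eta> \<in> space M" for f g t \<eta> y
    using that disj[OF that] by (simp add: spec_def spectrum_def Complex_eq algebra_simps)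
  have energy: "freq_energy L \<mu> U H \<eta> t = exp (- 2 * lam \<eta> * t) * freq_energy L \<mu> U H \<eta> 0" if "\<eta> \<in> space M" for \<eta> t
  proof -
    have e2: "(exp (- lam \<eta> * t))\<^sup>2 = exp (- 2 * lam \<eta> * t)" by (simp flip: exp_double)
    have n: "(cmod (spec f g t \<eta> y))\<^sup>2 = exp (- 2 * lam \<eta> * t) * (cmod (spec f g 0 \<eta> y))\<^sup>2" for f g y
      unfolding spec_exp[OF that, of f g t y] e2[symmetric] by (simp add: norm_mult power_mult_distrib)
    show ?thesis
      unfolding freq_energy_def U_def H_def n by (simp add: sum_distrib_left[symmetric] algebra_simps)
  qed
  have pos: "freq_energy L \<mu> U H \<eta> 0 > 0" if "\<eta> \<in> space M" for \<eta>
  proof -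
    have "H 0 \<eta> = complex_of_real (Hf \<eta> / 2)"
      using that disj[OF that] by (simp add: H_def spec_def spectrum_def Complex_eq)
    then have "(cmod (H 0 \<eta>))\<^sup>2 = (Hf \<eta> / 2)\<^sup>2" by (simp only: norm_of_real power2_abs)
    also have "\<dots> > 0" using nzH[OF that] by simp
    finally have "(cmod (H 0 \<eta>))\<^sup>2 > 0" .
    then have "\<mu> \<eta> / 2 * (cmod (H 0 \<eta>))\<^sup>2 > 0" using \<mu>(1)[OF that] by simp
    \<comment> \<open>A function that is not integrable has integral 0, so both cases give the
      sign.\<close>
    moreover have "integral {0..L} (\<lambda>y. \<Sum>b\<in>Basis. (cmod (U 0 \<eta> y b))\<^sup>2) \<ge> 0"
      by (cases "(\<lambda>y. \<Sum>b\<in>Basis. (cmod (U 0 \<eta> y b))\<^sup>2) integrable_on {0..L}")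
         (auto intro!: Henstock_Kurzweil_Integration.integral_nonneg sum_nonneg simp: not_integrable_integral)
    ultimately show ?thesis unfolding freq_energy_def by linarith
  qed
  have "slow_decay_at S L \<mu> 1 1 U H \<xi>"
    unfolding slow_decay_at_def
  proof (intro exI[of _ V] conjI V ballI allI impI)
    fix \<eta> assume "\<eta> \<in> V \<inter> dual_group S"
    then have \<eta>: "\<eta> \<in> space M" using D by simp
    show "freq_energy L \<mu> U H \<eta> 0 \<noteq> 0" using pos[OF \<eta>] by simp
    fix t :: real assume t: "0 \<le> t"
    \<comment> \<open>With \<open>k = 2 * pi * norm \<eta>\<close> the bound becomes
      \<open>\<mu> \<eta> / (pi * norm \<eta>)\<close>, and \<open>pi \<ge> 1\<close> leaves the
      constant 1.\<close>
    have "2 * lam \<eta> \<le> 2 * (\<mu> \<eta> / k \<eta>)" using lam(4)[OF \<eta>] by simp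
    also have "\<dots> \<le> \<mu> \<eta> / norm \<eta>"
    proof -
      have "1 \<le> pi" using pi_gt3 by simp
      then show ?thesis using \<mu>(1)[OF \<eta>] nz[OF \<eta>] by (simp add: k_def field_simps)
    qed
    finally have "2 * lam \<eta> * t \<le> \<mu> \<eta> / norm \<eta> * t" using t by (rule mult_right_mono)
    then have "exp (- 1 * (\<mu> \<eta> / norm \<eta>) * t) \<le> exp (- 2 * lam \<eta> * t)" by simp
    then show "1 * exp (- 1 * (\<mu> \<eta> / norm \<eta>) * t) * freq_energy L \<mu> U H \<eta> 0 \<le> freq_energy L \<mu> U H \<eta> t"
      unfolding energy[OF \<eta>, of t] mult_1 by (rule mult_right_mono[OF _ less_imp_le[OF pos[OF \<eta>]]])
  qed
  then show ?thesis using sol tr by blast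
qed

theorem theorem3p4:
  fixes S :: cross_section and L :: real and \<mu> :: "real^'n \<Rightarrow> real"
  assumes "L > 0"
    and "boundary_symbol S \<mu>"
    and "((\<lambda>\<xi>. \<mu> \<xi> / norm \<xi> ^ 3) \<longlongrightarrow> 0) (freq_at_infinity S)"
    and "Liminf (freq_at_infinity S) (\<lambda>\<xi>. ereal (\<mu> \<xi>)) > 0"
  shows "\<exists>c1>0. \<exists>c2>0. \<forall>\<^sub>F \<xi> in freq_at_infinity S.
           \<exists>u p h U H.
             is_solution S L \<mu> u p h \<and>
             horizontal_transforms S L u h U H \<and>
             slow_decay_at S L \<mu> c1 c2 U H \<xi>"
proof -
  have \<mu>_pos: "\<And>\<xi>. \<xi> \<in> dual_group S \<Longrightarrow> 0 < \<mu> \<xi>"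
    using assms(2) unfolding boundary_symbol_def by (meson less_le_trans)
  have even: "\<And>\<xi>. \<xi> \<in> dual_group S \<Longrightarrow> \<mu> (- \<xi>) = \<mu> \<xi>"
    and \<mu>_meas: "\<mu> \<in> borel_measurable (restrict_space lebesgue (dual_group S))"
    using assms(2) unfolding boundary_symbol_def by blast+
  have "\<forall>\<^sub>F \<xi> in freq_at_infinity S. \<mu> \<xi> / norm \<xi> ^ 3 < 1"
    using order_tendstoD(2)[OF assms(3), of 1] by simp
  then obtain B where B: "\<And>\<xi>. norm \<xi> \<ge> B \<Longrightarrow> \<xi> \<in> dual_group S \<Longrightarrow> \<mu> \<xi> / norm \<xi> ^ 3 < 1"
    unfolding freq_at_infinity_def eventually_inf_principal eventually_at_infinity by blast
  \<comment> \<open>The margin 2 keeps all frequencies within distance 1/2 of \<open>\<xi>\<close>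
    beyond the threshold \<open>B\<close> and away from 0.\<close>
  have sol: "\<exists>u p h U H. is_solution S L \<mu> u p h \<and> horizontal_transforms S L u h U H \<and> slow_decay_at S L \<mu> 1 1 U H \<xi>"
    if big: "norm \<xi> \<ge> \<bar>B\<bar> + 2" and \<xi>: "\<xi> \<in> dual_group S" for \<xi>
  proof -
    \<comment> \<open>Radius 1/2 is small enough to isolate an integer vector in its lattice and, as
      \<open>norm \<xi> \<ge> 2\<close>, to keep the ball disjoint from its reflection.\<close>
    define V where "V = ball \<xi> (1 / 2)"
    have near: "\<bar>B\<bar> + 1 \<le> norm \<eta>" "norm \<eta> \<le> norm \<xi> + 1" if "\<eta> \<in> V" for \<eta>
    proof -
      have "norm (\<xi> - \<eta>) < 1 / 2" using that by (simp add: V_def dist_norm)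
      then show "\<bar>B\<bar> + 1 \<le> norm \<eta>" "norm \<eta> \<le> norm \<xi> + 1"
        using big norm_triangle_ineq2[of \<xi> \<eta>] norm_triangle_ineq3[of \<xi> \<eta>] by linarith+
    qed
    have small: "\<mu> \<eta> \<le> norm \<eta> ^ 3" if "\<eta> \<in> V" "\<eta> \<in> dual_group S" for \<eta>
    proof -
      have "norm \<eta> \<ge> B" "0 < norm \<eta>" using near(1)[OF that(1)] by linarith+
      then show ?thesis using B[OF _ that(2)] by (simp add: pos_divide_less_eq)
    qed
    have disj: "- \<eta> \<notin> V" if "\<eta> \<in> V" for \<eta>
    proof
      assume "- \<eta> \<in> V"
      then have "norm (\<xi> + \<eta>) < 1 / 2" "norm (\<xi> - \<eta>) < 1 / 2" using that by (simp_all add: V_def dist_norm)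
      moreover have "2 * norm \<xi> \<le> norm (\<xi> + \<eta>) + norm (\<xi> - \<eta>)"
      proof -
        have "(\<xi> + \<eta>) + (\<xi> - \<eta>) = 2 *\<^sub>R \<xi>" by (simp add: scaleR_2)
        then have "norm ((\<xi> + \<eta>) + (\<xi> - \<eta>)) = 2 * norm \<xi>" by (simp only: norm_scaleR abs_numeral)
        then show ?thesis using norm_triangle_ineq[of "\<xi> + \<eta>" "\<xi> - \<eta>"] by simp
      qed
      ultimately show False using big by linarith
    qed
    show ?thesis
    proof (cases S)
      case Euclidean
      have du: "dual_group S = (UNIV :: (real^'n) set)" by (simp add: Euclidean dual_group_def)
      have Vl: "V \<in> sets lebesgue" "emeasure lebesgue V < \<infinity>"
        unfolding V_def using emeasure_lborel_ball_finite[of \<xi> "1 / 2"] by simp_all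
      show ?thesis
      \<comment> \<open>Lebesgue measure on the ball: the resulting fields are square integrable by
        Plancherel, as the transform on the whole space requires.\<close>
      proof (rule slow_solution[where M = "lebesgue_on V" and V = V and R = "norm \<xi> + 1"])
        show "finite_measure (lebesgue_on V)"
          using Vl by (intro finite_measureI) (simp add: emeasure_restrict_space)
        show "(\<lambda>\<eta>. \<eta>) \<in> borel_measurable (lebesgue_on V)"
          by (intro measurable_restrict_space1 measurable_completion) simp
        show "\<mu> \<in> borel_measurable (lebesgue_on V)"
          using \<mu>_meas unfolding du by (intro measurable_restrict_space1) simp
        show "has_spectral_transforms S (lebesgue_on V)"
          unfolding Euclidean by (rule has_spectral_transforms_Euclidean[OF Vl])
      qed (use assms(1) \<mu>_pos even small disj near du in \<open>auto simp: V_def\<close>)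
    next
      case Torus
      have only: "V \<inter> dual_group S = {\<xi>}"
      proof -
        have "\<eta> = \<xi>" if "\<eta> \<in> V" "\<eta> \<in> dual_group S" for \<eta>
        proof (rule vec_eq_iff[THEN iffD2], rule allI)
          fix i
          have "\<xi> $ i \<in> \<int>" "\<eta> $ i \<in> \<int>" using that \<xi> by (auto simp: Torus dual_group_def)
          moreover have "\<bar>\<xi> $ i - \<eta> $ i\<bar> < 1"
            using component_le_norm_cart[of "\<xi> - \<eta>" i] that(1) by (simp add: V_def dist_norm)
          ultimately show "\<eta> $ i = \<xi> $ i" by (simp add: Ints_eq_abs_less1 abs_minus_commute)
        qed
        then show ?thesis using \<xi> by (auto simp: V_def)
      qed
      have \<xi>V: "\<xi> \<in> V" by (simp add: V_def)
      show ?thesis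
      \<comment> \<open>A point mass gives a single periodic wave, and every function on the
        one-point space is measurable.\<close>
      proof (rule slow_solution[where M = "count_space {\<xi>}" and V = V and R = "norm \<xi> + 1"])
        show "finite_measure (count_space {\<xi>})" by (rule finite_measure_count_space) simp
        show "has_spectral_transforms S (count_space {\<xi>})"
          using \<xi> unfolding Torus by (rule has_spectral_transforms_Torus)
        show "space (count_space {\<xi>}) = V \<inter> dual_group S" using only by simp
        have "- \<xi> \<noteq> \<xi>" using disj[OF \<xi>V] \<xi>V by metis
        then show "- \<eta> \<notin> space (count_space {\<xi>})" if "\<eta> \<in> space (count_space {\<xi>})" for \<eta>
          using that by simp
      qed (use assms(1) \<mu>_pos even small \<xi>V \<xi> in \<open>auto simp: V_def\<close>)
    qed
  qed
  have "\<forall>\<^sub>F \<xi> in freq_at_infinity S. \<exists>u p h U H. is_solution S L \<mu> u p h \<and> horizontal_transforms S L u h U H \<and> slow_decay_at S L \<mu> 1 1 U H \<xi>"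
    unfolding freq_at_infinity_def eventually_inf_principal eventually_at_infinity
    using sol by blast
  then show ?thesis by (intro exI[of _ 1] conjI) simp_all
qed

end
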